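(* Let $0<H<1$ and $0<K<1$ be such that $2HK>1$. For $x,y>0$ with $x\ne y$ let $$g(x,y)=2^{2-K}H^2K(K-1)(x^{2H}+y^{2H})^{K-2}(xy)^{2H-1}+2^{1-K}HK(2HK-1)|x-y|^{2HK-2}.$$ Let $(\xi_j,\ j=1,2,\dots)$ be a jointly Gaussian sequence of standard normal random variables such that $E[\xi_i\xi_j]=g(i,j)$ for all $i\ne j$. Let $f:\mathbb{R}\to\mathbb{R}$ be a measurable function such that $\{x: f(x)\neq 0\}$ has positive Lebesgue measure, $E[f(\xi_1)]=0$, $E[(f(\xi_1))^2]<\infty$, and $$c_1:=E[f(\xi_1)\xi_1]\ne0.$$ Put $\eta_j=f(\xi_j)$, $j=1,2,\dots$. Then, as $n\to\infty$, the processes $$\left(n^{-HK}\sum_{j=1}^{[nt]}\eta_j,\ t\ge0\right)$$ converge, in the sense of all finite dimensional distributions, to $\left(c_1B^{H,K}_t,\ t\ge 0\right)$, where $B^{H,K}$ is a bifractional Brownian motion with parameters $H,K$.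
   Context: For $H\in(0,1)$, $K\in(0,1]$, the bifractional Brownian motion $B^{H,K}=(B^{H,K}_t,\ t\ge0)$ is the centered Gaussian process with covariance $E[B^{H,K}_tB^{H,K}_s]=2^{-K}\left((t^{2H}+s^{2H})^K-|t-s|^{2HK}\right)$. $[x]$ denotes the integer part of $x$; empty sums are $0$. The number $c_1$ is the coefficient of the first Hermite polynomial $H_1(x)=x$ in the Hermite expansion $f=\sum_{k\ge1}c_kH_k$ of $f$ with respect to the standard Gaussian measure, where $H_k$ is the $k$-th Hermite polynomial with leading coefficient $1$. *)

theory Defs
  imports "HOL-Probability.Probability"
begin

text \<open>Univariate normal laws, including the degenerate ones (\<open>normal_density m 0\<close> is the zero function
  and not the density of a point mass).\<close>

definition normal_law :: "real \<Rightarrow> real \<Rightarrow> real measure" where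
  "normal_law m \<sigma> = (if \<sigma> = 0 then return borel m else density lborel (\<lambda>x. ennreal (normal_density m \<sigma> x)))"

definition gaussian_rv :: "'a measure \<Rightarrow> ('a \<Rightarrow> real) \<Rightarrow> bool" where
  "gaussian_rv M X \<longleftrightarrow> X \<in> borel_measurable M \<and> (\<exists>m \<sigma>. \<sigma> \<ge> 0 \<and> distr M borel X = normal_law m \<sigma>)"

text \<open>The index set \<open>T\<close> is explicit, so this covers both jointly Gaussian sequences and Gaussian
  processes in continuous time; the values of \<open>X\<close> outside \<open>T\<close> are irrelevant.\<close>

definition gaussian_process :: "'a measure \<Rightarrow> 'i set \<Rightarrow> ('i \<Rightarrow> 'a \<Rightarrow> real) \<Rightarrow> bool" where
  "gaussian_process M T X \<longleftrightarrow>
     prob_space M \<and>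
     (\<forall>J a. finite J \<and> J \<subseteq> T \<longrightarrow> gaussian_rv M (\<lambda>\<omega>. \<Sum>j\<in>J. a j * X j \<omega>))"

text \<open>All bases of real powers below are nonnegative and all exponents applied to a base that may vanish
  are positive, so \<open>0 powr p = 0\<close> is the usual convention.\<close>

definition bifractional_cov :: "real \<Rightarrow> real \<Rightarrow> real \<Rightarrow> real \<Rightarrow> real" where
  "bifractional_cov H K t s =
     2 powr (- K) * ((t powr (2 * H) + s powr (2 * H)) powr K - \<bar>t - s\<bar> powr (2 * H * K))"

definition bifractional_brownian_motion ::
  "real \<Rightarrow> real \<Rightarrow> 'a measure \<Rightarrow> (real \<Rightarrow> 'a \<Rightarrow> real) \<Rightarrow> bool" where
  "bifractional_brownian_motion H K M B \<longleftrightarrow>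
     0 < H \<and> H < 1 \<and> 0 < K \<and> K \<le> 1 \<and>
     gaussian_process M {0..} B \<and>
     (\<forall>t\<ge>0. (\<integral>\<omega>. B t \<omega> \<partial>M) = 0) \<and>
     (\<forall>t\<ge>0. \<forall>s\<ge>0. (\<integral>\<omega>. B t \<omega> * B s \<omega> \<partial>M) = bifractional_cov H K t s)"

definition g_kernel :: "real \<Rightarrow> real \<Rightarrow> real \<Rightarrow> real \<Rightarrow> real" where
  "g_kernel H K x y =
     2 powr (2 - K) * H\<^sup>2 * K * (K - 1) * (x powr (2 * H) + y powr (2 * H)) powr (K - 2)
       * (x * y) powr (2 * H - 1)
     + 2 powr (1 - K) * H * K * (2 * H * K - 1) * \<bar>x - y\<bar> powr (2 * H * K - 2)"

text \<open>Weak convergence of measures on a topological space: convergence of the integrals of all bounded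
  continuous test functions.  The notion \<open>weak_conv_m\<close> of the library is limited to the real line.\<close>

definition weak_conv_on :: "'a topology \<Rightarrow> (nat \<Rightarrow> 'a measure) \<Rightarrow> 'a measure \<Rightarrow> bool" where
  "weak_conv_on S \<mu> \<nu> \<longleftrightarrow>
     (\<forall>\<phi>. continuous_map S euclideanreal \<phi> \<and> bounded (\<phi> ` topspace S) \<longrightarrow>
        (\<lambda>n. \<integral>x. \<phi> x \<partial>\<mu> n) \<longlonglongrightarrow> (\<integral>x. \<phi> x \<partial>\<nu>))"

text \<open>The joint law of \<open>(X\<^sub>t, t \<in> J)\<close>, a measure on the space \<open>J \<rightarrow>\<^sub>E \<real>\<close>.\<close>

definition fin_dim_distr :: "'a measure \<Rightarrow> (real \<Rightarrow> 'a \<Rightarrow> real) \<Rightarrow> real set \<Rightarrow> (real \<Rightarrow> real) measure" where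
  "fin_dim_distr M X J = distr M (\<Pi>\<^sub>M t\<in>J. borel) (\<lambda>\<omega>. \<lambda>t\<in>J. X t \<omega>)"

definition fdd_converges ::
  "real set \<Rightarrow> 'a measure \<Rightarrow> (nat \<Rightarrow> real \<Rightarrow> 'a \<Rightarrow> real) \<Rightarrow> 'b measure \<Rightarrow> (real \<Rightarrow> 'b \<Rightarrow> real) \<Rightarrow> bool" where
  "fdd_converges T M X N Y \<longleftrightarrow>
     (\<forall>J. finite J \<and> J \<subseteq> T \<longrightarrow>
        weak_conv_on (product_topology (\<lambda>_. euclideanreal) J)
          (\<lambda>n. fin_dim_distr M (X n) J) (fin_dim_distr N Y J))"

end

(* Write f = c1 x + h, where h is orthogonal to 1 and x in the standard Gaussian L^2 space. The part of the
   process that comes from c1 x is Gaussian, and its covariance function converges: the double sums of g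
   differ from those of the unit-increment covariances of the bifractional Brownian motion, which telescope,
   by o(n^(2HK)), since g is the mixed second derivative of the limit covariance and is homogeneous of degree
   2HK - 2. The part that comes from h vanishes in L^2, because |E h(xi_i) h(xi_j)| = O(g(i,j)^2)
   (Mehler's formula) and 2HK > 1. Finite dimensional convergence is reduced to that of characteristic functions
   by approximating bounded continuous functions by trigonometric polynomials (Stone-Weierstrass on a torus). *)
theory Submission
  imports Defs
begin

section \<open>Trigonometric polynomials and the Cramer--Wold device\<close>

text \<open>The double sum of g resembles a Riemann sum for a kernel that blows up on the diagonal.
  Comparing it term by term with second differences of the covariance avoids any singular integral:
  those telescope exactly, and the comparison has to be accurate only away from the diagonal, where
  rescaling by 1/n leads to uniform continuity on a compact set. The band of pairs at distance at
  most \<delta> n costs a multiple of \<delta>^(2HK-1) n^(2HK), which is small because 2HK > 1; the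
  diagonal costs O(n), again o(n^(2HK)). The same band argument serves the sums of squares that
  control h.

  Joint normality is given through linear combinations only, so the density of a pair has to be
  derived first, by way of characteristic functions. No Hermite series is summed for h: since h is
  orthogonal to 1 and x, the first two terms of Mehler's expansion can be subtracted from the joint
  density, and the weighted L^2 norm of the rest is explicit.\<close>

inductive_set trig_poly :: "'i set \<Rightarrow> (('i \<Rightarrow> real) \<Rightarrow> complex) set" for J where
  trig_exp: "(\<lambda>x. c * iexp (\<Sum>i\<in>J. a i * x i)) \<in> trig_poly J"
| trig_add: "p \<in> trig_poly J \<Longrightarrow> q \<in> trig_poly J \<Longrightarrow> (\<lambda>x. p x + q x) \<in> trig_poly J"

text \<open>Frequencies add under multiplication. Closure under products makes the pullbacks in
  \<open>trig_approx_periodic\<close> a ring, as Stone-Weierstrass requires.\<close>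

lemma trig_mult:
  assumes "p \<in> trig_poly J" "q \<in> trig_poly J"
  shows "(\<lambda>x. p x * q x) \<in> trig_poly J"
  using assms
proof (induction arbitrary: q)
  case (trig_exp c a)
  from this show ?case
  proof (induction)
    case (trig_exp d b)
    have "(\<lambda>x. c * iexp (\<Sum>i\<in>J. a i * x i) * (d * iexp (\<Sum>i\<in>J. b i * x i))) =
        (\<lambda>x. (c * d) * iexp (\<Sum>i\<in>J. (a i + b i) * x i))"
      by (simp add: fun_eq_iff distrib_right sum.distrib exp_add distrib_left)
    then show ?case by (simp only: trig_poly.trig_exp)
  next
    case (trig_add p q)
    then show ?case by (simp add: distrib_left trig_poly.trig_add)
  qed
next
  case (trig_add p q)
  then show ?case by (simp add: distrib_right trig_poly.trig_add)
qed

lemma trig_const: "(\<lambda>x. c) \<in> trig_poly J"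
  using trig_exp[of c "\<lambda>_. 0" J] by simp

lemma trig_coordinate:
  assumes "finite J" "j \<in> J"
  shows "(\<lambda>x. c * iexp (b * x j)) \<in> trig_poly J"
  using trig_exp[of c "\<lambda>i. if i = j then b else 0" J] assms
  by (simp add: if_distrib[of "\<lambda>z. z * _"] cong: if_cong)

lemma trig_poly_measurable [measurable]:
  fixes p :: "('i \<Rightarrow> real) \<Rightarrow> complex"
  assumes "p \<in> trig_poly J"
  shows "p \<in> borel_measurable (\<Pi>\<^sub>M i\<in>J. borel)"
  using assms by induction auto

lemma abs_arcsin_sin: "\<bar>x\<bar> \<le> pi / 2 \<Longrightarrow> arcsin (sin x) = x"
  by (rule arcsin_sin) auto

text \<open>On the box \<open>\<bar>c * x i\<bar> \<le> 1\<close> this makes every cut-off factor on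
  the torus equal to 1, so that the periodic function reproduces \<phi> there.\<close>

lemma cos_ge_half:
  fixes x :: real
  assumes "\<bar>x\<bar> \<le> 1"
  shows "1 / 2 \<le> cos x"
proof -
  have "cos (pi / 3) \<le> cos \<bar>x\<bar>"
    using assms pi_gt3 by (intro cos_monotone_0_pi_le) auto
  then show ?thesis by (simp add: cos_60)
qed

lemma compact_torus: "compact (PiE J (\<lambda>_. sphere 0 1) :: (nat \<Rightarrow> complex) set)"
proof -
  \<comment> \<open>\<open>PiE\<close> fixes the coordinates outside \<open>J\<close> to
    \<open>undefined\<close>. In a product over all of \<open>nat\<close> they become one-point
    factors, and Tychonoff's theorem applies.\<close>
  let ?T = "\<lambda>i. if i \<in> J then sphere 0 1 else {undefined :: complex}"
  have "compactin (product_topology (\<lambda>i. euclidean) UNIV) (PiE UNIV ?T)"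
    by (subst compactin_PiE) auto
  moreover have "PiE UNIV ?T = PiE J (\<lambda>_. sphere 0 1)"
    by (auto simp: PiE_def Pi_def extensional_def split: if_splits)
  ultimately show ?thesis
    by (simp add: euclidean_product_topology)
qed

text \<open>Continuous functions on the torus are approximated by trigonometric polynomials; the angle
  \<open>arcsin (Im z\<^sub>i)\<close> is the correct one on the right half circle, and the factors
  \<open>min 1 (max 0 (2 * Re z\<^sub>i))\<close> remove the rest.\<close>

lemma trig_approx_periodic:
  fixes \<phi> :: "('i \<Rightarrow> real) \<Rightarrow> real"
  assumes J: "finite J" and \<phi>: "continuous_map (product_topology (\<lambda>_. euclideanreal) J) euclideanreal \<phi>"
    and b: "\<And>x. x \<in> PiE J (\<lambda>_. UNIV) \<Longrightarrow> \<bar>\<phi> x\<bar> \<le> b" and c: "c > 0" and e: "e > 0"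
  obtains F p where "p \<in> trig_poly J" "\<And>x. x \<in> PiE J (\<lambda>_. UNIV) \<Longrightarrow> cmod (of_real (F x) - p x) \<le> e"
    "\<And>x. x \<in> PiE J (\<lambda>_. UNIV) \<Longrightarrow> \<bar>F x\<bar> \<le> b"
    "\<And>x. x \<in> PiE J (\<lambda>_. UNIV) \<Longrightarrow> (\<And>i. i \<in> J \<Longrightarrow> \<bar>c * x i\<bar> \<le> 1) \<Longrightarrow> F x = \<phi> x"
proof -
  \<comment> \<open>The finitely many indices are renamed to natural numbers: functions on the
    countable type \<open>nat\<close> form a metric space, in which the torus is a compact
    set.\<close>
  obtain e' :: "'i \<Rightarrow> nat" where inj: "inj_on e' J"
    using finite_imp_inj_to_nat_seg[OF J] by auto
  let ?S = "PiE (e' ` J) (\<lambda>_. sphere 0 1) :: (nat \<Rightarrow> complex) set"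
  define E where "E = (\<lambda>x::'i \<Rightarrow> real. \<lambda>k\<in>e' ` J. iexp (c * x (inv_into J e' k)))"
  have E: "E x (e' i) = iexp (c * x i)" if "i \<in> J" for x i
    using that inj by (simp add: E_def inv_into_f_f)
  \<comment> \<open>\<open>E\<close> winds \<open>x\<close> around the torus. Membership in
    \<open>R\<close> is phrased through the pullback along \<open>E\<close>, so that the ring axioms
    reduce to closure of \<open>trig_poly\<close> and the approximant found in \<open>R\<close>
    directly hands over the trigonometric polynomial \<open>p\<close>.\<close>
  define R where "R = {f :: (nat \<Rightarrow> complex) \<Rightarrow> real. continuous_on ?S f \<and>
    (\<exists>p\<in>trig_poly J. \<forall>x. complex_of_real (f (E x)) = p x)}"
  define D where "D = (\<lambda>z::nat \<Rightarrow> complex. \<lambda>i\<in>J. arcsin (Im (z (e' i))) / c)"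
  define \<psi> where "\<psi> = (\<lambda>z. \<phi> (D z) * (\<Prod>i\<in>J. min 1 (max 0 (2 * Re (z (e' i))))))"
  have E_in: "E x \<in> ?S" for x by (auto simp: E_def)
  have cont_coord: "continuous_on ?S (\<lambda>z. z i)" for i
    by (rule continuous_on_subset[OF continuous_on_product_coordinates]) auto
  interpret function_ring_on R ?S
  proof
    show "compact ?S" by (rule compact_torus)
    show "continuous_on ?S f" if "f \<in> R" for f using that by (simp add: R_def)
    fix f g assume "f \<in> R" "g \<in> R"
    then obtain p q where pq: "p \<in> trig_poly J" "\<forall>x. complex_of_real (f (E x)) = p x" "continuous_on ?S f"
      "q \<in> trig_poly J" "\<forall>x. complex_of_real (g (E x)) = q x" "continuous_on ?S g"
      unfolding R_def by auto
    show "(\<lambda>x. f x + g x) \<in> R"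
      unfolding R_def using pq
      by (auto intro!: continuous_intros bexI[of _ "\<lambda>x. p x + q x"] trig_add)
    show "(\<lambda>x. f x * g x) \<in> R"
      unfolding R_def using pq
      by (auto intro!: continuous_intros bexI[of _ "\<lambda>x. p x * q x"] trig_mult)
  next
    show "(\<lambda>_. d) \<in> R" for d unfolding R_def by (auto intro!: bexI[OF _ trig_const])
  next
    fix z w assume zw: "z \<in> ?S" "w \<in> ?S" "z \<noteq> w"
    then obtain k where k: "k \<in> e' ` J" "z k \<noteq> w k" by (metis PiE_ext)
    then obtain j where j: "j \<in> J" "z (e' j) \<noteq> w (e' j)" by auto
    have re: "(\<lambda>z. Re (z (e' j))) \<in> R"
    proof -
      have "complex_of_real (Re (E x (e' j))) = 1/2 * iexp (c * x j) + 1/2 * iexp ((- c) * x j)" for x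
        using j by (auto simp: E complex_eq_iff Re_exp Im_exp)
      moreover have "(\<lambda>x. 1/2 * iexp (c * x j) + 1/2 * iexp ((- c) * x j)) \<in> trig_poly J"
        by (intro trig_add trig_coordinate J j)
      moreover have "continuous_on ?S (\<lambda>z. Re (z (e' j)))"
        by (intro continuous_intros cont_coord)
      ultimately show ?thesis
        unfolding R_def mem_Collect_eq by (intro conjI bexI allI)
    qed
    have im: "(\<lambda>z. Im (z (e' j))) \<in> R"
    proof -
      have "complex_of_real (Im (E x (e' j))) = (- \<i>/2) * iexp (c * x j) + (\<i>/2) * iexp ((- c) * x j)" for x
        using j by (auto simp: E complex_eq_iff Re_exp Im_exp)
      moreover have "(\<lambda>x. (- \<i>/2) * iexp (c * x j) + (\<i>/2) * iexp ((- c) * x j)) \<in> trig_poly J"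
        by (intro trig_add trig_coordinate J j)
      moreover have "continuous_on ?S (\<lambda>z. Im (z (e' j)))"
        by (intro continuous_intros cont_coord)
      ultimately show ?thesis
        unfolding R_def mem_Collect_eq by (intro conjI bexI allI)
    qed
    from j have "Re (z (e' j)) \<noteq> Re (w (e' j)) \<or> Im (z (e' j)) \<noteq> Im (w (e' j))" by (auto simp: complex_eq_iff)
    then show "\<exists>f\<in>R. f z \<noteq> f w"
      by (elim disjE) (rule bexI[OF _ re], assumption, rule bexI[OF _ im])
  qed
  have "continuous_on ?S \<psi>"
  proof -
    have "continuous_map (top_of_set ?S) (product_topology (\<lambda>_. euclideanreal) J) D"
      unfolding continuous_map_componentwise
    proof (intro conjI ballI)
      show "D ` topspace (top_of_set ?S) \<subseteq> extensional J" by (auto simp: D_def)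
      fix k assume k: "k \<in> J"
      have "-1 \<le> Im (z (e' k)) \<and> Im (z (e' k)) \<le> 1" if "z \<in> ?S" for z
      proof -
        from that k have "cmod (z (e' k)) = 1" by (auto simp: PiE_def Pi_def)
        then show ?thesis using abs_Im_le_cmod[of "z (e' k)"] by linarith
      qed
      then have "continuous_on ?S (\<lambda>z. arcsin (Im (z (e' k))) / c)"
        using c by (intro continuous_intros cont_coord) auto
      then show "continuous_map (top_of_set ?S) euclideanreal (\<lambda>z. D z k)"
        using k by (simp add: D_def)
    qed
    from continuous_map_compose[OF this \<phi>] have "continuous_on ?S (\<lambda>z. \<phi> (D z))"
      by (simp add: comp_def)
    then show ?thesis
      unfolding \<psi>_def by (intro continuous_intros cont_coord)
  qed
  from Stone_Weierstrass_basic[OF this e] obtain g where g: "g \<in> R" "\<And>z. z \<in> ?S \<Longrightarrow> \<bar>\<psi> z - g z\<bar> < e"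
    by auto
  from g(1) obtain p where p: "p \<in> trig_poly J" "\<And>x. complex_of_real (g (E x)) = p x"
    unfolding R_def by auto
  show ?thesis
  proof
    show "p \<in> trig_poly J" by fact
    fix x :: "'i \<Rightarrow> real" assume x: "x \<in> PiE J (\<lambda>_. UNIV)"
    show "cmod (of_real (\<psi> (E x)) - p x) \<le> e"
      using g(2)[OF E_in, of x] by (simp flip: p(2) of_real_diff)
    have "\<bar>\<Prod>i\<in>J. min 1 (max 0 (2 * Re (E x (e' i))))\<bar> \<le> 1"
      by (subst abs_prod) (auto intro!: prod_le_1)
    moreover have "\<bar>\<phi> (D (E x))\<bar> \<le> b" by (rule b) (auto simp: D_def)
    ultimately have "\<bar>\<phi> (D (E x))\<bar> * \<bar>\<Prod>i\<in>J. min 1 (max 0 (2 * Re (E x (e' i))))\<bar> \<le> b * 1"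
      by (intro mult_mono) auto
    then show "\<bar>\<psi> (E x)\<bar> \<le> b" unfolding \<psi>_def abs_mult by simp
    assume *: "\<And>i. i \<in> J \<Longrightarrow> \<bar>c * x i\<bar> \<le> 1"
    have "D (E x) = x"
    proof
      fix i
      show "D (E x) i = x i"
      proof (cases "i \<in> J")
      case True
      then have "\<bar>c * x i\<bar> \<le> pi / 2" using *[of i] pi_gt3 by linarith
      then show ?thesis using True c by (simp add: D_def E Im_exp abs_arcsin_sin)
    next
      case False
      then show ?thesis using x by (auto simp: D_def PiE_def extensional_def)
    qed
    qed
    moreover have "(\<Prod>i\<in>J. min 1 (max 0 (2 * Re (E x (e' i))))) = 1"
    proof (intro prod.neutral ballI)
      fix i assume "i \<in> J"
      then show "min 1 (max 0 (2 * Re (E x (e' i)))) = 1"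
        using cos_ge_half[OF *[of i]] by (simp add: E Re_exp)
    qed
    ultimately show "\<psi> (E x) = \<phi> x" by (simp add: \<psi>_def)
  qed
qed

text \<open>Outside the box \<open>\<bar>c * x\<^sub>i\<bar> \<le> 1\<close> the error is at most \<open>2 * b\<close>, hence at most
  \<open>2 * b * c\<^sup>2 * (\<Sum>i\<in>J. (x\<^sub>i)\<^sup>2)\<close>.\<close>

lemma trig_approx:
  fixes \<phi> :: "('i \<Rightarrow> real) \<Rightarrow> real"
  assumes J: "finite J" and \<phi>: "continuous_map (product_topology (\<lambda>_. euclideanreal) J) euclideanreal \<phi>"
    and b: "\<And>x. x \<in> PiE J (\<lambda>_. UNIV) \<Longrightarrow> \<bar>\<phi> x\<bar> \<le> b" and e: "e > 0"
  obtains p where "p \<in> trig_poly J"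
    "\<And>x. x \<in> PiE J (\<lambda>_. UNIV) \<Longrightarrow> cmod (of_real (\<phi> x) - p x) \<le> e * (1 + (\<Sum>i\<in>J. (x i)\<^sup>2))"
proof -
  have b0: "b \<ge> 0" using b[of "\<lambda>i\<in>J. 0"] by force
  \<comment> \<open>Outside the box some \<open>(c * x j)\<^sup>2\<close> exceeds 1 while the error
    is at most \<open>2 * b\<close>, so \<open>2 * b * c\<^sup>2 \<le> e\<close> is what is wanted.
    The summand 1 keeps the quotient meaningful for \<open>b = 0\<close>.\<close>
  define c where "c = sqrt (e / (2 * b + 1))"
  have c: "c > 0" "c\<^sup>2 = e / (2 * b + 1)" using b0 e by (auto simp: c_def)
  have c2: "2 * b * c\<^sup>2 \<le> e"
  proof -
    have "2 * b * c\<^sup>2 \<le> (2 * b + 1) * c\<^sup>2" by (simp add: distrib_right)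
    also have "\<dots> = e" using b0 by (simp add: c(2))
    finally show ?thesis .
  qed
  obtain F p where p: "p \<in> trig_poly J"
    and F: "\<And>x. x \<in> PiE J (\<lambda>_. UNIV) \<Longrightarrow> cmod (of_real (F x) - p x) \<le> e"
    "\<And>x. x \<in> PiE J (\<lambda>_. UNIV) \<Longrightarrow> \<bar>F x\<bar> \<le> b"
    "\<And>x. x \<in> PiE J (\<lambda>_. UNIV) \<Longrightarrow> (\<And>i. i \<in> J \<Longrightarrow> \<bar>c * x i\<bar> \<le> 1) \<Longrightarrow> F x = \<phi> x"
    by (rule trig_approx_periodic[OF J \<phi> b c(1) e]; blast)
  show ?thesis
  proof
    show "p \<in> trig_poly J" by fact
    fix x :: "'i \<Rightarrow> real" assume x: "x \<in> PiE J (\<lambda>_. UNIV)"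
    have "\<bar>\<phi> x - F x\<bar> \<le> e * (\<Sum>i\<in>J. (x i)\<^sup>2)"
    proof (cases "\<forall>i\<in>J. \<bar>c * x i\<bar> \<le> 1")
      case True
      then show ?thesis using F(3)[OF x] e by (simp add: sum_nonneg)
    next
      case False
      then obtain j where j: "j \<in> J" "1 < \<bar>c * x j\<bar>" by force
      then have "1 \<le> (c * x j)\<^sup>2" by (metis abs_le_square_iff abs_1 less_imp_le one_power2)
      then have "2 * b * 1 \<le> 2 * b * (c * x j)\<^sup>2" using b0 by (intro mult_left_mono) auto
      also have "\<dots> = (2 * b * c\<^sup>2) * (x j)\<^sup>2" by (simp add: power_mult_distrib)
      also have "\<dots> \<le> e * (\<Sum>i\<in>J. (x i)\<^sup>2)"
        using j J c2 e by (intro mult_mono member_le_sum) auto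
      finally show ?thesis using b[OF x] F(2)[OF x] by linarith
    qed
    moreover have "cmod (of_real (\<phi> x) - p x) \<le> cmod (of_real (\<phi> x - F x)) + cmod (of_real (F x) - p x)"
      using norm_triangle_ineq[of "of_real (\<phi> x - F x)" "of_real (F x) - p x"] by simp
    ultimately show "cmod (of_real (\<phi> x) - p x) \<le> e * (1 + (\<Sum>i\<in>J. (x i)\<^sup>2))"
      using F(1)[OF x] unfolding norm_of_real by (simp add: distrib_left)
  qed
qed

text \<open>\<open>trig_approx\<close> with tolerance 1/(n+1) exhibits \<phi> as a pointwise limit
  of trigonometric polynomials, which are measurable by inspection. This bypasses a comparison of
  the product sigma-algebra with the Borel sets of the product topology.\<close>

lemma measurable_PiM_continuous_map:
  fixes \<phi> :: "('i \<Rightarrow> real) \<Rightarrow> real"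
  assumes J: "finite J" and \<phi>: "continuous_map (product_topology (\<lambda>_. euclideanreal) J) euclideanreal \<phi>"
    and b: "\<And>x. x \<in> PiE J (\<lambda>_. UNIV) \<Longrightarrow> \<bar>\<phi> x\<bar> \<le> b"
  shows "\<phi> \<in> borel_measurable (\<Pi>\<^sub>M i\<in>J. borel)"
proof -
  have "\<exists>p\<in>trig_poly J. \<forall>x\<in>PiE J (\<lambda>_. UNIV).
      cmod (of_real (\<phi> x) - p x) \<le> inverse (real (Suc n)) * (1 + (\<Sum>i\<in>J. (x i)\<^sup>2))" for n
    by (rule trig_approx[OF J \<phi> b, of "inverse (real (Suc n))"]) auto
  then obtain p where p: "p n \<in> trig_poly J" "\<And>x. x \<in> PiE J (\<lambda>_. UNIV) \<Longrightarrow>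
      cmod (of_real (\<phi> x) - p n x) \<le> inverse (real (Suc n)) * (1 + (\<Sum>i\<in>J. (x i)\<^sup>2))" for n
    by metis
  show ?thesis
  proof (rule borel_measurable_LIMSEQ_real)
    show "(\<lambda>x. Re (p n x)) \<in> borel_measurable (\<Pi>\<^sub>M i\<in>J. borel)" for n
      using p(1)[of n] by measurable
    fix x :: "'i \<Rightarrow> real" assume "x \<in> space (\<Pi>\<^sub>M i\<in>J. borel)"
    then have x: "x \<in> PiE J (\<lambda>_. UNIV)" by (simp add: space_PiM)
    have "(\<lambda>n. inverse (real (Suc n)) * (1 + (\<Sum>i\<in>J. (x i)\<^sup>2))) \<longlonglongrightarrow> 0"
      by (rule tendsto_mult_left_zero[OF LIMSEQ_inverse_real_of_nat])
    then have "(\<lambda>n. Re (p n x) - \<phi> x) \<longlonglongrightarrow> 0"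
    proof (rule Lim_null_comparison[rotated])
      have "\<bar>Re (p n x) - \<phi> x\<bar> \<le> cmod (of_real (\<phi> x) - p n x)" for n
        using abs_Re_le_cmod[of "of_real (\<phi> x) - p n x"] by simp
      then show "\<forall>\<^sub>F n in sequentially. norm (Re (p n x) - \<phi> x) \<le> inverse (real (Suc n)) * (1 + (\<Sum>i\<in>J. (x i)\<^sup>2))"
        using p(2)[OF x] by (intro always_eventually allI) (metis order_trans real_norm_def)
    qed
    then show "(\<lambda>n. Re (p n x)) \<longlonglongrightarrow> \<phi> x" by (simp add: LIM_zero_iff)
  qed
qed

section \<open>Expectations of trigonometric polynomials and weak convergence\<close>

lemma trig_poly_integrable:
  fixes X :: "'i \<Rightarrow> 'a \<Rightarrow> real"
  assumes "prob_space M" and X: "\<And>j. j \<in> J \<Longrightarrow> X j \<in> borel_measurable M" and "p \<in> trig_poly J"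
  shows "integrable M (\<lambda>\<omega>. p (\<lambda>j\<in>J. X j \<omega>))"
  using assms(3)
proof induction
  case (trig_exp c a)
  interpret prob_space M by fact
  have "(\<lambda>\<omega>. \<Sum>i\<in>J. a i * X i \<omega>) \<in> borel_measurable M" using X by measurable
  then have "(\<lambda>\<omega>. complex_of_real (\<Sum>i\<in>J. a i * X i \<omega>)) \<in> borel_measurable M"
    by measurable
  then have "integrable M (\<lambda>\<omega>. c * iexp (\<Sum>i\<in>J. a i * X i \<omega>))"
    by (intro integrable_mult_right integrable_iexp) simp_all
  then show ?case by (simp cong: sum.cong)
qed auto

lemma trig_poly_expectation_tendsto:
  fixes X :: "nat \<Rightarrow> 'i \<Rightarrow> 'a \<Rightarrow> real" and Y :: "'i \<Rightarrow> 'b \<Rightarrow> real"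
  assumes M: "prob_space M" and N: "prob_space N"
    and X: "\<And>n j. j \<in> J \<Longrightarrow> X n j \<in> borel_measurable M"
    and Y: "\<And>j. j \<in> J \<Longrightarrow> Y j \<in> borel_measurable N"
    and char: "\<And>a. (\<lambda>n. \<integral>\<omega>. iexp (\<Sum>j\<in>J. a j * X n j \<omega>) \<partial>M) \<longlonglongrightarrow> (\<integral>\<omega>. iexp (\<Sum>j\<in>J. a j * Y j \<omega>) \<partial>N)"
    and "p \<in> trig_poly J"
  shows "(\<lambda>n. \<integral>\<omega>. p (\<lambda>j\<in>J. X n j \<omega>) \<partial>M) \<longlonglongrightarrow> (\<integral>\<omega>. p (\<lambda>j\<in>J. Y j \<omega>) \<partial>N)"
  using assms(6)
proof induction
  case (trig_exp c a)
  have "(\<lambda>n. c * (\<integral>\<omega>. iexp (\<Sum>j\<in>J. a j * X n j \<omega>) \<partial>M)) \<longlonglongrightarrow> c * (\<integral>\<omega>. iexp (\<Sum>j\<in>J. a j * Y j \<omega>) \<partial>N)"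
    by (intro tendsto_mult_left char)
  then show ?case by (simp cong: sum.cong)
next
  case (trig_add p q)
  have "(\<integral>\<omega>. p (\<lambda>j\<in>J. X n j \<omega>) + q (\<lambda>j\<in>J. X n j \<omega>) \<partial>M) =
      (\<integral>\<omega>. p (\<lambda>j\<in>J. X n j \<omega>) \<partial>M) + (\<integral>\<omega>. q (\<lambda>j\<in>J. X n j \<omega>) \<partial>M)" for n
    by (intro Bochner_Integration.integral_add trig_poly_integrable M X trig_add.hyps)
  moreover have "(\<integral>\<omega>. p (\<lambda>j\<in>J. Y j \<omega>) + q (\<lambda>j\<in>J. Y j \<omega>) \<partial>N) =
      (\<integral>\<omega>. p (\<lambda>j\<in>J. Y j \<omega>) \<partial>N) + (\<integral>\<omega>. q (\<lambda>j\<in>J. Y j \<omega>) \<partial>N)"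
    by (intro Bochner_Integration.integral_add trig_poly_integrable N Y trig_add.hyps)
  ultimately show ?case using tendsto_add[OF trig_add.IH] by (simp only:)
qed

text \<open>The quadratic weight of \<open>trig_approx\<close> integrates to at most
  \<open>1 + card J * V\<close> for every law with second moments below \<open>V\<close>. Hence one
  polynomial \<open>p\<close> serves all members of a sequence and its limit at once.\<close>

lemma expectation_trig_approx:
  fixes X :: "'i \<Rightarrow> 'a \<Rightarrow> real" and e V :: real
  assumes M: "prob_space M" and J: "finite J"
    and X: "\<And>j. j \<in> J \<Longrightarrow> X j \<in> borel_measurable M"
    and X2: "\<And>j. j \<in> J \<Longrightarrow> integrable M (\<lambda>\<omega>. (X j \<omega>)\<^sup>2)"
    and V: "\<And>j. j \<in> J \<Longrightarrow> (\<integral>\<omega>. (X j \<omega>)\<^sup>2 \<partial>M) \<le> V"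
    and \<phi>: "\<phi> \<in> borel_measurable (\<Pi>\<^sub>M i\<in>J. borel)" "\<And>x. x \<in> PiE J (\<lambda>_. UNIV) \<Longrightarrow> \<bar>\<phi> x\<bar> \<le> b"
    and p: "p \<in> trig_poly J" "e > 0"
      "\<And>x. x \<in> PiE J (\<lambda>_. UNIV) \<Longrightarrow> cmod (of_real (\<phi> x) - p x) \<le> e * (1 + (\<Sum>i\<in>J. (x i)\<^sup>2))"
  shows "cmod (of_real (\<integral>\<omega>. \<phi> (\<lambda>j\<in>J. X j \<omega>) \<partial>M) - (\<integral>\<omega>. p (\<lambda>j\<in>J. X j \<omega>) \<partial>M)) \<le> e * (1 + card J * V)"
proof -
  interpret prob_space M by fact
  have XJ: "(\<lambda>\<omega>. \<lambda>j\<in>J. X j \<omega>) \<in> M \<rightarrow>\<^sub>M (\<Pi>\<^sub>M i\<in>J. borel)" using X by measurable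
  have int\<phi>: "integrable M (\<lambda>\<omega>. \<phi> (\<lambda>j\<in>J. X j \<omega>))"
    using measurable_compose[OF XJ \<phi>(1)] \<phi>(2) by (intro integrable_const_bound[of _ b]) auto
  note intp = trig_poly_integrable[OF M X p(1)]
  have "cmod (of_real (\<integral>\<omega>. \<phi> (\<lambda>j\<in>J. X j \<omega>) \<partial>M) - (\<integral>\<omega>. p (\<lambda>j\<in>J. X j \<omega>) \<partial>M)) =
      cmod (\<integral>\<omega>. of_real (\<phi> (\<lambda>j\<in>J. X j \<omega>)) - p (\<lambda>j\<in>J. X j \<omega>) \<partial>M)"
    using int\<phi> intp by (subst Bochner_Integration.integral_diff) auto
  also have "\<dots> \<le> (\<integral>\<omega>. cmod (of_real (\<phi> (\<lambda>j\<in>J. X j \<omega>)) - p (\<lambda>j\<in>J. X j \<omega>)) \<partial>M)"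
    by (rule integral_norm_bound)
  also have "\<dots> \<le> (\<integral>\<omega>. e * (1 + (\<Sum>i\<in>J. (X i \<omega>)\<^sup>2)) \<partial>M)"
  proof (rule integral_mono)
    show "integrable M (\<lambda>\<omega>. cmod (of_real (\<phi> (\<lambda>j\<in>J. X j \<omega>)) - p (\<lambda>j\<in>J. X j \<omega>)))"
      using int\<phi> intp by (intro integrable_norm Bochner_Integration.integrable_diff integrable_of_real)
    show "integrable M (\<lambda>\<omega>. e * (1 + (\<Sum>i\<in>J. (X i \<omega>)\<^sup>2)))" using X2 by auto
    show "cmod (of_real (\<phi> (\<lambda>j\<in>J. X j \<omega>)) - p (\<lambda>j\<in>J. X j \<omega>)) \<le> e * (1 + (\<Sum>i\<in>J. (X i \<omega>)\<^sup>2))" for \<omega>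
      using p(3)[of "\<lambda>j\<in>J. X j \<omega>"] by (simp cong: sum.cong)
  qed
  also have "\<dots> = e * (1 + (\<Sum>i\<in>J. \<integral>\<omega>. (X i \<omega>)\<^sup>2 \<partial>M))"
    using X2 by (simp add: Bochner_Integration.integral_sum prob_space)
  also have "\<dots> \<le> e * (1 + card J * V)"
    using p(2) sum_bounded_above[of J "\<lambda>i. \<integral>\<omega>. (X i \<omega>)\<^sup>2 \<partial>M" V, OF V]
    by (intro mult_left_mono add_left_mono) auto
  finally show ?thesis .
qed

text \<open>The Cramer--Wold device; the bound on the second moments takes the place of tightness.\<close>

lemma fin_dim_convergence_criterion:
  fixes X :: "nat \<Rightarrow> real \<Rightarrow> 'a \<Rightarrow> real" and Y :: "real \<Rightarrow> 'b \<Rightarrow> real"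
  assumes M: "prob_space M" and N: "prob_space N" and J: "finite J"
    and X: "\<And>n j. j \<in> J \<Longrightarrow> X n j \<in> borel_measurable M"
    and Y: "\<And>j. j \<in> J \<Longrightarrow> Y j \<in> borel_measurable N"
    and X2: "\<And>n j. j \<in> J \<Longrightarrow> integrable M (\<lambda>\<omega>. (X n j \<omega>)\<^sup>2)"
    and Y2: "\<And>j. j \<in> J \<Longrightarrow> integrable N (\<lambda>\<omega>. (Y j \<omega>)\<^sup>2)"
    and V: "\<And>j. j \<in> J \<Longrightarrow> \<exists>V. \<forall>n. (\<integral>\<omega>. (X n j \<omega>)\<^sup>2 \<partial>M) \<le> V"
    and char: "\<And>a. (\<lambda>n. \<integral>\<omega>. iexp (\<Sum>j\<in>J. a j * X n j \<omega>) \<partial>M) \<longlonglongrightarrow> (\<integral>\<omega>. iexp (\<Sum>j\<in>J. a j * Y j \<omega>) \<partial>N)"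
  shows "weak_conv_on (product_topology (\<lambda>_. euclideanreal) J)
    (\<lambda>n. fin_dim_distr M (X n) J) (fin_dim_distr N Y J)"
  unfolding weak_conv_on_def
proof (intro allI impI, elim conjE)
  fix \<phi> :: "(real \<Rightarrow> real) \<Rightarrow> real"
  assume cont: "continuous_map (product_topology (\<lambda>_. euclideanreal) J) euclideanreal \<phi>"
    and "bounded (\<phi> ` topspace (product_topology (\<lambda>_. euclideanreal) J))"
  then obtain b where b: "\<And>x. x \<in> PiE J (\<lambda>_. UNIV) \<Longrightarrow> \<bar>\<phi> x\<bar> \<le> b"
    by (auto simp: bounded_iff)
  note meas = measurable_PiM_continuous_map[OF J cont b]
  obtain W where W: "j \<in> J \<Longrightarrow> (\<integral>\<omega>. (X n j \<omega>)\<^sup>2 \<partial>M) \<le> W j" for n j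
    using V by metis
  \<comment> \<open>One bound for all coordinates of all \<open>X n\<close> and of \<open>Y\<close>.
    The absolute value makes each summand nonnegative, so that a single summand is below the
    sum.\<close>
  define V where "V = (\<Sum>j\<in>J. \<bar>W j\<bar> + (\<integral>\<omega>. (Y j \<omega>)\<^sup>2 \<partial>N))"
  have WV: "\<bar>W j\<bar> + (\<integral>\<omega>. (Y j \<omega>)\<^sup>2 \<partial>N) \<le> V" if "j \<in> J" for j
    unfolding V_def using that J by (intro member_le_sum[of j J "\<lambda>j. \<bar>W j\<bar> + (\<integral>\<omega>. (Y j \<omega>)\<^sup>2 \<partial>N)"]) auto
  have V0: "V \<ge> 0" unfolding V_def by (intro sum_nonneg) auto
  have XV: "(\<integral>\<omega>. (X n j \<omega>)\<^sup>2 \<partial>M) \<le> V" if "j \<in> J" for n j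
  proof -
    have "0 \<le> (\<integral>\<omega>. (Y j \<omega>)\<^sup>2 \<partial>N)" by simp
    then show ?thesis using W[OF that, of n] WV[OF that] by linarith
  qed
  have YV: "(\<integral>\<omega>. (Y j \<omega>)\<^sup>2 \<partial>N) \<le> V" if "j \<in> J" for j
    using WV[OF that] by linarith
  have "(\<lambda>n. \<integral>\<omega>. \<phi> (\<lambda>j\<in>J. X n j \<omega>) \<partial>M) \<longlonglongrightarrow> (\<integral>\<omega>. \<phi> (\<lambda>j\<in>J. Y j \<omega>) \<partial>N)"
  proof (rule LIMSEQ_I)
    fix r :: real assume r: "r > 0"
    define S where "S = 1 + card J * V"
    \<comment> \<open>Three errors of size r/4 add up to less than r: the two replacements of \<phi>
      by \<open>p\<close>, and the convergence of the expectations of \<open>p\<close>.\<close>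
    define e where "e = r / (4 * S)"
    have pos: "S > 0" using V0 by (simp add: S_def add_pos_nonneg)
    have e: "e > 0" "e * (1 + card J * V) = r / 4"
      unfolding S_def[symmetric] using pos r by (auto simp: e_def)
    obtain p where p: "p \<in> trig_poly J"
      "\<And>x. x \<in> PiE J (\<lambda>_. UNIV) \<Longrightarrow> cmod (of_real (\<phi> x) - p x) \<le> e * (1 + (\<Sum>i\<in>J. (x i)\<^sup>2))"
      by (rule trig_approx[OF J cont b e(1)]; blast)
    let ?X = "\<lambda>n. \<integral>\<omega>. \<phi> (\<lambda>j\<in>J. X n j \<omega>) \<partial>M" and ?Y = "\<integral>\<omega>. \<phi> (\<lambda>j\<in>J. Y j \<omega>) \<partial>N"
    let ?P = "\<lambda>n. \<integral>\<omega>. p (\<lambda>j\<in>J. X n j \<omega>) \<partial>M" and ?Q = "\<integral>\<omega>. p (\<lambda>j\<in>J. Y j \<omega>) \<partial>N"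
    have 1: "cmod (of_real (?X n) - ?P n) \<le> e * (1 + card J * V)" for n
      by (rule expectation_trig_approx[OF M J X X2 XV meas b p(1) e(1) p(2)])
    have 2: "cmod (of_real ?Y - ?Q) \<le> e * (1 + card J * V)"
      by (rule expectation_trig_approx[OF N J Y Y2 YV meas b p(1) e(1) p(2)])
    have "?P \<longlonglongrightarrow> ?Q" by (rule trig_poly_expectation_tendsto[OF M N X Y char p(1)])
    from LIMSEQ_D[OF this, of "r / 4"] r obtain n0 where n0: "\<And>n. n \<ge> n0 \<Longrightarrow> cmod (?P n - ?Q) < r / 4"
      by auto
    have "norm (?X n - ?Y) < r" if "n \<ge> n0" for n
    proof -
      have "norm (?X n - ?Y) = cmod (of_real (?X n) - of_real ?Y)"
        by (simp flip: of_real_diff)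
      also have "of_real (?X n) - of_real ?Y = (of_real (?X n) - ?P n) + ((?P n - ?Q) - (of_real ?Y - ?Q))"
        by simp
      also have "cmod \<dots> \<le> cmod (of_real (?X n) - ?P n) + (cmod (?P n - ?Q) + cmod (of_real ?Y - ?Q))"
        by (intro order_trans[OF norm_triangle_ineq] add_left_mono norm_triangle_ineq4)
      also have "\<dots> < r" using 1[of n] 2 n0[OF that] r unfolding e(2) by linarith
      finally show ?thesis .
    qed
    then show "\<exists>no. \<forall>n\<ge>no. norm (?X n - ?Y) < r" by blast
  qed
  moreover have "(\<integral>x. \<phi> x \<partial>fin_dim_distr M (X n) J) = (\<integral>\<omega>. \<phi> (\<lambda>j\<in>J. X n j \<omega>) \<partial>M)" for n
    unfolding fin_dim_distr_def using X meas by (subst integral_distr) auto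
  moreover have "(\<integral>x. \<phi> x \<partial>fin_dim_distr N Y J) = (\<integral>\<omega>. \<phi> (\<lambda>j\<in>J. Y j \<omega>) \<partial>N)"
    unfolding fin_dim_distr_def using Y meas by (subst integral_distr) auto
  ultimately show "(\<lambda>n. \<integral>x. \<phi> x \<partial>fin_dim_distr M (X n) J) \<longlonglongrightarrow> (\<integral>x. \<phi> x \<partial>fin_dim_distr N Y J)"
    by simp
qed

section \<open>Gaussian pairs\<close>

text \<open>A vanishing expectation forces the mean parameter to be 0, so the law is determined by
  its variance. The case of variance 0 is separate because that law has no density: it is the point
  mass at 0, and both sides of the second claim equal 1.\<close>

lemma gaussian_rv_centered:
  assumes M: "prob_space M" and X: "gaussian_rv M X" and m: "(\<integral>\<omega>. X \<omega> \<partial>M) = 0"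
  shows gaussian_rv_square_integrable: "integrable M (\<lambda>\<omega>. (X \<omega>)\<^sup>2)"
    and gaussian_rv_char: "(\<integral>\<omega>. iexp (X \<omega>) \<partial>M) = of_real (exp (- (\<integral>\<omega>. (X \<omega>)\<^sup>2 \<partial>M) / 2))"
proof -
  interpret prob_space M by fact
  obtain \<mu> \<sigma> where X_meas [measurable]: "X \<in> borel_measurable M" and \<sigma>: "\<sigma> \<ge> 0"
    and D: "distr M borel X = normal_law \<mu> \<sigma>"
    using X unfolding gaussian_rv_def by auto
  have "integrable M (\<lambda>\<omega>. (X \<omega>)\<^sup>2) \<and> (\<integral>\<omega>. iexp (X \<omega>) \<partial>M) = of_real (exp (- (\<integral>\<omega>. (X \<omega>)\<^sup>2 \<partial>M) / 2))"
  proof (cases "\<sigma> = 0")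
    case True
    then have D: "distr M borel X = return borel \<mu>" using D by (simp add: normal_law_def)
    have "(\<integral>\<omega>. X \<omega> \<partial>M) = (\<integral>x. x \<partial>distr M borel X)" by (simp add: integral_distr)
    then have [simp]: "\<mu> = 0" using m by (simp add: D integral_return)
    have "integrable (distr M borel X) (\<lambda>x. x\<^sup>2)"
      unfolding D using integrable_cong_AE[of "\<lambda>x::real. x\<^sup>2" "return borel \<mu>" "\<lambda>x. 0"]
      by (auto simp: AE_return)
    then have "integrable M (\<lambda>\<omega>. (X \<omega>)\<^sup>2)" by (simp add: integrable_distr_eq)
    moreover have "(\<integral>\<omega>. (X \<omega>)\<^sup>2 \<partial>M) = (\<integral>x. x\<^sup>2 \<partial>distr M borel X)" by (simp add: integral_distr)
    moreover have "(\<integral>\<omega>. iexp (X \<omega>) \<partial>M) = (\<integral>x. iexp x \<partial>distr M borel X)" by (simp add: integral_distr)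
    ultimately show ?thesis by (simp add: D integral_return)
  next
    case False
    then have \<sigma>: "\<sigma> > 0" using \<sigma> by simp
    have "distr M lborel X = distr M borel X" by (rule distr_cong) auto
    then have "distributed M lborel X (normal_density \<mu> \<sigma>)"
      using D \<sigma> by (simp add: distributed_def normal_law_def)
    moreover from normal_distributed_expectation[OF \<sigma> this] m have [simp]: "\<mu> = 0" by simp
    ultimately have X: "distributed M lborel X (normal_density 0 \<sigma>)" by simp
    then have Z: "distributed M lborel (\<lambda>\<omega>. X \<omega> / \<sigma>) std_normal_density"
      using normal_standard_normal_convert[OF \<sigma>, of X 0] by simp
    have Z2: "integrable M (\<lambda>\<omega>. (X \<omega> / \<sigma>)\<^sup>2)"
      using distributed_integrable[OF Z, of "\<lambda>x. x\<^sup>2"] integrable_std_normal_moment[of 2]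
      by (simp add: normal_density_nonneg)
    then have "integrable M (\<lambda>\<omega>. \<sigma>\<^sup>2 * (X \<omega> / \<sigma>)\<^sup>2)" by (rule integrable_mult_right)
    then have 1: "integrable M (\<lambda>\<omega>. (X \<omega>)\<^sup>2)" using \<sigma> by (simp add: power_divide)
    have 2: "(\<integral>\<omega>. (X \<omega>)\<^sup>2 \<partial>M) = \<sigma>\<^sup>2"
      using normal_distributed_variance[OF \<sigma> X] m by simp
    have "distr M lborel (\<lambda>\<omega>. X \<omega> / \<sigma>) = std_normal_distribution"
      using Z by (simp add: distributed_def)
    then have "(\<integral>x. iexp (\<sigma> * x) \<partial>distr M lborel (\<lambda>\<omega>. X \<omega> / \<sigma>)) = char std_normal_distribution \<sigma>"
      by (simp add: char_def)
    also have "(\<integral>x. iexp (\<sigma> * x) \<partial>distr M lborel (\<lambda>\<omega>. X \<omega> / \<sigma>)) = (\<integral>\<omega>. iexp (X \<omega>) \<partial>M)"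
      using \<sigma> by (subst integral_distr) auto
    finally show ?thesis using 1 by (simp add: char_std_normal_distribution 2)
  qed
  then show "integrable M (\<lambda>\<omega>. (X \<omega>)\<^sup>2)"
    "(\<integral>\<omega>. iexp (X \<omega>) \<partial>M) = of_real (exp (- (\<integral>\<omega>. (X \<omega>)\<^sup>2 \<partial>M) / 2))" by auto
qed

text \<open>Kac's theorem: reweighting by \<open>2 + W\<close> does not change the characteristic function of \<open>Z\<close>, hence it
  does not change the law of \<open>Z\<close>.\<close>

lemma weighted_char_factorizes:
  fixes W Z :: "'a \<Rightarrow> real"
  assumes M: "prob_space M" and W [measurable]: "W \<in> borel_measurable M" and W1: "\<And>\<omega>. \<bar>W \<omega>\<bar> \<le> 1"
    and Z [measurable]: "Z \<in> borel_measurable M"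
    and fac: "\<And>t. (\<integral>\<omega>. of_real (W \<omega>) * iexp (t * Z \<omega>) \<partial>M) = of_real (\<integral>\<omega>. W \<omega> \<partial>M) * (\<integral>\<omega>. iexp (t * Z \<omega>) \<partial>M)"
    and B [measurable]: "B \<in> sets borel"
  shows "(\<integral>\<omega>. W \<omega> * indicator B (Z \<omega>) \<partial>M) = (\<integral>\<omega>. W \<omega> \<partial>M) * measure M {\<omega>\<in>space M. Z \<omega> \<in> B}"
proof -
  interpret prob_space M by fact
  have intW: "integrable M W" using W1 by (intro integrable_const_bound[of _ 1]) auto
  \<comment> \<open>\<open>W\<close> may be negative. Adding 2 makes the weight at least 1, and
    \<open>c\<close>, which is positive because the expectation of \<open>W\<close> is at least -1,
    turns it into a probability density.\<close>
  define c where "c = 2 + (\<integral>\<omega>. W \<omega> \<partial>M)"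
  define w where "w = (\<lambda>\<omega>. (2 + W \<omega>) / c)"
  have "\<bar>\<integral>\<omega>. W \<omega> \<partial>M\<bar> \<le> (\<integral>\<omega>. 1 \<partial>M)"
    using W1 intW by (intro order_trans[OF integral_abs_bound integral_mono]) auto
  then have c: "c > 0" by (simp add: c_def prob_space)
  have w0: "w \<omega> \<ge> 0" for \<omega> using W1[of \<omega>] c by (simp add: w_def)
  have [measurable]: "w \<in> borel_measurable M" unfolding w_def by measurable
  have intw: "integrable M w" unfolding w_def using intW by auto
  have w1: "(\<integral>\<omega>. w \<omega> \<partial>M) = 1"
    unfolding w_def using intW c by (simp add: prob_space c_def[symmetric])
  define D where "D = density M (\<lambda>\<omega>. ennreal (w \<omega>))"
  have [measurable_cong, simp]: "sets D = sets M" and [simp]: "space D = space M" by (simp_all add: D_def)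
  have "emeasure D (space D) = 1"
    using intw w0 w1 by (simp add: D_def emeasure_density nn_integral_eq_integral)
  then interpret D: prob_space D by (rule prob_spaceI)
  let ?P = "distr D borel Z" and ?Q = "distr M borel Z"
  have iexp_int: "integrable M (\<lambda>\<omega>. iexp (t * Z \<omega>))" for t
    by (intro integrable_iexp) auto
  have Wexp_int: "integrable M (\<lambda>\<omega>. of_real (W \<omega>) * iexp (t * Z \<omega>))" for t
    by (intro integrable_const_bound[of _ 1]) (auto simp: norm_mult W1)
  have "?P = ?Q"
  proof (rule Levy_uniqueness)
    show "real_distribution ?P" "real_distribution ?Q"
      by (auto intro!: D.real_distribution_distr real_distribution_distr)
    show "char ?P = char ?Q"
    proof
      fix t
      have "char ?P t = (\<integral>\<omega>. iexp (t * Z \<omega>) \<partial>D)"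
        unfolding char_def by (subst integral_distr) auto
      also have "\<dots> = (\<integral>\<omega>. w \<omega> *\<^sub>R iexp (t * Z \<omega>) \<partial>M)"
        unfolding D_def using w0 by (subst integral_density) auto
      also have "\<dots> = (\<integral>\<omega>. (2 * iexp (t * Z \<omega>) + of_real (W \<omega>) * iexp (t * Z \<omega>)) / of_real c \<partial>M)"
        by (simp add: w_def scaleR_conv_of_real distrib_right)
      also have "\<dots> = (2 * (\<integral>\<omega>. iexp (t * Z \<omega>) \<partial>M) + (\<integral>\<omega>. of_real (W \<omega>) * iexp (t * Z \<omega>) \<partial>M)) / of_real c"
        using iexp_int Wexp_int by (subst integral_divide_zero, subst Bochner_Integration.integral_add) auto
      also have "\<dots> = (\<integral>\<omega>. iexp (t * Z \<omega>) \<partial>M) * of_real (2 + (\<integral>\<omega>. W \<omega> \<partial>M)) / of_real c"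
        unfolding fac by (simp add: algebra_simps)
      also have "\<dots> = (\<integral>\<omega>. iexp (t * Z \<omega>) \<partial>M)" using c by (simp add: c_def[symmetric])
      also have "\<dots> = char ?Q t" unfolding char_def by (subst integral_distr) auto
      finally show "char ?P t = char ?Q t" .
    qed
  qed
  then have "measure ?P B = measure ?Q B" by simp
  then have eq: "measure D {\<omega>\<in>space M. Z \<omega> \<in> B} = measure M {\<omega>\<in>space M. Z \<omega> \<in> B}"
    by (simp add: measure_distr vimage_def Int_def conj_commute)
  have indB: "(\<integral>\<omega>. indicator B (Z \<omega>) \<partial>M) = measure M {\<omega>\<in>space M. Z \<omega> \<in> B}"
  proof -
    have "(\<integral>\<omega>. indicator B (Z \<omega>) \<partial>M) = (\<integral>\<omega>. indicator {\<omega>\<in>space M. Z \<omega> \<in> B} \<omega> \<partial>M :: real)"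
      by (intro Bochner_Integration.integral_cong) (auto simp: indicator_def)
    then show ?thesis by simp
  qed
  have "measure D {\<omega>\<in>space M. Z \<omega> \<in> B} = (\<integral>\<omega>. indicator {\<omega>\<in>space M. Z \<omega> \<in> B} \<omega> \<partial>D)" by simp
  also have "\<dots> = (\<integral>\<omega>. w \<omega> *\<^sub>R indicator {\<omega>\<in>space M. Z \<omega> \<in> B} \<omega> \<partial>M)"
    unfolding D_def using w0 by (subst integral_density) auto
  also have "\<dots> = (\<integral>\<omega>. (2 * indicator B (Z \<omega>) + W \<omega> * indicator B (Z \<omega>)) / c \<partial>M)"
    by (intro Bochner_Integration.integral_cong) (auto simp: w_def indicator_def)
  also have "\<dots> = (2 * (\<integral>\<omega>. indicator B (Z \<omega>) \<partial>M) + (\<integral>\<omega>. W \<omega> * indicator B (Z \<omega>) \<partial>M)) / c"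
  proof -
    have "integrable M (\<lambda>\<omega>. indicator B (Z \<omega>) :: real)" "integrable M (\<lambda>\<omega>. W \<omega> * indicator B (Z \<omega>))"
      using W1 by (auto intro!: integrable_const_bound[of _ 1] simp: indicator_def)
    then show ?thesis by simp
  qed
  finally have "(2 * measure M {\<omega>\<in>space M. Z \<omega> \<in> B} + (\<integral>\<omega>. W \<omega> * indicator B (Z \<omega>) \<partial>M)) / c
      = measure M {\<omega>\<in>space M. Z \<omega> \<in> B}"
    using eq indB by simp
  \<comment> \<open>The constant part of the weight contributes the same term on both sides once
    \<open>c\<close> is unfolded; what remains is the factorization for \<open>W\<close>
    alone.\<close>
  then have "2 * measure M {\<omega>\<in>space M. Z \<omega> \<in> B} + (\<integral>\<omega>. W \<omega> * indicator B (Z \<omega>) \<partial>M)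
      = measure M {\<omega>\<in>space M. Z \<omega> \<in> B} * c"
    using c by (simp add: divide_eq_eq)
  then show ?thesis by (simp add: c_def algebra_simps)
qed

text \<open>\<open>weighted_char_factorizes\<close> is used twice. With the real weights cos(s X)
  and sin(s X) it replaces the exponential in \<open>Z\<close> by the indicator of \<open>B\<close>;
  then the roles are exchanged, and with that indicator as weight it replaces the exponential in
  \<open>X\<close> by the indicator of \<open>A\<close>.\<close>

lemma kac_independence:
  fixes X Z :: "'a \<Rightarrow> real"
  assumes M: "prob_space M" and X [measurable]: "X \<in> borel_measurable M"
    and Z [measurable]: "Z \<in> borel_measurable M"
    and fac: "\<And>s t. (\<integral>\<omega>. iexp (s * X \<omega> + t * Z \<omega>) \<partial>M) = (\<integral>\<omega>. iexp (s * X \<omega>) \<partial>M) * (\<integral>\<omega>. iexp (t * Z \<omega>) \<partial>M)"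
    and A [measurable]: "A \<in> sets borel" and B [measurable]: "B \<in> sets borel"
  shows "measure M {\<omega>\<in>space M. X \<omega> \<in> A \<and> Z \<omega> \<in> B} =
    measure M {\<omega>\<in>space M. X \<omega> \<in> A} * measure M {\<omega>\<in>space M. Z \<omega> \<in> B}"
proof -
  interpret prob_space M by fact
  let ?b = "measure M {\<omega>\<in>space M. Z \<omega> \<in> B}"
  have iexp_int: "integrable M (\<lambda>\<omega>. iexp (s * X \<omega> + t * Z \<omega>))" for s t
    by (intro integrable_iexp) auto
  have iexp_int': "integrable M (\<lambda>\<omega>. iexp (s * X \<omega>))" for s
    using iexp_int[of s 0] by simp
  have cos_fac: "(\<integral>\<omega>. cos (s * X \<omega>) * indicator B (Z \<omega>) \<partial>M) = (\<integral>\<omega>. cos (s * X \<omega>) \<partial>M) * ?b" for s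
  proof (rule weighted_char_factorizes[OF M])
    fix t
    have e: "of_real (cos (s * x)) = (iexp (s * x) + iexp ((- s) * x)) / 2" for x
      by (auto simp: complex_eq_iff Re_exp Im_exp)
    have "(\<integral>\<omega>. of_real (cos (s * X \<omega>)) * iexp (t * Z \<omega>) \<partial>M) =
        (\<integral>\<omega>. (iexp (s * X \<omega> + t * Z \<omega>) + iexp ((- s) * X \<omega> + t * Z \<omega>)) / 2 \<partial>M)"
      by (intro Bochner_Integration.integral_cong refl, subst e) (simp add: mult_exp_exp distrib_right algebra_simps)
    also have "\<dots> = ((\<integral>\<omega>. iexp (s * X \<omega> + t * Z \<omega>) \<partial>M) + (\<integral>\<omega>. iexp ((- s) * X \<omega> + t * Z \<omega>) \<partial>M)) / 2"
      by (subst integral_divide_zero, subst Bochner_Integration.integral_add[OF iexp_int iexp_int]) simp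
    also have "\<dots> = ((\<integral>\<omega>. iexp (s * X \<omega>) \<partial>M) + (\<integral>\<omega>. iexp ((- s) * X \<omega>) \<partial>M)) / 2 * (\<integral>\<omega>. iexp (t * Z \<omega>) \<partial>M)"
      unfolding fac by (simp add: algebra_simps)
    also have "((\<integral>\<omega>. iexp (s * X \<omega>) \<partial>M) + (\<integral>\<omega>. iexp ((- s) * X \<omega>) \<partial>M)) / 2 =
        (\<integral>\<omega>. of_real (cos (s * X \<omega>)) \<partial>M)"
      by (subst e, subst integral_divide_zero, subst Bochner_Integration.integral_add[OF iexp_int' iexp_int']) simp
    finally show "(\<integral>\<omega>. of_real (cos (s * X \<omega>)) * iexp (t * Z \<omega>) \<partial>M) =
        of_real (\<integral>\<omega>. cos (s * X \<omega>) \<partial>M) * (\<integral>\<omega>. iexp (t * Z \<omega>) \<partial>M)" by simp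
  qed auto
  have sin_fac: "(\<integral>\<omega>. sin (s * X \<omega>) * indicator B (Z \<omega>) \<partial>M) = (\<integral>\<omega>. sin (s * X \<omega>) \<partial>M) * ?b" for s
  proof (rule weighted_char_factorizes[OF M])
    fix t
    have e: "of_real (sin (s * x)) = (iexp (s * x) - iexp ((- s) * x)) / (2 * \<i>)" for x
      by (auto simp: complex_eq_iff Re_exp Im_exp Re_divide Im_divide)
    have "(\<integral>\<omega>. of_real (sin (s * X \<omega>)) * iexp (t * Z \<omega>) \<partial>M) =
        (\<integral>\<omega>. (iexp (s * X \<omega> + t * Z \<omega>) - iexp ((- s) * X \<omega> + t * Z \<omega>)) / (2 * \<i>) \<partial>M)"
      by (intro Bochner_Integration.integral_cong refl, subst e) (simp add: mult_exp_exp left_diff_distrib algebra_simps)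
    also have "\<dots> = ((\<integral>\<omega>. iexp (s * X \<omega> + t * Z \<omega>) \<partial>M) - (\<integral>\<omega>. iexp ((- s) * X \<omega> + t * Z \<omega>) \<partial>M)) / (2 * \<i>)"
      by (subst integral_divide_zero, subst Bochner_Integration.integral_diff[OF iexp_int iexp_int]) simp
    also have "\<dots> = ((\<integral>\<omega>. iexp (s * X \<omega>) \<partial>M) - (\<integral>\<omega>. iexp ((- s) * X \<omega>) \<partial>M)) / (2 * \<i>) * (\<integral>\<omega>. iexp (t * Z \<omega>) \<partial>M)"
      unfolding fac by (simp add: left_diff_distrib)
    also have "((\<integral>\<omega>. iexp (s * X \<omega>) \<partial>M) - (\<integral>\<omega>. iexp ((- s) * X \<omega>) \<partial>M)) / (2 * \<i>) =
        (\<integral>\<omega>. of_real (sin (s * X \<omega>)) \<partial>M)"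
      by (subst e, subst integral_divide_zero, subst Bochner_Integration.integral_diff[OF iexp_int' iexp_int']) simp
    finally show "(\<integral>\<omega>. of_real (sin (s * X \<omega>)) * iexp (t * Z \<omega>) \<partial>M) =
        of_real (\<integral>\<omega>. sin (s * X \<omega>) \<partial>M) * (\<integral>\<omega>. iexp (t * Z \<omega>) \<partial>M)" by simp
  qed auto
  have indb: "(\<integral>\<omega>. indicator B (Z \<omega>) \<partial>M) = ?b"
    using cos_fac[of 0] by (simp add: prob_space)
  have "(\<integral>\<omega>. indicator B (Z \<omega>) * indicator A (X \<omega>) \<partial>M) =
      (\<integral>\<omega>. indicator B (Z \<omega>) \<partial>M) * measure M {\<omega>\<in>space M. X \<omega> \<in> A}"
  proof (rule weighted_char_factorizes[OF M])
    fix s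
    have int1: "integrable M (\<lambda>\<omega>. cos (s * X \<omega>) * indicator B (Z \<omega>))"
      "integrable M (\<lambda>\<omega>. sin (s * X \<omega>) * indicator B (Z \<omega>))"
      "integrable M (\<lambda>\<omega>. cos (s * X \<omega>))" "integrable M (\<lambda>\<omega>. sin (s * X \<omega>))"
      by (auto intro!: integrable_const_bound[of _ 1] simp: indicator_def)
    have e: "iexp (s * x) = of_real (cos (s * x)) + \<i> * of_real (sin (s * x))" for x
      by (auto simp: complex_eq_iff Re_exp Im_exp)
    have "(\<integral>\<omega>. of_real (indicator B (Z \<omega>)) * iexp (s * X \<omega>) \<partial>M) =
        (\<integral>\<omega>. of_real (cos (s * X \<omega>) * indicator B (Z \<omega>)) + \<i> * of_real (sin (s * X \<omega>) * indicator B (Z \<omega>)) \<partial>M)"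
      by (intro Bochner_Integration.integral_cong refl, subst e) (simp add: algebra_simps)
    also have "\<dots> = of_real (\<integral>\<omega>. cos (s * X \<omega>) * indicator B (Z \<omega>) \<partial>M) +
        \<i> * of_real (\<integral>\<omega>. sin (s * X \<omega>) * indicator B (Z \<omega>) \<partial>M)"
      using int1(1,2)[THEN integrable_of_real[where 'a=complex]]
      by (subst Bochner_Integration.integral_add) (auto simp del: of_real_mult)
    also have "\<dots> = of_real ?b * (of_real (\<integral>\<omega>. cos (s * X \<omega>) \<partial>M) + \<i> * of_real (\<integral>\<omega>. sin (s * X \<omega>) \<partial>M))"
      unfolding cos_fac sin_fac by (simp add: algebra_simps)
    also have "of_real (\<integral>\<omega>. cos (s * X \<omega>) \<partial>M) + \<i> * of_real (\<integral>\<omega>. sin (s * X \<omega>) \<partial>M) =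
        (\<integral>\<omega>. of_real (cos (s * X \<omega>)) + \<i> * of_real (sin (s * X \<omega>)) \<partial>M)"
      using int1(3,4)[THEN integrable_of_real[where 'a=complex]]
      by (subst Bochner_Integration.integral_add) auto
    also have "\<dots> = (\<integral>\<omega>. iexp (s * X \<omega>) \<partial>M)" by (subst e) simp
    finally show "(\<integral>\<omega>. of_real (indicator B (Z \<omega>)) * iexp (s * X \<omega>) \<partial>M) =
        of_real (\<integral>\<omega>. indicator B (Z \<omega>) \<partial>M) * (\<integral>\<omega>. iexp (s * X \<omega>) \<partial>M)"
      unfolding indb .
  qed (auto simp: indicator_def)
  moreover have "(\<integral>\<omega>. indicator B (Z \<omega>) * indicator A (X \<omega>) \<partial>M) = 
      (\<integral>\<omega>. indicator {\<omega>\<in>space M. X \<omega> \<in> A \<and> Z \<omega> \<in> B} \<omega> \<partial>M :: real)"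
    by (intro Bochner_Integration.integral_cong) (auto simp: indicator_def)
  ultimately show ?thesis by (simp add: indb mult.commute)
qed


section \<open>Joint density of a standard normal pair\<close>

lemma abs_mult_le_squares: "\<bar>x * y\<bar> \<le> x\<^sup>2 + y\<^sup>2" for x y :: real
proof -
  have "0 \<le> (\<bar>x\<bar> - \<bar>y\<bar>)\<^sup>2" by simp
  then have "2 * (\<bar>x\<bar> * \<bar>y\<bar>) \<le> x\<^sup>2 + y\<^sup>2" by (simp add: power2_diff)
  moreover have "0 \<le> \<bar>x\<bar> * \<bar>y\<bar>" by simp
  ultimately show ?thesis unfolding abs_mult by linarith
qed

lemma integrable_mult_of_squares:
  fixes U V :: "'a \<Rightarrow> real"
  assumes [measurable]: "U \<in> borel_measurable M" "V \<in> borel_measurable M"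
    and int: "integrable M (\<lambda>\<omega>. (U \<omega>)\<^sup>2)" "integrable M (\<lambda>\<omega>. (V \<omega>)\<^sup>2)"
  shows "integrable M (\<lambda>\<omega>. U \<omega> * V \<omega>)"
proof (rule Bochner_Integration.integrable_bound)
  show "integrable M (\<lambda>\<omega>. (U \<omega>)\<^sup>2 + (V \<omega>)\<^sup>2)" using int by auto
  show "AE \<omega> in M. norm (U \<omega> * V \<omega>) \<le> norm ((U \<omega>)\<^sup>2 + (V \<omega>)\<^sup>2)"
    using abs_mult_le_squares by auto
qed auto

lemma std_normal_of_char:
  assumes M: "prob_space M" and V [measurable]: "V \<in> borel_measurable M"
    and char: "\<And>t. (\<integral>\<omega>. iexp (t * V \<omega>) \<partial>M) = of_real (exp (- t\<^sup>2 / 2))"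
  shows "distributed M lborel V std_normal_density"
proof -
  interpret prob_space M by fact
  have "distr M borel V = std_normal_distribution"
  proof (rule Levy_uniqueness)
    show "char (distr M borel V) = char std_normal_distribution"
      unfolding char_std_normal_distribution
      by (rule ext) (simp add: char_def integral_distr char[simplified])
  qed (auto intro: real_dist_normal_dist real_distribution_distr)
  moreover have "distr M lborel V = distr M borel V" by (rule distr_cong) auto
  ultimately show ?thesis by (simp add: distributed_def)
qed

text \<open>The second factor is the conditional density of \<open>Y = \<rho> X + sqrt (1 - \<rho>\<^sup>2) Z\<close> given \<open>X = x\<close>,
  where \<open>Z\<close> is standard normal and independent of \<open>X\<close>.\<close>

lemma std_normal_pair_density:
  assumes M: "prob_space M" and X [measurable]: "X \<in> borel_measurable M" and Y [measurable]: "Y \<in> borel_measurable M"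
    and gauss: "\<And>a b. gaussian_rv M (\<lambda>\<omega>. a * X \<omega> + b * Y \<omega>)"
    and m: "(\<integral>\<omega>. X \<omega> \<partial>M) = 0" "(\<integral>\<omega>. Y \<omega> \<partial>M) = 0"
    and v: "(\<integral>\<omega>. (X \<omega>)\<^sup>2 \<partial>M) = 1" "(\<integral>\<omega>. (Y \<omega>)\<^sup>2 \<partial>M) = 1"
    and \<rho>: "(\<integral>\<omega>. X \<omega> * Y \<omega> \<partial>M) = \<rho>" "\<rho>\<^sup>2 < 1"
  shows "distributed M (lborel \<Otimes>\<^sub>M lborel) (\<lambda>\<omega>. (X \<omega>, Y \<omega>))
    (\<lambda>(x, y). ennreal (std_normal_density x * normal_density (\<rho> * x) (sqrt (1 - \<rho>\<^sup>2)) y))"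
proof -
  interpret prob_space M by fact
  have int2: "integrable M (\<lambda>\<omega>. (X \<omega>)\<^sup>2)" "integrable M (\<lambda>\<omega>. (Y \<omega>)\<^sup>2)"
    using gaussian_rv_square_integrable[OF M gauss[of 1 0]] gaussian_rv_square_integrable[OF M gauss[of 0 1]] m
    by simp_all
  have int1: "integrable M X" "integrable M Y"
    using int2 by (auto intro: square_integrable_imp_integrable)
  have intXY: "integrable M (\<lambda>\<omega>. X \<omega> * Y \<omega>)" by (rule integrable_mult_of_squares[OF X Y int2])
  have char: "(\<integral>\<omega>. iexp (a * X \<omega> + b * Y \<omega>) \<partial>M) = of_real (exp (- (a\<^sup>2 + 2 * a * b * \<rho> + b\<^sup>2) / 2))" for a b
  proof -
    have "(\<integral>\<omega>. a * X \<omega> + b * Y \<omega> \<partial>M) = 0" using int1 m by simp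
    note gaussian_rv_char[OF M gauss this]
    moreover have "(\<integral>\<omega>. (a * X \<omega> + b * Y \<omega>)\<^sup>2 \<partial>M) =
        (\<integral>\<omega>. a\<^sup>2 * (X \<omega>)\<^sup>2 + 2 * a * b * (X \<omega> * Y \<omega>) + b\<^sup>2 * (Y \<omega>)\<^sup>2 \<partial>M)"
      by (intro Bochner_Integration.integral_cong) (auto simp: power2_eq_square algebra_simps)
    moreover have "\<dots> = a\<^sup>2 + 2 * a * b * \<rho> + b\<^sup>2"
      using int2 intXY v \<rho> by simp
    ultimately show ?thesis by simp
  qed
  define r where "r = sqrt (1 - \<rho>\<^sup>2)"
  have r: "r > 0" "r\<^sup>2 = 1 - \<rho>\<^sup>2" using \<rho>(2) by (auto simp: r_def)
  \<comment> \<open>The normalized residual of the regression of \<open>Y\<close> on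
    \<open>X\<close>. By \<open>charXZ\<close> the characteristic function of the pair
    \<open>(X, Z)\<close> is a product, so Kac's theorem gives independence.\<close>
  define Z where "Z = (\<lambda>\<omega>. (Y \<omega> - \<rho> * X \<omega>) / r)"
  have [measurable]: "Z \<in> borel_measurable M" unfolding Z_def by measurable
  have charXZ: "(\<integral>\<omega>. iexp (s * X \<omega> + t * Z \<omega>) \<partial>M) = of_real (exp (- (s\<^sup>2 + t\<^sup>2) / 2))" for s t
  proof -
    have "s * X \<omega> + t * Z \<omega> = (s - t * \<rho> / r) * X \<omega> + (t / r) * Y \<omega>" for \<omega>
      using r by (simp add: Z_def field_simps)
    moreover have "(s - t * \<rho> / r)\<^sup>2 + 2 * (s - t * \<rho> / r) * (t / r) * \<rho> + (t / r)\<^sup>2 = s\<^sup>2 + t\<^sup>2"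
    proof -
      have "(s - t * \<rho> / r)\<^sup>2 + 2 * (s - t * \<rho> / r) * (t / r) * \<rho> + (t / r)\<^sup>2 = s\<^sup>2 + t\<^sup>2 * (1 - \<rho>\<^sup>2) / r\<^sup>2"
        using r by (simp add: field_simps power2_eq_square)
      then show ?thesis using r \<rho>(2) by simp
    qed
    ultimately show ?thesis using char[of "s - t * \<rho> / r" "t / r"] by simp
  qed
  have Xd: "distributed M lborel X std_normal_density"
    using charXZ[of _ 0] by (intro std_normal_of_char M) auto
  have Zd: "distributed M lborel Z std_normal_density"
    using charXZ[of 0] by (intro std_normal_of_char M) auto
  have XZ: "distributed M (lborel \<Otimes>\<^sub>M lborel) (\<lambda>\<omega>. (X \<omega>, Z \<omega>)) (\<lambda>(x, z). ennreal (std_normal_density x * std_normal_density z))"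
  proof (rule distributed_jointI)
    fix A B :: "real set" assume AB [measurable]: "A \<in> sets lborel" "B \<in> sets lborel"
    have "emeasure M {\<omega>\<in>space M. X \<omega> \<in> A \<and> Z \<omega> \<in> B} = emeasure M {\<omega>\<in>space M. X \<omega> \<in> A} * emeasure M {\<omega>\<in>space M. Z \<omega> \<in> B}"
    proof -
      have "(\<integral>\<omega>. iexp (s * X \<omega> + t * Z \<omega>) \<partial>M) = (\<integral>\<omega>. iexp (s * X \<omega>) \<partial>M) * (\<integral>\<omega>. iexp (t * Z \<omega>) \<partial>M)" for s t
      proof -
        have "(\<integral>\<omega>. iexp (s * X \<omega>) \<partial>M) = of_real (exp (- s\<^sup>2 / 2))"
          "(\<integral>\<omega>. iexp (t * Z \<omega>) \<partial>M) = of_real (exp (- t\<^sup>2 / 2))"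
          using charXZ[of s 0] charXZ[of 0 t] by simp_all
        then show ?thesis
          unfolding charXZ by (simp only: of_real_mult[symmetric] mult_exp_exp) (simp add: add_divide_distrib)
      qed
      then show ?thesis
        using kac_independence[OF M, of X Z A B] AB by (simp add: emeasure_eq_measure ennreal_mult)
    qed
    also have "\<dots> = (\<integral>\<^sup>+x. ennreal (std_normal_density x) * indicator A x \<partial>lborel) * (\<integral>\<^sup>+z. ennreal (std_normal_density z) * indicator B z \<partial>lborel)"
      using distributed_emeasure[OF Xd AB(1)] distributed_emeasure[OF Zd AB(2)]
      by (simp add: vimage_def Int_def conj_commute)
    also have "\<dots> = (\<integral>\<^sup>+x. (\<integral>\<^sup>+z. ennreal (std_normal_density z) * indicator B z \<partial>lborel) * (ennreal (std_normal_density x) * indicator A x) \<partial>lborel)"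
      by (subst nn_integral_cmult) (auto simp: mult.commute)
    also have "\<dots> = (\<integral>\<^sup>+x. (\<integral>\<^sup>+z. ennreal (std_normal_density x) * (ennreal (std_normal_density z) * indicator B z) \<partial>lborel) * indicator A x \<partial>lborel)"
      by (subst nn_integral_cmult) (auto simp: ac_simps)
    finally show "emeasure M {\<omega>\<in>space M. X \<omega> \<in> A \<and> Z \<omega> \<in> B} =
      (\<integral>\<^sup>+x. (\<integral>\<^sup>+y. (case (x, y) of (x, z) \<Rightarrow> ennreal (std_normal_density x * std_normal_density z)) * indicator B y \<partial>lborel) * indicator A x \<partial>lborel)"
      by (simp add: ennreal_mult ac_simps)
  qed (auto intro: lborel.sigma_finite_measure_axioms)
  have Yeq: "Y \<omega> = \<rho> * X \<omega> + r * Z \<omega>" for \<omega> using r by (simp add: Z_def)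
  let ?q = "\<lambda>x y. std_normal_density x * normal_density (\<rho> * x) r y"
  \<comment> \<open>For fixed \<open>x\<close> the substitution y = \<rho> x + r z has Jacobian
    \<open>r\<close>, which is exactly what turns the conditional density into the standard
    one.\<close>
  have nd: "r * normal_density (\<rho> * x) r (\<rho> * x + r * z) = std_normal_density z" for x z
    using r(1) by (simp add: normal_density_def real_sqrt_mult field_simps)
  have "distr M (lborel \<Otimes>\<^sub>M lborel) (\<lambda>\<omega>. (X \<omega>, Y \<omega>)) = density (lborel \<Otimes>\<^sub>M lborel) (\<lambda>(x, y). ennreal (?q x y))"
  proof (rule measure_eqI)
    fix A :: "(real \<times> real) set" assume "A \<in> sets (distr M (lborel \<Otimes>\<^sub>M lborel) (\<lambda>\<omega>. (X \<omega>, Y \<omega>)))"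
    then have A: "A \<in> sets (lborel \<Otimes>\<^sub>M lborel)" and A' [measurable]: "A \<in> sets (borel \<Otimes>\<^sub>M borel)" 
      by (simp_all cong: sets_pair_measure_cong)
    have "emeasure (distr M (lborel \<Otimes>\<^sub>M lborel) (\<lambda>\<omega>. (X \<omega>, Y \<omega>))) A = (\<integral>\<^sup>+p. indicator A p \<partial>distr M (lborel \<Otimes>\<^sub>M lborel) (\<lambda>\<omega>. (X \<omega>, Y \<omega>)))"
      using A by simp
    also have "\<dots> = (\<integral>\<^sup>+\<omega>. indicator A (X \<omega>, Y \<omega>) \<partial>M)"
      using A by (subst nn_integral_distr) auto
    also have "\<dots> = (\<integral>\<^sup>+\<omega>. (\<lambda>(x, z). indicator A (x, \<rho> * x + r * z)) (X \<omega>, Z \<omega>) \<partial>M)"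
      by (simp add: Yeq)
    also have "\<dots> = (\<integral>\<^sup>+p. (\<lambda>(x, z). ennreal (std_normal_density x * std_normal_density z)) p * (\<lambda>(x, z). indicator A (x, \<rho> * x + r * z)) p \<partial>(lborel \<Otimes>\<^sub>M lborel))"
      by (rule distributed_nn_integral[OF XZ, symmetric]) measurable
    also have "\<dots> = (\<integral>\<^sup>+x. \<integral>\<^sup>+z. ennreal (std_normal_density x * std_normal_density z) * indicator A (x, \<rho> * x + r * z) \<partial>lborel \<partial>lborel)"
      by (subst lborel.nn_integral_fst[symmetric]) auto
    also have "\<dots> = (\<integral>\<^sup>+x. \<integral>\<^sup>+y. ennreal (?q x y) * indicator A (x, y) \<partial>lborel \<partial>lborel)"
    proof (rule nn_integral_cong)
      fix x :: real
      have "(\<integral>\<^sup>+y. ennreal (?q x y) * indicator A (x, y) \<partial>lborel) =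
          ennreal \<bar>r\<bar> * (\<integral>\<^sup>+z. ennreal (?q x (\<rho> * x + r * z)) * indicator A (x, \<rho> * x + r * z) \<partial>lborel)"
        using r by (intro nn_integral_real_affine) auto
      also have "\<dots> = (\<integral>\<^sup>+z. ennreal \<bar>r\<bar> * (ennreal (?q x (\<rho> * x + r * z)) * indicator A (x, \<rho> * x + r * z)) \<partial>lborel)"
        by (rule nn_integral_cmult[symmetric]) auto
      also have "\<dots> = (\<integral>\<^sup>+z. ennreal (std_normal_density x * (r * normal_density (\<rho> * x) r (\<rho> * x + r * z))) * indicator A (x, \<rho> * x + r * z) \<partial>lborel)"
        using r(1) by (intro nn_integral_cong) (subst mult.assoc[symmetric], subst ennreal_mult[symmetric], simp_all add: mult.left_commute)
      finally show "(\<integral>\<^sup>+z. ennreal (std_normal_density x * std_normal_density z) * indicator A (x, \<rho> * x + r * z) \<partial>lborel) =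
        (\<integral>\<^sup>+y. ennreal (?q x y) * indicator A (x, y) \<partial>lborel)"
        by (simp only: nd)
    qed
    also have "\<dots> = (\<integral>\<^sup>+p. (\<lambda>(x, y). ennreal (?q x y)) p * indicator A p \<partial>(lborel \<Otimes>\<^sub>M lborel))"
      by (subst lborel.nn_integral_fst[symmetric]) (auto simp: normal_density_def)
    also have "\<dots> = emeasure (density (lborel \<Otimes>\<^sub>M lborel) (\<lambda>(x, y). ennreal (?q x y))) A"
      using A by (subst emeasure_density) (auto simp: normal_density_def)
    finally show "emeasure (distr M (lborel \<Otimes>\<^sub>M lborel) (\<lambda>\<omega>. (X \<omega>, Y \<omega>))) A =
        emeasure (density (lborel \<Otimes>\<^sub>M lborel) (\<lambda>(x, y). ennreal (?q x y))) A" .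
  qed simp
  then show ?thesis
    unfolding distributed_def r_def[symmetric] by (auto simp: normal_density_def)
qed

section \<open>Mehler's formula and the covariance of functionals orthogonal to 1 and x\<close>

lemma has_bochner_integral_product:
  fixes f g :: "real \<Rightarrow> real"
  assumes f: "integrable lborel f" and g: "integrable lborel g"
  shows "has_bochner_integral (lborel \<Otimes>\<^sub>M lborel) (\<lambda>(x, y). f x * g y) ((\<integral>x. f x \<partial>lborel) * (\<integral>y. g y \<partial>lborel))"
proof -
  note [measurable] = borel_measurable_integrable[OF f] borel_measurable_integrable[OF g]
  have int: "integrable (lborel \<Otimes>\<^sub>M lborel) (\<lambda>(x, y). f x * g y)"
    using f g by (intro lborel_pair.Fubini_integrable) (auto simp: abs_mult)
  from lborel_pair.integral_fst'[OF int] show ?thesis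
    using int by (simp add: has_bochner_integral_iff)
qed

text \<open>The factorization comes from completing the square in \<open>y\<close>.\<close>

lemma mehler_square:
  fixes \<rho> :: real
  assumes "\<rho>\<^sup>2 < 1"
  defines "r \<equiv> sqrt (1 - \<rho>\<^sup>2)"
  shows "(std_normal_density x * normal_density (\<rho> * x) r y)\<^sup>2 / (std_normal_density x * std_normal_density y) =
    1 / (1 - \<rho>\<^sup>2) * (normal_density 0 (sqrt (1 + \<rho>\<^sup>2) / r) x * normal_density (2 * \<rho> / (1 + \<rho>\<^sup>2) * x) (r / sqrt (1 + \<rho>\<^sup>2)) y)"
proof -
  define n d where "n = 1 + \<rho>\<^sup>2" and "d = 1 - \<rho>\<^sup>2"
  have nd: "n > 0" "d > 0" "n + d = 2" "\<rho>\<^sup>2 = n - 1"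
    using assms by (auto simp: n_def d_def add_pos_nonneg)
  have var: "r\<^sup>2 = d" "(sqrt n / r)\<^sup>2 = n / d" "(r / sqrt n)\<^sup>2 = d / n"
    using nd by (auto simp: r_def d_def[symmetric] power_divide)
  \<comment> \<open>The two variances \<open>n / d\<close> and \<open>d / n\<close> are reciprocal,
    so the normalizing constants multiply to that of a standard normal pair.\<close>
  have const: "sqrt (2 * pi * (n / d)) * sqrt (2 * pi * (d / n)) = 2 * pi"
  proof -
    have "sqrt (2 * pi * (n / d)) * sqrt (2 * pi * (d / n)) = sqrt ((2 * pi)\<^sup>2)"
      unfolding real_sqrt_mult[symmetric] using nd
      by (intro arg_cong[where f=sqrt]) (simp add: field_simps power2_eq_square)
    also have "\<dots> = 2 * pi" unfolding real_sqrt_abs by simp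
    finally show ?thesis .
  qed
  have *: "- x\<^sup>2 * d\<^sup>2 - (n * w)\<^sup>2 = (2 * n * d) * (- x\<^sup>2 / (2 * (n / d)) - w\<^sup>2 / (2 * (d / n)))" for w
    using nd by (simp add: field_simps power2_eq_square)
  have expo: "- x\<^sup>2 / 2 - (y - \<rho> * x)\<^sup>2 / d + y\<^sup>2 / 2 = - x\<^sup>2 / (2 * (n / d)) - (y - 2 * \<rho> / n * x)\<^sup>2 / (2 * (d / n))"
  proof -
    have "(2 * n * d) * (- x\<^sup>2 / 2 - (y - \<rho> * x)\<^sup>2 / d + y\<^sup>2 / 2) = - x\<^sup>2 * n * d - 2 * n * (y - \<rho> * x)\<^sup>2 + y\<^sup>2 * n * d"
      using nd by (simp add: field_simps)
    \<comment> \<open>Completing the square in \<open>y\<close> rests on \<open>2 - d = n\<close>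
      and \<open>d\<^sup>2 + 4 * \<rho>\<^sup>2 = n\<^sup>2\<close>.\<close>
    also have "\<dots> = - x\<^sup>2 * d\<^sup>2 - (n * y - 2 * \<rho> * x)\<^sup>2"
      unfolding n_def d_def by (simp add: power2_eq_square algebra_simps)
    also have "(n * y - 2 * \<rho> * x) = n * (y - 2 * \<rho> / n * x)"
      using nd by (simp add: field_simps)
    also have "- x\<^sup>2 * d\<^sup>2 - (n * (y - 2 * \<rho> / n * x))\<^sup>2 =
        (2 * n * d) * (- x\<^sup>2 / (2 * (n / d)) - (y - 2 * \<rho> / n * x)\<^sup>2 / (2 * (d / n)))"
        by (rule *)
    finally show ?thesis using nd by (metis mult_cancel_left mult_pos_pos less_irrefl zero_less_numeral)
  qed
  have "(std_normal_density x * normal_density (\<rho> * x) r y)\<^sup>2 / (std_normal_density x * std_normal_density y) =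
      std_normal_density x * (normal_density (\<rho> * x) r y)\<^sup>2 / std_normal_density y"
    using normal_density_pos[of 1 0 x] by (simp add: power2_eq_square)
  also have "\<dots> = 1 / (2 * pi * d) * (exp (- x\<^sup>2 / 2) * (exp (- (y - \<rho> * x)\<^sup>2 / (2 * d)))\<^sup>2 / exp (- y\<^sup>2 / 2))"
    using nd unfolding std_normal_density_def normal_density_def[of "\<rho> * x"] var by (simp add: power_mult_distrib power_divide)
  also have "exp (- x\<^sup>2 / 2) * (exp (- (y - \<rho> * x)\<^sup>2 / (2 * d)))\<^sup>2 / exp (- y\<^sup>2 / 2) =
      exp (- x\<^sup>2 / 2 - (y - \<rho> * x)\<^sup>2 / d + y\<^sup>2 / 2)"
    unfolding exp_double[symmetric] mult_exp_exp exp_diff[symmetric] by simp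
  also have "\<dots> = exp (- x\<^sup>2 / (2 * (n / d))) * exp (- (y - 2 * \<rho> / n * x)\<^sup>2 / (2 * (d / n)))"
    unfolding expo mult_exp_exp by simp
  also have "1 / (2 * pi * d) * \<dots> = 1 / d * (exp (- x\<^sup>2 / (2 * (n / d))) * exp (- (y - 2 * \<rho> / n * x)\<^sup>2 / (2 * (d / n))) /
      (sqrt (2 * pi * (n / d)) * sqrt (2 * pi * (d / n))))"
    unfolding const by simp
  also have "\<dots> = 1 / d * (normal_density 0 (sqrt n / r) x * normal_density (2 * \<rho> / n * x) (r / sqrt n) y)"
    unfolding normal_density_def var by (simp add: power_divide)
  finally show ?thesis unfolding n_def d_def .
qed


text \<open>By \<open>mehler_square\<close> the integrand is the constant 1/(1-\<rho>^2) times a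
  probability density: integrating out \<open>y\<close> and then \<open>x\<close> gives 1. The value
  is the sum of \<rho>^(2k) over all k, one term per Hermite chaos.\<close>

lemma mehler_square_integral:
  fixes \<rho> :: real
  assumes "\<rho>\<^sup>2 < 1"
  defines "r \<equiv> sqrt (1 - \<rho>\<^sup>2)"
  shows "has_bochner_integral (lborel \<Otimes>\<^sub>M lborel)
    (\<lambda>(x, y). (std_normal_density x * normal_density (\<rho> * x) r y)\<^sup>2 / (std_normal_density x * std_normal_density y))
    (1 / (1 - \<rho>\<^sup>2))"
proof -
  define s t m where "s = sqrt (1 + \<rho>\<^sup>2) / r" and "t = r / sqrt (1 + \<rho>\<^sup>2)" and "m = 2 * \<rho> / (1 + \<rho>\<^sup>2)"
  have "r > 0" using assms by simp
  moreover have "sqrt (1 + \<rho>\<^sup>2) > 0" by (simp add: add_pos_nonneg)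
  ultimately have st: "s > 0" "t > 0" by (simp_all add: s_def t_def)
  let ?f = "\<lambda>(x, y). normal_density 0 s x * normal_density (m * x) t y"
  have int: "integrable (lborel \<Otimes>\<^sub>M lborel) ?f"
  proof (rule lborel_pair.Fubini_integrable)
    show "?f \<in> borel_measurable (lborel \<Otimes>\<^sub>M lborel)" unfolding normal_density_def by measurable
    have "(\<integral>y. norm (normal_density 0 s x * normal_density (m * x) t y) \<partial>lborel) = normal_density 0 s x" for x
      using st by (simp add: abs_mult)
    then show "integrable lborel (\<lambda>x. \<integral>y. norm (?f (x, y)) \<partial>lborel)" using st by simp
  qed (use st in auto)
  have "(\<integral>p. ?f p \<partial>(lborel \<Otimes>\<^sub>M lborel)) = 1"
    using lborel_pair.integral_fst'[OF int] st by simp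
  then have "has_bochner_integral (lborel \<Otimes>\<^sub>M lborel) ?f 1"
    using int by (simp add: has_bochner_integral_iff)
  then have "has_bochner_integral (lborel \<Otimes>\<^sub>M lborel) (\<lambda>p. 1 / (1 - \<rho>\<^sup>2) * ?f p) (1 / (1 - \<rho>\<^sup>2) * 1)"
    by (rule has_bochner_integral_mult_right)
  then show ?thesis
    using mehler_square[OF assms(1)]
    by (simp add: case_prod_beta' r_def s_def t_def m_def)
qed

text \<open>Gebelein's inequality for the second Hermite chaos and above: the difference \<open>k\<close> of the joint density and
  its projection to the first two chaoses satisfies \<open>\<integral> k\<^sup>2 / (\<phi> \<otimes> \<phi>) = \<rho>\<^sup>4 / (1 - \<rho>\<^sup>2)\<close>, and
  AM-GM replaces the Cauchy--Schwarz inequality.\<close>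

lemma second_chaos_covariance_bound:
  assumes M: "prob_space M" and X [measurable]: "X \<in> borel_measurable M" and Y [measurable]: "Y \<in> borel_measurable M"
    and gauss: "\<And>a b. gaussian_rv M (\<lambda>\<omega>. a * X \<omega> + b * Y \<omega>)"
    and m: "(\<integral>\<omega>. X \<omega> \<partial>M) = 0" "(\<integral>\<omega>. Y \<omega> \<partial>M) = 0"
    and v: "(\<integral>\<omega>. (X \<omega>)\<^sup>2 \<partial>M) = 1" "(\<integral>\<omega>. (Y \<omega>)\<^sup>2 \<partial>M) = 1"
    and \<rho>: "(\<integral>\<omega>. X \<omega> * Y \<omega> \<partial>M) = \<rho>" "\<rho>\<^sup>2 \<le> R" "0 < R" "R \<le> 1/4"
    and h [measurable]: "h \<in> borel_measurable borel"
    and h2: "integrable lborel (\<lambda>x. std_normal_density x * (h x)\<^sup>2)"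
      "(\<integral>x. std_normal_density x * (h x)\<^sup>2 \<partial>lborel) \<le> V" "V > 0"
    and h0: "(\<integral>x. std_normal_density x * h x \<partial>lborel) = 0"
    and h1: "(\<integral>x. std_normal_density x * (x * h x) \<partial>lborel) = 0"
  shows "\<bar>\<integral>\<omega>. h (X \<omega>) * h (Y \<omega>) \<partial>M\<bar> \<le> 2 * R * V"
proof -
  interpret prob_space M by fact
  let ?L = "lborel \<Otimes>\<^sub>M lborel :: (real \<times> real) measure"
  let ?\<phi> = "std_normal_density"
  define r where "r = sqrt (1 - \<rho>\<^sup>2)"
  define q where "q = (\<lambda>x y. ?\<phi> x * normal_density (\<rho> * x) r y)"
  define k where "k = (\<lambda>x y. q x y - ?\<phi> x * ?\<phi> y * (1 + \<rho> * x * y))"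
  have \<rho>1: "\<rho>\<^sup>2 < 1" using \<rho> by linarith
  have r: "r > 0" using \<rho>1 by (simp add: r_def)
  have \<phi>: "?\<phi> x > 0" for x by (rule normal_density_pos) simp
  have q0: "q x y \<ge> 0" for x y by (simp add: q_def)
  have [measurable]: "case_prod q \<in> borel_measurable (borel \<Otimes>\<^sub>M borel)" unfolding q_def normal_density_def by measurable
  have [measurable]: "case_prod k \<in> borel_measurable (borel \<Otimes>\<^sub>M borel)" unfolding k_def by measurable
  have XY: "distributed M ?L (\<lambda>\<omega>. (X \<omega>, Y \<omega>)) (\<lambda>p. ennreal ((\<lambda>(x, y). q x y) p))"
    using std_normal_pair_density[OF M X Y gauss m v \<rho>(1) \<rho>1] by (simp add: q_def r_def case_prod_beta')
  have via_q: "has_bochner_integral ?L (\<lambda>(x, y). q x y * u x y) (\<integral>\<omega>. u (X \<omega>) (Y \<omega>) \<partial>M)"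
    if [measurable]: "case_prod u \<in> borel_measurable (borel \<Otimes>\<^sub>M borel)" and "integrable M (\<lambda>\<omega>. u (X \<omega>) (Y \<omega>))" for u :: "real \<Rightarrow> real \<Rightarrow> real"
    using distributed_integrable[OF XY, of "case_prod u"] distributed_integral[OF XY, of "case_prod u"] that q0
    by (simp add: has_bochner_integral_iff case_prod_beta')
  have Xd: "distributed M lborel X ?\<phi>" and Yd: "distributed M lborel Y ?\<phi>"
  proof -
    have c: "(\<integral>\<omega>. iexp (t * U \<omega>) \<partial>M) = of_real (exp (- t\<^sup>2 / 2))"
      if U: "\<And>a. gaussian_rv M (\<lambda>\<omega>. a * U \<omega>)" "(\<integral>\<omega>. U \<omega> \<partial>M) = 0" "(\<integral>\<omega>. (U \<omega>)\<^sup>2 \<partial>M) = 1" for U t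
      using gaussian_rv_char[OF M U(1)[of t]] U(2,3) by (simp add: power_mult_distrib)
    show "distributed M lborel X ?\<phi>"
      using gauss[of _ 0] m v by (intro std_normal_of_char M c) auto
    show "distributed M lborel Y ?\<phi>"
      using gauss[of 0] m v by (intro std_normal_of_char M c) auto
  qed
  have sq_int: "integrable M (\<lambda>\<omega>. (u (X \<omega>))\<^sup>2)" "integrable M (\<lambda>\<omega>. (u (Y \<omega>))\<^sup>2)"
    if "u \<in> borel_measurable borel" "integrable lborel (\<lambda>x. ?\<phi> x * (u x)\<^sup>2)" for u :: "real \<Rightarrow> real"
    using distributed_integrable[OF Xd, of "\<lambda>x. (u x)\<^sup>2"] distributed_integrable[OF Yd, of "\<lambda>x. (u x)\<^sup>2"] that by auto
  have prod_int: "integrable M (\<lambda>\<omega>. u (X \<omega>) * u (Y \<omega>))"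
    if [measurable]: "u \<in> borel_measurable borel" and i: "integrable lborel (\<lambda>x. ?\<phi> x * (u x)\<^sup>2)" for u :: "real \<Rightarrow> real"
    by (rule Bochner_Integration.integrable_bound[OF Bochner_Integration.integrable_add[OF sq_int[OF that]]])
      (use abs_mult_le_squares in auto)
  have mom: "integrable lborel ?\<phi>" "(\<integral>x. ?\<phi> x \<partial>lborel) = 1"
    "integrable lborel (\<lambda>x. ?\<phi> x * x)" "(\<integral>x. ?\<phi> x * x \<partial>lborel) = 0"
    "integrable lborel (\<lambda>x. ?\<phi> x * x\<^sup>2)" "(\<integral>x. ?\<phi> x * x\<^sup>2 \<partial>lborel) = 1"
    using integrable_std_normal_moment[of 1] integrable_std_normal_moment[of 2]
      integral_std_normal_moment_odd[of 0] integral_std_normal_moment_even[of 1] by simp_all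
  \<comment> \<open>Pythagoras: the norm 1/(1-\<rho>^2) of the full kernel, minus twice the cross
    term 1 + \<rho>^2, plus the norm 1 + \<rho>^2 of the projection. The cross term is read off as
    the expectation of 1 + \<rho> X Y.\<close>
  have D: "has_bochner_integral ?L (\<lambda>(x, y). (k x y)\<^sup>2 / (?\<phi> x * ?\<phi> y)) (1 / (1 - \<rho>\<^sup>2) - 1 - \<rho>\<^sup>2)"
  proof -
    have 1: "has_bochner_integral ?L (\<lambda>(x, y). (q x y)\<^sup>2 / (?\<phi> x * ?\<phi> y)) (1 / (1 - \<rho>\<^sup>2))"
      using mehler_square_integral[OF \<rho>1] by (simp add: q_def r_def)
    have intXY: "integrable M (\<lambda>\<omega>. X \<omega> * Y \<omega>)" using prod_int[of "\<lambda>x. x"] mom by simp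
    have 2: "has_bochner_integral ?L (\<lambda>(x, y). q x y * (1 + \<rho> * x * y)) (1 + \<rho>\<^sup>2)"
    proof -
      have "(\<integral>\<omega>. 1 + \<rho> * (X \<omega> * Y \<omega>) \<partial>M) = 1 + \<rho>\<^sup>2"
        using intXY by (simp add: prob_space \<rho>(1) power2_eq_square)
      then show ?thesis
        using via_q[of "\<lambda>x y. 1 + \<rho> * (x * y)"] intXY by (simp add: mult.assoc)
    qed
    have 3: "has_bochner_integral ?L (\<lambda>p. (\<lambda>(x, y). ?\<phi> x * ?\<phi> y) p + 2 * \<rho> * (\<lambda>(x, y). (?\<phi> x * x) * (?\<phi> y * y)) p
        + \<rho>\<^sup>2 * (\<lambda>(x, y). (?\<phi> x * x\<^sup>2) * (?\<phi> y * y\<^sup>2)) p) (1 * 1 + 2 * \<rho> * (0 * 0) + \<rho>\<^sup>2 * (1 * 1))"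
      using has_bochner_integral_product[OF mom(1) mom(1)] has_bochner_integral_product[OF mom(3) mom(3)]
        has_bochner_integral_product[OF mom(5) mom(5)] unfolding mom(2,4,6)
      by (intro has_bochner_integral_add has_bochner_integral_mult_right)
    have B: "has_bochner_integral ?L (\<lambda>p. (\<lambda>(x, y). (q x y)\<^sup>2 / (?\<phi> x * ?\<phi> y)) p - 2 * (\<lambda>(x, y). q x y * (1 + \<rho> * x * y)) p
      + ((\<lambda>(x, y). ?\<phi> x * ?\<phi> y) p + 2 * \<rho> * (\<lambda>(x, y). (?\<phi> x * x) * (?\<phi> y * y)) p
        + \<rho>\<^sup>2 * (\<lambda>(x, y). (?\<phi> x * x\<^sup>2) * (?\<phi> y * y\<^sup>2)) p))
      (1 / (1 - \<rho>\<^sup>2) - 2 * (1 + \<rho>\<^sup>2) + (1 * 1 + 2 * \<rho> * (0 * 0) + \<rho>\<^sup>2 * (1 * 1)))"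
      by (intro has_bochner_integral_add has_bochner_integral_diff has_bochner_integral_mult_right 1 2 3)
    have eq: "(k x y)\<^sup>2 / (?\<phi> x * ?\<phi> y) = (q x y)\<^sup>2 / (?\<phi> x * ?\<phi> y) - 2 * (q x y * (1 + \<rho> * x * y))
      + (?\<phi> x * ?\<phi> y + 2 * \<rho> * ((?\<phi> x * x) * (?\<phi> y * y)) + \<rho>\<^sup>2 * ((?\<phi> x * x\<^sup>2) * (?\<phi> y * y\<^sup>2)))" for x y
    proof -
      have *: "(a - p * b)\<^sup>2 / p = a\<^sup>2 / p - 2 * (a * b) + p * b\<^sup>2" if "p \<noteq> 0" for a b p :: real
        using that by (simp add: field_simps power2_eq_square)
      have "?\<phi> x * ?\<phi> y \<noteq> 0" using \<phi>[of x] \<phi>[of y] by simp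
      from *[OF this, of "q x y" "1 + \<rho> * x * y"] show ?thesis
        by (simp add: k_def power2_eq_square algebra_simps)
    qed
    show ?thesis
      by (rule iffD1[OF has_bochner_integral_cong B]) (auto simp: eq)
  qed
  have Hint: "integrable lborel (\<lambda>x. ?\<phi> x * h x)" "integrable lborel (\<lambda>x. ?\<phi> x * x * h x)"
  proof -
    show "integrable lborel (\<lambda>x. ?\<phi> x * h x)"
    proof (rule Bochner_Integration.integrable_bound)
      show "integrable lborel (\<lambda>x. ?\<phi> x + ?\<phi> x * (h x)\<^sup>2)" using mom h2 by simp
      have "\<bar>?\<phi> x * h x\<bar> \<le> \<bar>?\<phi> x + ?\<phi> x * (h x)\<^sup>2\<bar>" for x
        using abs_mult_le_squares[of 1 "h x"] \<phi>[of x] mult_left_mono[of "\<bar>h x\<bar>" "1 + (h x)\<^sup>2" "?\<phi> x"]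
        by (simp add: abs_mult distrib_left)
      then show "AE x in lborel. norm (?\<phi> x * h x) \<le> norm (?\<phi> x + ?\<phi> x * (h x)\<^sup>2)" by simp
    qed auto
    show "integrable lborel (\<lambda>x. ?\<phi> x * x * h x)"
    proof (rule Bochner_Integration.integrable_bound)
      show "integrable lborel (\<lambda>x. ?\<phi> x * x\<^sup>2 + ?\<phi> x * (h x)\<^sup>2)" using mom h2 by simp
      have "\<bar>?\<phi> x * x * h x\<bar> \<le> \<bar>?\<phi> x * x\<^sup>2 + ?\<phi> x * (h x)\<^sup>2\<bar>" for x
        using abs_mult_le_squares[of x "h x"] \<phi>[of x] mult_left_mono[of "\<bar>x * h x\<bar>" "x\<^sup>2 + (h x)\<^sup>2" "?\<phi> x"]
        by (simp add: abs_mult distrib_left mult.assoc)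
      then show "AE x in lborel. norm (?\<phi> x * x * h x) \<le> norm (?\<phi> x * x\<^sup>2 + ?\<phi> x * (h x)\<^sup>2)" by simp
    qed auto
  qed
  \<comment> \<open>Passing from \<open>q\<close> to \<open>k\<close> does not change the integral,
    because the subtracted products integrate \<open>h\<close> against 1 or against x, which gives 0
    in both variables.\<close>
  have kh: "has_bochner_integral ?L (\<lambda>(x, y). k x y * (h x * h y)) (\<integral>\<omega>. h (X \<omega>) * h (Y \<omega>) \<partial>M)"
  proof -
    have "has_bochner_integral ?L (\<lambda>p. (\<lambda>(x, y). q x y * (h x * h y)) p - ((\<lambda>(x, y). (?\<phi> x * h x) * (?\<phi> y * h y)) p
        + \<rho> * (\<lambda>(x, y). (?\<phi> x * x * h x) * (?\<phi> y * y * h y)) p)) ((\<integral>\<omega>. h (X \<omega>) * h (Y \<omega>) \<partial>M) - (0 * 0 + \<rho> * (0 * 0)))"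
      using has_bochner_integral_product[OF Hint(1) Hint(1)] has_bochner_integral_product[OF Hint(2) Hint(2)]
      unfolding h0 h1[unfolded mult.assoc[symmetric]]
      by (intro has_bochner_integral_add has_bochner_integral_diff has_bochner_integral_mult_right via_q prod_int[OF h h2(1)]) auto
    then show ?thesis
      by (simp add: k_def case_prod_beta' algebra_simps)
  qed
  have hh: "has_bochner_integral ?L (\<lambda>(x, y). (?\<phi> x * (h x)\<^sup>2) * (?\<phi> y * (h y)\<^sup>2))
      ((\<integral>x. ?\<phi> x * (h x)\<^sup>2 \<partial>lborel) * (\<integral>x. ?\<phi> x * (h x)\<^sup>2 \<partial>lborel))"
    by (rule has_bochner_integral_product[OF h2(1) h2(1)])
  \<comment> \<open>The weight of the AM-GM inequality below. It balances the two terms: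
    \<open>l * (V * V)\<close> is \<open>R * V\<close> and the kernel term is at most 4/3 of that,
    so half of the sum is 7/6 \<open>R * V\<close>. Using the bound \<open>R\<close> instead of
    \<rho>^2 keeps \<open>l\<close> positive when \<rho> vanishes.\<close>
  define l where "l = R / V"
  have l: "l > 0" using \<rho> h2 by (simp add: l_def)
  let ?B = "(\<lambda>p. (l * (\<lambda>(x, y). (?\<phi> x * (h x)\<^sup>2) * (?\<phi> y * (h y)\<^sup>2)) p + 1 / l * (\<lambda>(x, y). (k x y)\<^sup>2 / (?\<phi> x * ?\<phi> y)) p) * (1 / 2))"
  let ?b = "\<integral>x. ?\<phi> x * (h x)\<^sup>2 \<partial>lborel"
  have B: "has_bochner_integral ?L ?B ((l * (?b * ?b) + 1 / l * (1 / (1 - \<rho>\<^sup>2) - 1 - \<rho>\<^sup>2)) * (1 / 2))"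
    by (intro has_bochner_integral_add has_bochner_integral_mult_right has_bochner_integral_mult_left hh D)
  have "\<bar>\<integral>\<omega>. h (X \<omega>) * h (Y \<omega>) \<partial>M\<bar> = \<bar>\<integral>p. (\<lambda>(x, y). k x y * (h x * h y)) p \<partial>?L\<bar>"
    using has_bochner_integral_integral_eq[OF kh] by simp
  also have "\<dots> \<le> (\<integral>p. ?B p \<partial>?L)"
  proof (rule order_trans[OF integral_abs_bound], rule integral_mono)
    show "integrable ?L (\<lambda>p. \<bar>(\<lambda>(x, y). k x y * (h x * h y)) p\<bar>)" "integrable ?L ?B"
      using kh B by (auto simp: has_bochner_integral_iff)
    fix p :: "real \<times> real"
    obtain x y where p: "p = (x, y)" by force
    define P where "P = ?\<phi> x * ?\<phi> y"
    have P: "P > 0" using \<phi> by (simp add: P_def)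
    have "\<bar>a * b\<bar> \<le> (l * (P * b\<^sup>2) + 1 / l * (a\<^sup>2 / P)) * (1 / 2)" for a b
    proof -
      have "0 \<le> (\<bar>b\<bar> * (l * P) - \<bar>a\<bar>)\<^sup>2 / (l * P)" using l P by simp
      also have "\<dots> = l * (P * b\<^sup>2) + 1 / l * (a\<^sup>2 / P) - 2 * \<bar>a * b\<bar>"
        using l P by (simp add: power2_diff field_simps power2_eq_square abs_mult)
      finally show ?thesis by simp
    qed
    from this[of "k x y" "h x * h y"] show "\<bar>(\<lambda>(x, y). k x y * (h x * h y)) p\<bar> \<le> ?B p"
      by (simp add: p P_def power_mult_distrib ac_simps)
  qed
  also have "\<dots> = (l * (?b * ?b) + 1 / l * (1 / (1 - \<rho>\<^sup>2) - 1 - \<rho>\<^sup>2)) * (1 / 2)"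
    using B by (rule has_bochner_integral_integral_eq)
  also have "\<dots> \<le> (l * (V * V) + 1 / l * (4 / 3 * R\<^sup>2)) * (1 / 2)"
  proof -
    have b: "0 \<le> ?b" by simp
    have "1 / (1 - \<rho>\<^sup>2) - 1 - \<rho>\<^sup>2 = \<rho>\<^sup>2 * \<rho>\<^sup>2 / (1 - \<rho>\<^sup>2)"
      using \<rho>1 by (simp add: field_simps)
    also have "\<dots> \<le> R * R / (3 / 4)"
      using \<rho> by (intro frac_le mult_mono) auto
    finally have "1 / (1 - \<rho>\<^sup>2) - 1 - \<rho>\<^sup>2 \<le> 4 / 3 * R\<^sup>2" by (simp add: power2_eq_square)
    then show ?thesis
      using l b h2(2) less_imp_le[OF h2(3)] by (intro mult_right_mono add_mono mult_left_mono mult_mono) auto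
  qed
  also have "\<dots> = 7 / 6 * (R * V)"
    using \<rho> h2 by (simp add: l_def power2_eq_square field_simps)
  also have "\<dots> \<le> 2 * R * V" using \<rho> h2 by simp
  finally show ?thesis .
qed

section \<open>Double sums of the kernel\<close>

text \<open>Integral comparison by telescoping: the mean value theorem bounds the increments of x^b
  / b from below by d^(b-1), because the exponent b - 1 is not positive.\<close>

lemma sum_powr_le:
  fixes b :: real
  assumes b: "0 < b" "b \<le> 1"
  shows "(\<Sum>d=1..n. real d powr (b - 1)) \<le> real n powr b / b"
proof (induction n)
  case (Suc n)
  have "b * real (Suc n) powr (b - 1) \<le> real (Suc n) powr b - real n powr b"
  proof -
    have "\<exists>l z. real n < z \<and> z < real (Suc n) \<and> DERIV (\<lambda>x. x powr b) z :> l \<and>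
        real (Suc n) powr b - real n powr b = (real (Suc n) - real n) * l"
    proof (rule MVT)
      show "continuous_on {real n..real (Suc n)} (\<lambda>x. x powr b)"
        using b by (intro continuous_on_powr' continuous_intros) auto
      show "(\<lambda>x. x powr b) differentiable (at x)" if "real n < x" "x < real (Suc n)" for x
        using that DERIV_powr[of "\<lambda>x. x" 1 x "\<lambda>_. b" 0] has_real_derivative_powr[of x b]
        by (auto simp: real_differentiable_def)
    qed simp
    then obtain l z where z: "real n < z" "z < real (Suc n)" "DERIV (\<lambda>x. x powr b) z :> l"
      "real (Suc n) powr b - real n powr b = l" by auto
    have "z > 0" using z(1) by (meson le_less_trans of_nat_0_le_iff)
    then have "l = b * z powr (b - 1)"
      using DERIV_unique[OF z(3) has_real_derivative_powr] by simp
    moreover have "real (Suc n) powr (b - 1) \<le> z powr (b - 1)"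
      using z \<open>z > 0\<close> b by (intro powr_mono2') auto
    ultimately show ?thesis using z(4) b by simp
  qed
  then have "real (Suc n) powr (b - 1) \<le> (real (Suc n) powr b - real n powr b) / b"
    using b by (simp add: field_simps)
  then show ?case using Suc.IH by (simp add: diff_divide_distrib)
qed simp

text \<open>Every distance between 1 and \<open>D\<close> is attained at most twice, once on each
  side of \<open>i\<close>.\<close>

lemma sum_near_diagonal_le:
  fixes f :: "nat \<Rightarrow> real"
  assumes f: "\<And>d. f d \<ge> 0"
  shows "(\<Sum>j\<in>{j\<in>{1..N}. j \<noteq> i \<and> nat \<bar>int i - int j\<bar> \<le> D}. f (nat \<bar>int i - int j\<bar>)) \<le> 2 * (\<Sum>d=1..D. f d)"
proof -
  let ?A = "{j\<in>{1..N}. j \<noteq> i \<and> nat \<bar>int i - int j\<bar> \<le> D}"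
  let ?d = "\<lambda>j. nat \<bar>int i - int j\<bar>"
  have half: "(\<Sum>j\<in>B. f (?d j)) \<le> (\<Sum>d=1..D. f d)" if "B \<subseteq> ?A" "inj_on ?d B" for B
  proof -
    have "(\<Sum>j\<in>B. f (?d j)) = sum f (?d ` B)" using that by (simp add: sum.reindex)
    also have "\<dots> \<le> (\<Sum>d=1..D. f d)" using that f by (intro sum_mono2) auto
    finally show ?thesis .
  qed
  have "(\<Sum>j\<in>?A. f (?d j)) = (\<Sum>j\<in>{j\<in>?A. j < i}. f (?d j)) + (\<Sum>j\<in>{j\<in>?A. i < j}. f (?d j))"
    by (subst sum.union_disjoint[symmetric]) (auto intro: sum.cong)
  also have "\<dots> \<le> (\<Sum>d=1..D. f d) + (\<Sum>d=1..D. f d)"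
    by (intro add_mono half) (auto simp: inj_on_def)
  finally show ?thesis by simp
qed

lemma powr_tendsto_0: "b < 0 \<Longrightarrow> (\<lambda>n. real n powr b) \<longlonglongrightarrow> 0"
  by (rule tendsto_neg_powr[OF _ filterlim_real_sequentially])

text \<open>The pairs are split at distance \<delta> n. In the band a row costs O((\<delta>
  n)^(a-1)), finite precisely because a > 1, so all rows cost O(\<delta>^(a-1) n^a). Beyond it there
  are at most (n T)^2 pairs, each of size \<epsilon> n^(a-2).\<close>

lemma offdiag_sum_tendsto_0:
  fixes u :: "nat \<Rightarrow> nat \<Rightarrow> real" and a C T :: real
  assumes a: "1 < a" "a < 2" and C: "C \<ge> 0" and T: "T \<ge> 0"
    and bd: "\<And>i j. i \<ge> 1 \<Longrightarrow> j \<ge> 1 \<Longrightarrow> i \<noteq> j \<Longrightarrow> \<bar>u i j\<bar> \<le> C * \<bar>real i - real j\<bar> powr (a - 2)"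
    and far: "\<And>\<delta> \<epsilon>. \<delta> > 0 \<Longrightarrow> \<epsilon> > 0 \<Longrightarrow> \<forall>\<^sub>F n in sequentially. \<forall>i j. 1 \<le> i \<longrightarrow> 1 \<le> j \<longrightarrow>
      real i \<le> real n * T \<longrightarrow> real j \<le> real n * T \<longrightarrow> \<delta> * real n < \<bar>real i - real j\<bar> \<longrightarrow> \<bar>u i j\<bar> \<le> \<epsilon> * real n powr (a - 2)"
  shows "(\<lambda>n. real n powr (- a) * (\<Sum>i=1..nat \<lfloor>real n * T\<rfloor>. \<Sum>j=1..nat \<lfloor>real n * T\<rfloor>. if i = j then 0 else \<bar>u i j\<bar>)) \<longlonglongrightarrow> 0"
proof (rule LIMSEQ_I)
  fix r :: real assume r: "r > 0"
  \<comment> \<open>Both contributions are to be at most r/4: \<open>\<epsilon>\<close> is fitted to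
    the far pairs and \<open>e\<close>, the value of \<open>\<delta> powr (a - 1)\<close>, to the
    band. The summands 1 exclude division by zero.\<close>
  define \<epsilon> where "\<epsilon> = r / (4 * (T\<^sup>2 + 1))"
  define e where "e = r * (a - 1) / (4 * (2 * C * T + 1))"
  define \<delta> where "\<delta> = e powr (1 / (a - 1))"
  have CT: "2 * C * T + 1 > 0" using C T by (simp add: add_nonneg_pos)
  have T2: "T\<^sup>2 + 1 > 0" by (simp add: add_nonneg_pos)
  have e: "e > 0" using r a CT by (simp add: e_def)
  have \<delta>: "\<delta> > 0" "\<delta> powr (a - 1) = e" using e a by (auto simp: \<delta>_def powr_powr)
  have \<epsilon>: "\<epsilon> > 0" using r T2 by (simp add: \<epsilon>_def)
  have small: "2 * C * T * e / (a - 1) + T\<^sup>2 * \<epsilon> < r"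
  proof -
    have "2 * C * T * e / (a - 1) = r / 4 * (2 * C * T / (2 * C * T + 1))"
    proof -
      have "p * (r * (a - 1) / (4 * q)) / (a - 1) = r / 4 * (p / q)" for p q
        using a by simp
      then show ?thesis unfolding e_def .
    qed
    also have "\<dots> \<le> r / 4 * 1" using r CT by (intro mult_left_mono) (auto simp: divide_le_eq)
    finally have 1: "2 * C * T * e / (a - 1) \<le> r / 4" by simp
    have "T\<^sup>2 * \<epsilon> = r / 4 * (T\<^sup>2 / (T\<^sup>2 + 1))" by (simp add: \<epsilon>_def)
    also have "\<dots> \<le> r / 4 * 1" using r T2 by (intro mult_left_mono) (auto simp: divide_le_eq)
    finally show ?thesis using 1 r by simp
  qed
  have "\<forall>\<^sub>F n in sequentially. norm (real n powr (- a) * (\<Sum>i=1..nat \<lfloor>real n * T\<rfloor>. \<Sum>j=1..nat \<lfloor>real n * T\<rfloor>. if i = j then 0 else \<bar>u i j\<bar>) - 0) < r"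
    using far[OF \<delta>(1) \<epsilon>] eventually_gt_at_top[of 0]
  proof eventually_elim
    case (elim n)
    define N where "N = nat \<lfloor>real n * T\<rfloor>"
    define D where "D = nat \<lfloor>\<delta> * real n\<rfloor>"
    have N: "real N \<le> real n * T" using T by (simp add: N_def)
    have D: "real D \<le> \<delta> * real n" using \<delta> by (simp add: D_def)
    let ?d = "\<lambda>i j. nat \<bar>int i - int j\<bar>"
    have d: "real (?d i j) = \<bar>real i - real j\<bar>" for i j by (simp add: of_nat_nat)
    have row: "(\<Sum>j=1..N. if i = j then 0 else \<bar>u i j\<bar>) \<le> 2 * C * (\<delta> * real n) powr (a - 1) / (a - 1) + real N * (\<epsilon> * real n powr (a - 2))"
      if i: "i \<in> {1..N}" for i
    proof -
      have "(\<Sum>j=1..N. if i = j then 0 else \<bar>u i j\<bar>) \<le>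
          (\<Sum>j=1..N. (if j \<noteq> i \<and> ?d i j \<le> D then C * real (?d i j) powr (a - 2) else 0) + \<epsilon> * real n powr (a - 2))"
      proof (rule sum_mono)
        fix j assume j: "j \<in> {1..N}"
        have e0: "0 \<le> \<epsilon> * real n powr (a - 2)" using \<epsilon> by simp
        show "(if i = j then 0 else \<bar>u i j\<bar>) \<le>
            (if j \<noteq> i \<and> ?d i j \<le> D then C * real (?d i j) powr (a - 2) else 0) + \<epsilon> * real n powr (a - 2)"
        proof (cases "j \<noteq> i \<and> ?d i j \<le> D")
          case True
          then show ?thesis using bd[of i j] i j e0 by (auto simp: d)
        next
          case False
          show ?thesis
          proof (cases "i = j")
            case True
            then show ?thesis using e0 by simp
          next
            case False
            with \<open>\<not> (j \<noteq> i \<and> ?d i j \<le> D)\<close> have "D < ?d i j" by auto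
            then have "\<lfloor>\<delta> * real n\<rfloor> < int (?d i j)" unfolding D_def by linarith
            then have "\<delta> * real n < real (?d i j)" by (simp add: floor_less_iff)
            moreover have "real i \<le> real n * T" "real j \<le> real n * T" using i j N by auto
            ultimately have "\<bar>u i j\<bar> \<le> \<epsilon> * real n powr (a - 2)"
              using elim(1) i j unfolding d by auto
            then show ?thesis using False \<open>\<not> (j \<noteq> i \<and> ?d i j \<le> D)\<close> by simp
          qed
        qed
      qed
      also have "\<dots> = (\<Sum>j\<in>{j\<in>{1..N}. j \<noteq> i \<and> ?d i j \<le> D}. C * real (?d i j) powr (a - 2)) + real N * (\<epsilon> * real n powr (a - 2))"
        by (subst sum.inter_filter) (simp_all add: sum.distrib)
      also have "(\<Sum>j\<in>{j\<in>{1..N}. j \<noteq> i \<and> ?d i j \<le> D}. C * real (?d i j) powr (a - 2)) \<le> 2 * (\<Sum>d=1..D. C * real d powr (a - 2))"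
        using C by (intro sum_near_diagonal_le[of "\<lambda>d. C * real d powr (a - 2)"]) auto
      also have "\<dots> = 2 * C * (\<Sum>d=1..D. real d powr ((a - 1) - 1))"
        by (simp add: sum_distrib_left[symmetric] mult.assoc)
      also have "\<dots> \<le> 2 * C * (real D powr (a - 1) / (a - 1))"
        using C a by (intro mult_left_mono sum_powr_le) auto
      also have "\<dots> \<le> 2 * C * ((\<delta> * real n) powr (a - 1) / (a - 1))"
        using C a D by (intro mult_left_mono divide_right_mono powr_mono2) auto
      finally show ?thesis by simp
    qed
    have n: "real n > 0" using elim by simp
    have "(\<Sum>i=1..N. \<Sum>j=1..N. if i = j then 0 else \<bar>u i j\<bar>) \<le>
        real (card {1..N}) * (2 * C * (\<delta> * real n) powr (a - 1) / (a - 1) + real N * (\<epsilon> * real n powr (a - 2)))"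
      by (rule sum_bounded_above) (rule row)
    also have "\<dots> \<le> (real n * T) * (2 * C * (\<delta> * real n) powr (a - 1) / (a - 1) + (real n * T) * (\<epsilon> * real n powr (a - 2)))"
      unfolding card_atLeastAtMost diff_Suc_1 using N C T a \<epsilon> by (intro mult_mono add_left_mono mult_right_mono add_nonneg_nonneg divide_nonneg_pos) auto
    also have "\<dots> = real n powr a * (2 * C * T * e / (a - 1) + T\<^sup>2 * \<epsilon>)"
    proof -
      have p1: "real n * real n powr (a - 1) = real n powr a" using n by (simp add: powr_diff)
      have p2: "real n * real n * real n powr (a - 2) = real n powr a" using n by (simp add: powr_diff power2_eq_square)
      have "(real n * T) * (2 * C * (\<delta> * real n) powr (a - 1) / (a - 1) + (real n * T) * (\<epsilon> * real n powr (a - 2))) =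
        (real n * real n powr (a - 1)) * (2 * C * T * e / (a - 1)) + (real n * real n * real n powr (a - 2)) * (T\<^sup>2 * \<epsilon>)"
        using \<delta> n by (simp add: powr_mult power2_eq_square algebra_simps)
      then show ?thesis unfolding p1 p2 by (simp add: distrib_left)
    qed
    finally have "real n powr (- a) * (\<Sum>i=1..N. \<Sum>j=1..N. if i = j then 0 else \<bar>u i j\<bar>) \<le>
        real n powr (- a) * (real n powr a * (2 * C * T * e / (a - 1) + T\<^sup>2 * \<epsilon>))"
      by (rule mult_left_mono) simp
    also have "\<dots> = 2 * C * T * e / (a - 1) + T\<^sup>2 * \<epsilon>"
      using n by (simp add: powr_minus)
    also have "\<dots> < r" by (rule small)
    finally have "real n powr (- a) * (\<Sum>i=1..N. \<Sum>j=1..N. if i = j then 0 else \<bar>u i j\<bar>) < r" .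
    moreover have "0 \<le> real n powr (- a) * (\<Sum>i=1..N. \<Sum>j=1..N. if i = j then 0 else \<bar>u i j\<bar>)"
      by (intro mult_nonneg_nonneg sum_nonneg) auto
    ultimately show ?case unfolding N_def[symmetric] by simp
  qed
  then show "\<exists>no. \<forall>n\<ge>no. norm (real n powr (- a) * (\<Sum>i=1..nat \<lfloor>real n * T\<rfloor>. \<Sum>j=1..nat \<lfloor>real n * T\<rfloor>. if i = j then 0 else \<bar>u i j\<bar>) - 0) < r"
    by (simp add: eventually_sequentially)
qed

text \<open>If \<open>F\<close> is the covariance function of a process, then \<open>mixed_diff F x y\<close> is the covariance of its
  increments over \<open>[x - 1, x]\<close> and \<open>[y - 1, y]\<close>.\<close>

definition mixed_diff :: "(real \<Rightarrow> real \<Rightarrow> real) \<Rightarrow> real \<Rightarrow> real \<Rightarrow> real" where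
  "mixed_diff F x y = F x y - F (x - 1) y - F x (y - 1) + F (x - 1) (y - 1)"

lemma sum_mixed_diff:
  "(\<Sum>i=1..m. \<Sum>j=1..l. mixed_diff F (real i) (real j)) = F (real m) (real l) - F 0 (real l) - F (real m) 0 + F 0 0"
proof -
  have row: "(\<Sum>j=1..l. mixed_diff F x (real j)) = (F x (real l) - F (x - 1) (real l)) - (F x 0 - F (x - 1) 0)" for x
    by (induction l) (auto simp: mixed_diff_def)
  show ?thesis unfolding row by (induction m) auto
qed

text \<open>The mean value theorem in \<open>x\<close> for the difference
  \<open>F x y0 - F x (y0 - 1)\<close>, then in \<open>y\<close> for \<open>F1\<close>. Derivatives
  are taken only at interior points of each interval of the mean value theorem, with mere continuity
  at its ends, because unit squares touching the axes occur.\<close>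

lemma mixed_diff_mean_value:
  assumes c1: "\<And>y. y \<in> {y0 - 1, y0} \<Longrightarrow> continuous_on {x0 - 1..x0} (\<lambda>x. F x y)"
    and d1: "\<And>x y. x \<in> {x0 - 1<..<x0} \<Longrightarrow> y \<in> {y0 - 1, y0} \<Longrightarrow> ((\<lambda>x. F x y) has_real_derivative F1 x y) (at x)"
    and c2: "\<And>x. x \<in> {x0 - 1<..<x0} \<Longrightarrow> continuous_on {y0 - 1..y0} (F1 x)"
    and d2: "\<And>x y. x \<in> {x0 - 1<..<x0} \<Longrightarrow> y \<in> {y0 - 1<..<y0} \<Longrightarrow> (F1 x has_real_derivative F12 x y) (at y)"
  obtains x y where "x \<in> {x0 - 1<..<x0}" "y \<in> {y0 - 1<..<y0}" "mixed_diff F x0 y0 = F12 x y"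
proof -
  have mvt: "\<exists>z\<in>{b - 1<..<b}. f b - f (b - 1) = f' z"
    if "continuous_on {b - 1..b} f" "\<And>z. z \<in> {b - 1<..<b} \<Longrightarrow> (f has_real_derivative f' z) (at z)"
    for f f' :: "real \<Rightarrow> real" and b
  proof -
    have "\<exists>l z. b - 1 < z \<and> z < b \<and> DERIV f z :> l \<and> f b - f (b - 1) = (b - (b - 1)) * l"
      using that by (intro MVT) (auto simp: real_differentiable_def)
    then obtain l z where z: "z \<in> {b - 1<..<b}" "DERIV f z :> l" "f b - f (b - 1) = l" by auto
    then show ?thesis using DERIV_unique[OF z(2) that(2)[OF z(1)]] by auto
  qed
  have "\<exists>x\<in>{x0 - 1<..<x0}. (F x0 y0 - F x0 (y0 - 1)) - (F (x0 - 1) y0 - F (x0 - 1) (y0 - 1)) = F1 x y0 - F1 x (y0 - 1)"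
    by (rule mvt) (auto intro!: continuous_intros derivative_eq_intros c1 d1)
  then obtain x where x: "x \<in> {x0 - 1<..<x0}" "mixed_diff F x0 y0 = F1 x y0 - F1 x (y0 - 1)"
    by (auto simp: mixed_diff_def)
  moreover have "\<exists>y\<in>{y0 - 1<..<y0}. F1 x y0 - F1 x (y0 - 1) = F12 x y"
    by (rule mvt) (use x c2 d2 in auto)
  ultimately show ?thesis using that by auto
qed


section \<open>The bifractional kernel as a mixed second derivative\<close>

context
  fixes H K a :: real
  assumes H: "0 < H" "H < 1" and K: "0 < K" "K < 1" and HK: "2 * H * K > 1" and a_def: "a = 2 * H * K"
begin

text \<open>The two summands of g degenerate in different places and are estimated separately: this
  one only at the origin, \<open>singular_kernel\<close> on the whole diagonal. Up to the factor
  2^(-K) they are the mixed second derivatives of \<open>smooth_cov\<close> and of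
  \<open>- singular_cov\<close>.\<close>

definition smooth_kernel :: "real \<Rightarrow> real \<Rightarrow> real" where
  "smooth_kernel x y = 2 powr (2 - K) * H\<^sup>2 * K * (K - 1) * (x powr (2 * H) + y powr (2 * H)) powr (K - 2) * (x * y) powr (2 * H - 1)"

definition singular_kernel :: "real \<Rightarrow> real \<Rightarrow> real" where
  "singular_kernel x y = 2 powr (1 - K) * H * K * (a - 1) * \<bar>x - y\<bar> powr (a - 2)"

definition smooth_cov :: "real \<Rightarrow> real \<Rightarrow> real" where
  "smooth_cov x y = (x powr (2 * H) + y powr (2 * H)) powr K"

definition singular_cov :: "real \<Rightarrow> real \<Rightarrow> real" where
  "singular_cov x y = \<bar>x - y\<bar> powr a"

lemma a_bounds: "1 < a" "a < 2" and H_gt: "1 < 2 * H"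
proof -
  have "2 * H * K < 2 * H * 1" using H K by (intro mult_strict_left_mono) auto
  then show "1 < 2 * H" "1 < a" "a < 2" unfolding a_def using HK H by linarith+
qed

lemma g_kernel_split: "g_kernel H K x y = smooth_kernel x y + singular_kernel x y"
  unfolding g_kernel_def smooth_kernel_def singular_kernel_def a_def[symmetric] ..

lemma bifractional_cov_split: "bifractional_cov H K x y = 2 powr (- K) * (smooth_cov x y - singular_cov x y)"
  unfolding bifractional_cov_def smooth_cov_def singular_cov_def a_def[symmetric] ..

text \<open>The larger coordinate controls both factors: the sum of powers from below, as its
  exponent K - 2 is negative, and the product from above, as 2H - 1 is positive. The constant 4
  bounds 2^(2-K).\<close>

lemma smooth_kernel_bound_max:
  assumes "0 \<le> x" "0 \<le> y" "0 < max x y"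
  shows "\<bar>smooth_kernel x y\<bar> \<le> 4 * max x y powr (a - 2)"
proof -
  define m where "m = max x y"
  have m: "m > 0" "x \<le> m" "y \<le> m" "m = x \<or> m = y" using assms by (auto simp: m_def)
  have "(x * y) powr (2 * H - 1) \<le> (m * m) powr (2 * H - 1)"
    using m assms H_gt by (intro powr_mono2 mult_mono) auto
  also have "\<dots> = m powr (4 * H - 2)" using m by (simp add: powr_mult flip: powr_add)
  finally have 1: "(x * y) powr (2 * H - 1) \<le> m powr (4 * H - 2)" .
  have "m powr (2 * H) \<le> x powr (2 * H) + y powr (2 * H)"
    using m(4) by auto
  then have "(x powr (2 * H) + y powr (2 * H)) powr (K - 2) \<le> (m powr (2 * H)) powr (K - 2)"
    using m K by (intro powr_mono2') auto
  also have "\<dots> = m powr (2 * H * (K - 2))" by (simp add: powr_powr)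
  finally have 2: "(x powr (2 * H) + y powr (2 * H)) powr (K - 2) \<le> m powr (2 * H * (K - 2))" .
  have "\<bar>2 powr (2 - K) * H\<^sup>2 * K * (K - 1)\<bar> \<le> 4 * 1 * 1 * 1"
  proof -
    have "2 powr (2 - K) \<le> 2 powr 2" using K by (intro powr_mono) auto
    then have "2 powr (2 - K) \<le> (4::real)" by simp
    moreover have "H\<^sup>2 \<le> 1" using H by (simp add: power_le_one)
    ultimately show ?thesis unfolding abs_mult using K by (intro mult_mono) auto
  qed
  then have 3: "\<bar>2 powr (2 - K) * H\<^sup>2 * K * (K - 1)\<bar> \<le> 4" by simp
  have "\<bar>smooth_kernel x y\<bar> = \<bar>2 powr (2 - K) * H\<^sup>2 * K * (K - 1)\<bar> * (x powr (2 * H) + y powr (2 * H)) powr (K - 2) * (x * y) powr (2 * H - 1)"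
    unfolding smooth_kernel_def by (simp add: abs_mult)
  also have "\<dots> \<le> 4 * m powr (2 * H * (K - 2)) * m powr (4 * H - 2)"
    using 1 2 3 by (intro mult_mono) auto
  also have "\<dots> = 4 * m powr (2 * H * (K - 2) + (4 * H - 2))" by (simp add: powr_add)
  also have "2 * H * (K - 2) + (4 * H - 2) = a - 2" by (simp add: a_def algebra_simps)
  finally show ?thesis by (simp add: m_def)
qed

text \<open>The distance of two nonnegative numbers is at most their maximum and the exponent is
  negative; this brings the smooth part to the same form as the singular one.\<close>

lemma smooth_kernel_bound:
  assumes "0 \<le> x" "0 \<le> y" "x \<noteq> y"
  shows "\<bar>smooth_kernel x y\<bar> \<le> 4 * \<bar>x - y\<bar> powr (a - 2)"
proof -
  have "\<bar>smooth_kernel x y\<bar> \<le> 4 * max x y powr (a - 2)" using assms by (intro smooth_kernel_bound_max) auto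
  also have "\<dots> \<le> 4 * \<bar>x - y\<bar> powr (a - 2)"
    using assms a_bounds by (intro mult_left_mono powr_mono2') auto
  finally show ?thesis .
qed

lemma singular_kernel_bound: "\<bar>singular_kernel x y\<bar> \<le> 2 * \<bar>x - y\<bar> powr (a - 2)"
proof -
  have "\<bar>2 powr (1 - K) * H * K * (a - 1)\<bar> \<le> 2 * 1 * 1 * 1"
  proof -
    have "2 powr (1 - K) \<le> 2 powr 1" using K by (intro powr_mono) auto
    then show ?thesis unfolding abs_mult using K H a_bounds by (intro mult_mono) auto
  qed
  then have "\<bar>2 powr (1 - K) * H * K * (a - 1)\<bar> * \<bar>x - y\<bar> powr (a - 2) \<le> 2 * \<bar>x - y\<bar> powr (a - 2)"
    by (intro mult_right_mono) auto
  then show ?thesis unfolding singular_kernel_def by (simp add: abs_mult)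
qed

lemma smooth_kernel_homogeneous:
  assumes "c > 0" "x \<ge> 0" "y \<ge> 0"
  shows "smooth_kernel (c * x) (c * y) = c powr (a - 2) * smooth_kernel x y"
proof -
  have "(c * x) powr (2 * H) + (c * y) powr (2 * H) = c powr (2 * H) * (x powr (2 * H) + y powr (2 * H))"
    using assms by (simp add: powr_mult distrib_left)
  then have 1: "((c * x) powr (2 * H) + (c * y) powr (2 * H)) powr (K - 2) = c powr (2 * H * (K - 2)) * (x powr (2 * H) + y powr (2 * H)) powr (K - 2)"
    using assms by (simp add: powr_mult powr_powr)
  have "(c * x * (c * y)) powr (2 * H - 1) = ((c * c) * (x * y)) powr (2 * H - 1)" by (simp add: ac_simps)
  also have "\<dots> = c powr (4 * H - 2) * (x * y) powr (2 * H - 1)"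
    using assms by (simp add: powr_mult flip: powr_add)
  finally have 2: "(c * x * (c * y)) powr (2 * H - 1) = c powr (4 * H - 2) * (x * y) powr (2 * H - 1)" .
  have 3: "c powr (2 * H * (K - 2)) * c powr (4 * H - 2) = c powr (a - 2)"
    by (simp add: a_def algebra_simps flip: powr_add)
  show ?thesis unfolding smooth_kernel_def 1 2 3[symmetric] by simp
qed

lemma singular_kernel_homogeneous:
  assumes "c > 0"
  shows "singular_kernel (c * x) (c * y) = c powr (a - 2) * singular_kernel x y"
proof -
  have "\<bar>c * x - c * y\<bar> = c * \<bar>x - y\<bar>" using assms by (simp add: abs_mult flip: right_diff_distrib)
  then show ?thesis using assms by (simp add: singular_kernel_def powr_mult)
qed

lemma mixed_diff_smooth_cov:
  assumes "x0 \<ge> 1" "y0 \<ge> 1"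
  obtains x y where "x \<in> {x0 - 1<..<x0}" "y \<in> {y0 - 1<..<y0}" "2 powr (- K) * mixed_diff smooth_cov x0 y0 = smooth_kernel x y"
proof -
  define s where "s = (\<lambda>x y :: real. x powr (2 * H) + y powr (2 * H))"
  define F1 where "F1 = (\<lambda>x y. (K * s x y powr (K - 1)) * (2 * H * x powr (2 * H - 1)))"
  define F12 where "F12 = (\<lambda>x y. (K * ((K - 1) * s x y powr (K - 2) * (2 * H * y powr (2 * H - 1)))) * (2 * H * x powr (2 * H - 1)))"
  have s: "s x y > 0" if "x > 0" for x y using that by (simp add: s_def add_pos_nonneg)
  have ds: "((\<lambda>z. z powr p) has_real_derivative p * z powr (p - 1)) (at z)" if "z > 0" for p z :: real
    using that by (rule has_real_derivative_powr)
  show thesis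
  proof (rule mixed_diff_mean_value[of y0 x0 smooth_cov F1 F12])
    show "continuous_on {x0 - 1..x0} (\<lambda>x. smooth_cov x y)" if "y \<in> {y0 - 1, y0}" for y
      unfolding smooth_cov_def using assms H K by (intro continuous_on_powr' continuous_intros) auto
    show "((\<lambda>x. smooth_cov x y) has_real_derivative F1 x y) (at x)" if "x \<in> {x0 - 1<..<x0}" "y \<in> {y0 - 1, y0}" for x y
    proof -
      have x: "x > 0" using that assms by auto
      have "((\<lambda>x. s x y) has_real_derivative 2 * H * x powr (2 * H - 1) + 0) (at x)"
        unfolding s_def by (intro DERIV_add ds x DERIV_const)
      from DERIV_chain2[OF ds[OF s[OF x]] this, of K]
      have "((\<lambda>x. s x y powr K) has_real_derivative F1 x y) (at x)" by (simp add: F1_def)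
      then show ?thesis unfolding smooth_cov_def s_def .
    qed
    show "continuous_on {y0 - 1..y0} (F1 x)" if "x \<in> {x0 - 1<..<x0}" for x
    proof -
      have x: "x > 0" using that assms by auto
      have "continuous_on {y0 - 1..y0} (s x)"
        unfolding s_def using assms H by (intro continuous_on_powr' continuous_intros) auto
      then show ?thesis
        unfolding F1_def using s[OF x] by (intro continuous_on_powr' continuous_intros) (auto simp: less_imp_le less_imp_neq[symmetric] dest: less_imp_neq)
    qed
    show "(F1 x has_real_derivative F12 x y) (at y)" if "x \<in> {x0 - 1<..<x0}" "y \<in> {y0 - 1<..<y0}" for x y
    proof -
      have x: "x > 0" and y: "y > 0" using that assms by auto
      have "(s x has_real_derivative 0 + 2 * H * y powr (2 * H - 1)) (at y)"
        unfolding s_def by (intro DERIV_add ds y DERIV_const)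
      from DERIV_cmult_right[OF DERIV_cmult[OF DERIV_chain2[OF ds[OF s[OF x]] this]], of K "K - 1" "2 * H * x powr (2 * H - 1)"]
      show ?thesis unfolding F1_def F12_def by simp
    qed
    fix x y assume xy: "x \<in> {x0 - 1<..<x0}" "y \<in> {y0 - 1<..<y0}" "mixed_diff smooth_cov x0 y0 = F12 x y"
    have "x > 0" "y > 0" using xy assms by auto
    moreover have "2 powr (2 - K) = 4 * 2 powr (- K)" by (simp add: powr_diff powr_minus divide_inverse)
    ultimately have "2 powr (- K) * mixed_diff smooth_cov x0 y0 = smooth_kernel x y"
      unfolding xy(3) F12_def smooth_kernel_def s_def by (simp add: powr_mult power2_eq_square)
    with xy show thesis using that by blast
  qed
qed

lemma singular_cov_commute: "singular_cov x y = singular_cov y x"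
  by (simp add: singular_cov_def abs_minus_commute)

lemma singular_kernel_commute: "singular_kernel x y = singular_kernel y x"
  by (simp add: singular_kernel_def abs_minus_commute)

lemma mixed_diff_singular_cov_above:
  assumes "y0 + 2 \<le> x0"
  obtains x y where "x \<in> {x0 - 1<..<x0}" "y \<in> {y0 - 1<..<y0}" "2 powr (- K) * mixed_diff singular_cov x0 y0 = - singular_kernel x y"
proof -
  define F1 where "F1 = (\<lambda>x y :: real. a * (x - y) powr (a - 1))"
  define F12 where "F12 = (\<lambda>x y :: real. a * ((a - 1) * (x - y) powr (a - 2) * (- 1)))"
  have ds: "((\<lambda>z. z powr p) has_real_derivative p * z powr (p - 1)) (at z)" if "z > 0" for p z :: real
    using that by (rule has_real_derivative_powr)
  show thesis
  proof (rule mixed_diff_mean_value[of y0 x0 singular_cov F1 F12])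
    show "continuous_on {x0 - 1..x0} (\<lambda>x. singular_cov x y)" if "y \<in> {y0 - 1, y0}" for y
      unfolding singular_cov_def using assms a_bounds by (intro continuous_on_powr' continuous_intros) auto
    show "((\<lambda>x. singular_cov x y) has_real_derivative F1 x y) (at x)" if "x \<in> {x0 - 1<..<x0}" "y \<in> {y0 - 1, y0}" for x y
    proof -
      have xy: "x - y > 0" using that assms by auto
      have "((\<lambda>x. x - y) has_real_derivative 1) (at x)" by (auto intro!: derivative_eq_intros)
      from DERIV_chain2[OF ds[OF xy] this, of a]
      have *: "((\<lambda>x. (x - y) powr a) has_real_derivative F1 x y) (at x)" by (simp add: F1_def)
      show ?thesis
        by (rule has_field_derivative_transform_within[OF * xy]) (auto simp: singular_cov_def dist_real_def)
    qed
    show "continuous_on {y0 - 1..y0} (F1 x)" if "x \<in> {x0 - 1<..<x0}" for x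
      unfolding F1_def using that assms a_bounds by (intro continuous_on_powr' continuous_intros) auto
    show "(F1 x has_real_derivative F12 x y) (at y)" if "x \<in> {x0 - 1<..<x0}" "y \<in> {y0 - 1<..<y0}" for x y
    proof -
      have xy: "x - y > 0" using that assms by auto
      have "((\<lambda>y. x - y) has_real_derivative - 1) (at y)" by (auto intro!: derivative_eq_intros)
      from DERIV_cmult[OF DERIV_chain2[OF ds[OF xy] this], of a "a - 1"]
      show ?thesis unfolding F1_def F12_def by simp
    qed
    fix x y assume xy: "x \<in> {x0 - 1<..<x0}" "y \<in> {y0 - 1<..<y0}" "mixed_diff singular_cov x0 y0 = F12 x y"
    then have "x - y > 0" using assms by auto
    moreover have "2 powr (1 - K) * H * K = 2 powr (- K) * a"
      by (simp add: a_def powr_diff powr_minus divide_inverse)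
    ultimately have "2 powr (- K) * mixed_diff singular_cov x0 y0 = - singular_kernel x y"
      unfolding xy(3) F12_def singular_kernel_def by simp
    with xy show thesis using that by blast
  qed
qed

lemma mixed_diff_singular_cov:
  assumes "\<bar>x0 - y0\<bar> \<ge> 2"
  obtains x y where "x \<in> {x0 - 1<..<x0}" "y \<in> {y0 - 1<..<y0}" "2 powr (- K) * mixed_diff singular_cov x0 y0 = - singular_kernel x y"
proof (cases "y0 + 2 \<le> x0")
  case True
  then show ?thesis using mixed_diff_singular_cov_above that by blast
next
  case False
  then have "x0 + 2 \<le> y0" using assms by linarith
  then obtain y x where "y \<in> {y0 - 1<..<y0}" "x \<in> {x0 - 1<..<x0}" "2 powr (- K) * mixed_diff singular_cov y0 x0 = - singular_kernel y x"
    by (rule mixed_diff_singular_cov_above)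
  moreover have "mixed_diff singular_cov y0 x0 = mixed_diff singular_cov x0 y0"
    by (simp add: mixed_diff_def singular_cov_commute)
  ultimately show ?thesis using that singular_kernel_commute by metis
qed

abbreviation bif_cov :: "real \<Rightarrow> real \<Rightarrow> real" where "bif_cov \<equiv> bifractional_cov H K"

lemma mixed_diff_bif_cov:
  "mixed_diff bif_cov x y = 2 powr (- K) * mixed_diff smooth_cov x y - 2 powr (- K) * mixed_diff singular_cov x y"
  unfolding mixed_diff_def bifractional_cov_split by (simp add: algebra_simps)

lemma two_powr_minus_K: "0 < 2 powr (- K)" "2 powr (- K) \<le> 1"
  using K powr_mono[of "- K" 0 2] by auto

text \<open>A crude bound suffices for the O(n) pairs next to the diagonal. Of the 20, 4 come from
  the smooth part and 16 from the four values of \<open>singular_cov\<close>, each at most 2^a \<le>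
  4.\<close>

lemma mixed_diff_bif_cov_near:
  fixes i j :: nat
  assumes ij: "i \<ge> 1" "j \<ge> 1" and near: "\<bar>real i - real j\<bar> \<le> 1"
  shows "\<bar>mixed_diff bif_cov (real i) (real j)\<bar> \<le> 20"
proof -
  \<comment> \<open>The square at \<open>i = j = 1\<close> is computed directly, since its
    intermediate point might be arbitrarily close to the origin, where \<open>smooth_kernel\<close>
    is unbounded. In all other squares one coordinate of that point exceeds 1.\<close>
  have P: "\<bar>2 powr (- K) * mixed_diff smooth_cov (real i) (real j)\<bar> \<le> 4"
  proof (cases "i = 1 \<and> j = 1")
    case True
    have "2 powr K \<le> 2 powr 1" using K by (intro powr_mono) auto
    moreover have "0 < 2 powr K" by simp
    ultimately have "\<bar>mixed_diff smooth_cov 1 1\<bar> \<le> 2"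
      using H K by (simp add: mixed_diff_def smooth_cov_def abs_le_iff)
    then have "2 powr (- K) * \<bar>mixed_diff smooth_cov 1 1\<bar> \<le> 1 * 2"
      using two_powr_minus_K by (intro mult_mono) auto
    then show ?thesis using True by (simp add: abs_mult)
  next
    case False
    obtain x y where xy: "x \<in> {real i - 1<..<real i}" "y \<in> {real j - 1<..<real j}"
      "2 powr (- K) * mixed_diff smooth_cov (real i) (real j) = smooth_kernel x y"
      by (rule mixed_diff_smooth_cov[of "real i" "real j"]) (use ij in auto)
    have "real i \<ge> 2 \<or> real j \<ge> 2" using False ij by auto
    then have m: "x \<ge> 0" "y \<ge> 0" "1 \<le> max x y" using xy ij by auto
    then have "\<bar>smooth_kernel x y\<bar> \<le> 4 * max x y powr (a - 2)" by (intro smooth_kernel_bound_max) auto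
    moreover have "max x y powr (a - 2) \<le> 1"
      using m a_bounds powr_mono2'[of "a - 2" 1 "max x y"] by simp
    ultimately show ?thesis using xy by simp
  qed
  have q: "0 \<le> singular_cov x y \<and> singular_cov x y \<le> 4" if "\<bar>x - y\<bar> \<le> 2" for x y
  proof -
    have "singular_cov x y \<le> 2 powr a" unfolding singular_cov_def using that a_bounds by (intro powr_mono2) auto
    also have "\<dots> \<le> 2 powr 2" using a_bounds by (intro powr_mono) auto
    finally show ?thesis by (simp add: singular_cov_def)
  qed
  have "\<bar>mixed_diff singular_cov (real i) (real j)\<bar> \<le> 16"
    using q[of "real i" "real j"] q[of "real i - 1" "real j"] q[of "real i" "real j - 1"] q[of "real i - 1" "real j - 1"] near
    unfolding mixed_diff_def by (simp add: abs_le_iff)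
  then have "2 powr (- K) * \<bar>mixed_diff singular_cov (real i) (real j)\<bar> \<le> 1 * 16"
    using two_powr_minus_K by (intro mult_mono) auto
  then have "\<bar>2 powr (- K) * mixed_diff singular_cov (real i) (real j)\<bar> \<le> 16" by (simp add: abs_mult)
  then show ?thesis using P unfolding mixed_diff_bif_cov by linarith
qed

text \<open>The mean value theorem gives each part its own intermediate point. This is harmless:
  later estimates only use that both lie in the same unit square.\<close>

lemma mixed_diff_bif_cov_far:
  assumes "x0 \<ge> 1" "y0 \<ge> 1" "\<bar>x0 - y0\<bar> \<ge> 2"
  obtains x y x' y' where "x \<in> {x0 - 1<..<x0}" "y \<in> {y0 - 1<..<y0}" "x' \<in> {x0 - 1<..<x0}" "y' \<in> {y0 - 1<..<y0}"
    "mixed_diff bif_cov x0 y0 = smooth_kernel x y + singular_kernel x' y'"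
proof -
  obtain x y where "x \<in> {x0 - 1<..<x0}" "y \<in> {y0 - 1<..<y0}" "2 powr (- K) * mixed_diff smooth_cov x0 y0 = smooth_kernel x y"
    by (rule mixed_diff_smooth_cov[OF assms(1,2)])
  moreover obtain x' y' where "x' \<in> {x0 - 1<..<x0}" "y' \<in> {y0 - 1<..<y0}" "2 powr (- K) * mixed_diff singular_cov x0 y0 = - singular_kernel x' y'"
    by (rule mixed_diff_singular_cov[OF assms(3)])
  ultimately show ?thesis using that[of x y x' y'] by (simp add: mixed_diff_bif_cov)
qed

lemma g_kernel_bound:
  assumes "0 \<le> x" "0 \<le> y" "x \<noteq> y"
  shows "\<bar>g_kernel H K x y\<bar> \<le> 6 * \<bar>x - y\<bar> powr (a - 2)"
  using smooth_kernel_bound[OF assms] singular_kernel_bound[of x y] unfolding g_kernel_split by linarith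

text \<open>The constant is 6 + 20 at distance 1. At distance d \<ge> 2 the intermediate points are
  still at least d - 1 \<ge> d/2 apart, which costs a factor 2^(2-a) \<le> 2, so 6 + 2 (4 + 2) = 18
  is enough there.\<close>

lemma g_kernel_minus_mixed_diff_bound:
  fixes i j :: nat
  assumes ij: "i \<ge> 1" "j \<ge> 1" "i \<noteq> j"
  shows "\<bar>g_kernel H K (real i) (real j) - mixed_diff bif_cov (real i) (real j)\<bar> \<le> 26 * \<bar>real i - real j\<bar> powr (a - 2)"
proof (cases "\<bar>real i - real j\<bar> \<ge> 2")
  case False
  then have "\<bar>int i - int j\<bar> < 2" by linarith
  then have 1: "\<bar>real i - real j\<bar> = 1" using ij by linarith
  then show ?thesis
    using g_kernel_bound[of "real i" "real j"] mixed_diff_bif_cov_near[of i j] ij by simp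
next
  case True
  define d where "d = \<bar>real i - real j\<bar>"
  have d: "d \<ge> 2" using True by (simp add: d_def)
  obtain x y x' y' where xy: "x \<in> {real i - 1<..<real i}" "y \<in> {real j - 1<..<real j}"
      "x' \<in> {real i - 1<..<real i}" "y' \<in> {real j - 1<..<real j}"
      "mixed_diff bif_cov (real i) (real j) = smooth_kernel x y + singular_kernel x' y'"
    by (rule mixed_diff_bif_cov_far[of "real i" "real j"]) (use ij True in auto)
  have near: "d / 2 \<le> \<bar>x - y\<bar>" "d / 2 \<le> \<bar>x' - y'\<bar>"
    using xy True unfolding d_def by (auto simp: abs_if split: if_splits)
  have p: "z powr (a - 2) \<le> 2 * d powr (a - 2)" if "d / 2 \<le> z" for z
  proof -
    have "z powr (a - 2) \<le> (d / 2) powr (a - 2)" using that d a_bounds by (intro powr_mono2') auto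
    also have "\<dots> = 2 powr (2 - a) * d powr (a - 2)"
      using d by (simp add: powr_divide powr_diff)
    also have "\<dots> \<le> 2 powr 1 * d powr (a - 2)"
      using a_bounds by (intro mult_right_mono powr_mono) auto
    finally show ?thesis by simp
  qed
  have "\<bar>smooth_kernel x y\<bar> \<le> 4 * \<bar>x - y\<bar> powr (a - 2)"
    using xy ij near d by (intro smooth_kernel_bound) auto
  moreover have "\<bar>singular_kernel x' y'\<bar> \<le> 2 * \<bar>x' - y'\<bar> powr (a - 2)" by (rule singular_kernel_bound)
  moreover have "\<bar>g_kernel H K (real i) (real j)\<bar> \<le> 6 * d powr (a - 2)"
    using g_kernel_bound[of "real i" "real j"] ij by (simp add: d_def)
  moreover have "0 \<le> d powr (a - 2)" by simp
  ultimately show ?thesis using p[OF near(1)] p[OF near(2)] xy(5) unfolding d_def[symmetric] by linarith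
qed

text \<open>Dividing by n moves \<open>(i, j)\<close> and the intermediate points into a compact set
  on which both kernels are uniformly continuous, within 2/n of each other. Homogeneity of degree a
  - 2 restores the factor n^(a-2).\<close>

lemma g_kernel_minus_mixed_diff_far:
  fixes T \<delta> \<epsilon> :: real
  assumes T: "T \<ge> 0" and \<delta>: "\<delta> > 0" and \<epsilon>: "\<epsilon> > 0"
  shows "\<forall>\<^sub>F n in sequentially. \<forall>i j :: nat. 1 \<le> i \<longrightarrow> 1 \<le> j \<longrightarrow>
    real i \<le> real n * T \<longrightarrow> real j \<le> real n * T \<longrightarrow> \<delta> * real n < \<bar>real i - real j\<bar> \<longrightarrow>
    \<bar>g_kernel H K (real i) (real j) - mixed_diff bif_cov (real i) (real j)\<bar> \<le> \<epsilon> * real n powr (a - 2)"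
proof -
  \<comment> \<open>The margin \<delta>/2 instead of \<delta> leaves room for the intermediate
    points. Staying off the diagonal also excludes the origin, so both kernels are continuous on
    \<open>S\<close>, including its points on the axes.\<close>
  define S where "S = {0..T} \<times> {0..T} \<inter> {p :: real \<times> real. \<delta> / 2 \<le> \<bar>fst p - snd p\<bar>}"
  have "compact S" unfolding S_def
    by (intro compact_Int_closed compact_Times compact_Icc closed_Collect_le continuous_intros)
  have c1: "continuous_on S (\<lambda>p. smooth_kernel (fst p) (snd p))"
    unfolding smooth_kernel_def
  proof (intro continuous_on_mult continuous_on_const)
    have "continuous_on S (\<lambda>p. fst p powr (2 * H) + snd p powr (2 * H))"
      by (intro continuous_on_add continuous_on_powr' continuous_intros) (use H in \<open>auto simp: S_def\<close>)
    moreover have pos: "fst p powr (2 * H) + snd p powr (2 * H) > 0" if "p \<in> S" for p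
    proof -
      have "fst p > 0 \<or> snd p > 0" using that \<delta> by (auto simp: S_def)
      then show ?thesis by (auto intro: add_pos_nonneg add_nonneg_pos)
    qed
    ultimately show "continuous_on S (\<lambda>p. (fst p powr (2 * H) + snd p powr (2 * H)) powr (K - 2))"
    proof (intro continuous_on_powr' continuous_on_const ballI)
      fix p assume "p \<in> S"
      from pos[OF this] show "0 \<le> fst p powr (2 * H) + snd p powr (2 * H) \<and>
          (fst p powr (2 * H) + snd p powr (2 * H) = 0 \<longrightarrow> 0 < K - 2)" by linarith
    qed
    show "continuous_on S (\<lambda>p. (fst p * snd p) powr (2 * H - 1))"
      by (intro continuous_on_powr' continuous_intros) (use H_gt in \<open>auto simp: S_def\<close>)
  qed
  have c2: "continuous_on S (\<lambda>p. singular_kernel (fst p) (snd p))"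
    unfolding singular_kernel_def
    by (intro continuous_intros continuous_on_powr' ballI) (use \<delta> in \<open>auto simp: S_def\<close>)
  obtain e1 where e1: "e1 > 0" "\<And>p q. p \<in> S \<Longrightarrow> q \<in> S \<Longrightarrow> dist p q < e1 \<Longrightarrow> dist (smooth_kernel (fst p) (snd p)) (smooth_kernel (fst q) (snd q)) < \<epsilon> / 2"
    using compact_uniformly_continuous[OF c1 \<open>compact S\<close>] \<epsilon> unfolding uniformly_continuous_on_def
    by (metis half_gt_zero)
  obtain e2 where e2: "e2 > 0" "\<And>p q. p \<in> S \<Longrightarrow> q \<in> S \<Longrightarrow> dist p q < e2 \<Longrightarrow> dist (singular_kernel (fst p) (snd p)) (singular_kernel (fst q) (snd q)) < \<epsilon> / 2"
    using compact_uniformly_continuous[OF c2 \<open>compact S\<close>] \<epsilon> unfolding uniformly_continuous_on_def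
    by (metis half_gt_zero)
  \<comment> \<open>The first condition lets a shift by less than one unit fit into the margin of
    \<open>S\<close>; the other two bring 2/n below the moduli \<open>e1\<close> and
    \<open>e2\<close>.\<close>
  have "\<forall>\<^sub>F n in sequentially. 2 / \<delta> < real n \<and> 2 / e1 < real n \<and> 2 / e2 < real n"
    by (intro eventually_conj eventually_compose_filterlim[OF eventually_gt_at_top filterlim_real_sequentially])
  then show ?thesis
  proof eventually_elim
    case (elim n)
    have n: "real n > 0" using elim \<delta> by (metis divide_pos_pos less_trans zero_less_numeral)
    have n2: "2 < \<delta> * real n" "2 / real n < e1" "2 / real n < e2"
      using elim \<delta> e1 e2 n by (auto simp: field_simps)
    show ?case
    proof (intro allI impI)
      fix i j :: nat
      assume ij: "1 \<le> i" "1 \<le> j" "real i \<le> real n * T" "real j \<le> real n * T" "\<delta> * real n < \<bar>real i - real j\<bar>"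
      obtain x y x' y' where xy: "x \<in> {real i - 1<..<real i}" "y \<in> {real j - 1<..<real j}"
          "x' \<in> {real i - 1<..<real i}" "y' \<in> {real j - 1<..<real j}"
          "mixed_diff bif_cov (real i) (real j) = smooth_kernel x y + singular_kernel x' y'"
        by (rule mixed_diff_bif_cov_far[of "real i" "real j"]) (use ij n2 in auto)
      have in_S: "(u / n, v / n) \<in> S" if "u \<in> {real i - 1..real i}" "v \<in> {real j - 1..real j}" for u v
      proof -
        have "\<delta> / 2 * real n \<le> \<bar>u - v\<bar>" using that ij n2 by (auto simp: abs_if split: if_splits)
        moreover have "\<bar>u / n - v / n\<bar> = \<bar>u - v\<bar> / n" using n by (simp add: abs_divide flip: diff_divide_distrib)
        ultimately show ?thesis
          using that ij n unfolding S_def by (auto simp: pos_le_divide_eq pos_divide_le_eq mult.commute)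
      qed
      have close: "dist (real i / n, real j / n) (u / n, v / n) < 2 / n"
        if "u \<in> {real i - 1<..<real i}" "v \<in> {real j - 1<..<real j}" for u v
      proof -
        have "dist (real i / n, real j / n) (u / n, v / n) \<le> \<bar>real i / n - u / n\<bar> + \<bar>real j / n - v / n\<bar>"
          unfolding dist_Pair_Pair dist_real_def by (rule order_trans[OF sqrt_sum_squares_le_sum_abs]) simp
        also have "\<dots> = (\<bar>real i - u\<bar> + \<bar>real j - v\<bar>) / n"
          using n by (simp add: abs_divide add_divide_distrib flip: diff_divide_distrib)
        also have "\<dots> < 2 / n" using that n by (intro divide_strict_right_mono) auto
        finally show ?thesis .
      qed
      have "\<bar>smooth_kernel (i / n) (j / n) - smooth_kernel (x / n) (y / n)\<bar> < \<epsilon> / 2"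
        using e1(2)[OF in_S[of "real i" "real j"] in_S[of x y]] close[OF xy(1,2)] n2 xy by (auto simp: dist_real_def)
      moreover have "\<bar>singular_kernel (i / n) (j / n) - singular_kernel (x' / n) (y' / n)\<bar> < \<epsilon> / 2"
        using e2(2)[OF in_S[of "real i" "real j"] in_S[of x' y']] close[OF xy(3,4)] n2 xy by (auto simp: dist_real_def)
      ultimately have "\<bar>(smooth_kernel (i / n) (j / n) + singular_kernel (i / n) (j / n)) - (smooth_kernel (x / n) (y / n) + singular_kernel (x' / n) (y' / n))\<bar> \<le> \<epsilon>"
        by linarith
      then have L: "real n powr (a - 2) * \<bar>(smooth_kernel (i / n) (j / n) + singular_kernel (i / n) (j / n)) - (smooth_kernel (x / n) (y / n) + singular_kernel (x' / n) (y' / n))\<bar> \<le> real n powr (a - 2) * \<epsilon>"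
        by (rule mult_left_mono) simp
      have sc1: "smooth_kernel u v = real n powr (a - 2) * smooth_kernel (u / n) (v / n)" if "u \<ge> 0" "v \<ge> 0" for u v
        using smooth_kernel_homogeneous[of "real n" "u / n" "v / n"] n that by simp
      have sc2: "singular_kernel u v = real n powr (a - 2) * singular_kernel (u / n) (v / n)" for u v
        using singular_kernel_homogeneous[of "real n" "u / n" "v / n"] n by simp
      have "g_kernel H K i j - mixed_diff bif_cov i j =
          real n powr (a - 2) * ((smooth_kernel (i / n) (j / n) + singular_kernel (i / n) (j / n)) - (smooth_kernel (x / n) (y / n) + singular_kernel (x' / n) (y' / n)))"
      proof -
        have "x \<ge> 0" "y \<ge> 0" using xy ij by auto
        then show ?thesis
          unfolding g_kernel_split xy(5) using sc1[of i j] sc1[of x y] sc2[of i j] sc2[of x' y']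
          by (simp add: algebra_simps)
      qed
      with L show "\<bar>g_kernel H K (real i) (real j) - mixed_diff bif_cov (real i) (real j)\<bar> \<le> \<epsilon> * real n powr (a - 2)"
        by (simp add: abs_mult mult.commute)
    qed
  qed
qed

lemma floor_ratio_tendsto:
  fixes s :: real
  assumes "s \<ge> 0"
  shows "(\<lambda>n. real (nat \<lfloor>real n * s\<rfloor>) / real n) \<longlonglongrightarrow> s"
proof (rule real_tendsto_sandwich)
  show "(\<lambda>n. s - 1 / real n) \<longlonglongrightarrow> s"
    using tendsto_diff[OF tendsto_const[of s] lim_1_over_n] by simp
  show "(\<lambda>n. s) \<longlonglongrightarrow> s" by simp
  show "\<forall>\<^sub>F n in sequentially. s - 1 / real n \<le> real (nat \<lfloor>real n * s\<rfloor>) / real n"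
    using eventually_gt_at_top[of 0]
  proof eventually_elim
    case (elim n)
    have "real n * s - 1 \<le> real (nat \<lfloor>real n * s\<rfloor>)" using assms by linarith
    then have "(real n * s - 1) / real n \<le> real (nat \<lfloor>real n * s\<rfloor>) / real n" by (intro divide_right_mono) auto
    then show ?case using elim by (simp add: diff_divide_distrib)
  qed
  show "\<forall>\<^sub>F n in sequentially. real (nat \<lfloor>real n * s\<rfloor>) / real n \<le> s"
    using eventually_gt_at_top[of 0]
  proof eventually_elim
    case (elim n)
    have "real (nat \<lfloor>real n * s\<rfloor>) \<le> real n * s" using assms by simp
    then show ?case using elim by (simp add: pos_divide_le_eq mult.commute)
  qed
qed

text \<open>Self-similarity: the covariance is homogeneous of degree a = 2HK, so the scaled value is
  the covariance at the ratios [ns]/n and [nt]/n, and continuity finishes.\<close>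

lemma bif_cov_scaled_tendsto:
  assumes st: "s \<ge> 0" "t \<ge> 0"
  shows "(\<lambda>n. real n powr (- a) * bif_cov (real (nat \<lfloor>real n * s\<rfloor>)) (real (nat \<lfloor>real n * t\<rfloor>))) \<longlonglongrightarrow> bif_cov s t"
proof -
  let ?s = "\<lambda>n. real (nat \<lfloor>real n * s\<rfloor>) / real n" and ?t = "\<lambda>n. real (nat \<lfloor>real n * t\<rfloor>) / real n"
  have lim: "?s \<longlonglongrightarrow> s" "?t \<longlonglongrightarrow> t" by (rule floor_ratio_tendsto[OF st(1)], rule floor_ratio_tendsto[OF st(2)])
  have "(\<lambda>n. bif_cov (?s n) (?t n)) \<longlonglongrightarrow> bif_cov s t"
    unfolding bifractional_cov_split smooth_cov_def singular_cov_def
    by (intro tendsto_intros tendsto_powr' lim) (use H K a_bounds st in \<open>auto\<close>)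
  moreover have "\<forall>\<^sub>F n in sequentially. bif_cov (?s n) (?t n) = real n powr (- a) * bif_cov (real (nat \<lfloor>real n * s\<rfloor>)) (real (nat \<lfloor>real n * t\<rfloor>))"
    using eventually_gt_at_top[of 0]
  proof eventually_elim
    case (elim n)
    have P: "smooth_cov (x / n) (y / n) = real n powr (- a) * smooth_cov x y" if "x \<ge> 0" "y \<ge> 0" for x y
    proof -
      have "(x / n) powr (2 * H) + (y / n) powr (2 * H) = (x powr (2 * H) + y powr (2 * H)) / real n powr (2 * H)"
        using that elim by (simp add: powr_divide add_divide_distrib)
      then have "smooth_cov (x / n) (y / n) = (x powr (2 * H) + y powr (2 * H)) powr K / (real n powr (2 * H)) powr K"
        unfolding smooth_cov_def by (simp add: powr_divide)
      also have "(real n powr (2 * H)) powr K = real n powr a" by (simp add: powr_powr a_def)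
      finally show ?thesis by (simp add: smooth_cov_def powr_minus divide_inverse mult.commute)
    qed
    have Q: "singular_cov (x / n) (y / n) = real n powr (- a) * singular_cov x y" for x y
    proof -
      have "\<bar>x / n - y / n\<bar> = \<bar>x - y\<bar> / n" by (simp add: abs_divide flip: diff_divide_distrib)
      then have "singular_cov (x / n) (y / n) = \<bar>x - y\<bar> powr a / real n powr a" by (simp add: singular_cov_def powr_divide)
      then show ?thesis by (simp add: singular_cov_def powr_minus divide_inverse mult.commute)
    qed
    show ?case unfolding bifractional_cov_split by (simp add: P Q algebra_simps)
  qed
  ultimately show ?thesis by (rule Lim_transform_eventually)
qed

text \<open>The process starts at 0; this removes the boundary terms left by
  \<open>sum_mixed_diff\<close>.\<close>

lemma bif_cov_zero:
  assumes "s \<ge> 0"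
  shows "bif_cov 0 s = 0" "bif_cov s 0 = 0"
proof -
  show "bif_cov 0 s = 0" "bif_cov s 0 = 0"
    using assms unfolding bifractional_cov_split smooth_cov_def singular_cov_def by (simp_all add: powr_powr a_def[symmetric])
qed

text \<open>The sum of the second differences \<open>m\<close> is exactly the covariance at the two
  upper limits. The error is summed in absolute value, which allows the rectangle to be enlarged to
  a square of side \<open>T = max s t\<close>, the shape treated by
  \<open>offdiag_sum_tendsto_0\<close>.\<close>

lemma kernel_sum_tendsto:
  assumes st: "s \<ge> 0" "t \<ge> 0"
  shows "(\<lambda>n. real n powr (- a) * (\<Sum>i=1..nat \<lfloor>real n * s\<rfloor>. \<Sum>j=1..nat \<lfloor>real n * t\<rfloor>.
    if i = j then 1 else g_kernel H K (real i) (real j))) \<longlonglongrightarrow> bif_cov s t"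
proof -
  define c :: "nat \<Rightarrow> nat \<Rightarrow> real" where "c = (\<lambda>i j. if i = j then 1 else g_kernel H K (real i) (real j))"
  define m :: "nat \<Rightarrow> nat \<Rightarrow> real" where "m = (\<lambda>i j. mixed_diff bif_cov (real i) (real j))"
  define T where "T = max s t"
  let ?N = "\<lambda>t n. nat \<lfloor>real n * t\<rfloor>"
  have T: "T \<ge> 0" "s \<le> T" "t \<le> T" using st by (auto simp: T_def)
  have off: "(\<lambda>n. real n powr (- a) * (\<Sum>i=1..?N T n. \<Sum>j=1..?N T n. if i = j then 0 else \<bar>g_kernel H K i j - m i j\<bar>)) \<longlonglongrightarrow> 0"
    unfolding m_def
    by (rule offdiag_sum_tendsto_0[OF a_bounds _ T(1) g_kernel_minus_mixed_diff_bound g_kernel_minus_mixed_diff_far[OF T(1)]]) auto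
  \<comment> \<open>Each of the at most n T diagonal entries is off by at most 1 + 20; the total is
    of order n, hence negligible against n^a.\<close>
  have diag: "(\<lambda>n. 21 * T * real n powr (1 - a)) \<longlonglongrightarrow> 0"
    using tendsto_mult_left[OF powr_tendsto_0[of "1 - a"], of "21 * T"] a_bounds by simp
  have "(\<lambda>n. real n powr (- a) * (\<Sum>i=1..?N s n. \<Sum>j=1..?N t n. c i j) - real n powr (- a) * bif_cov (?N s n) (?N t n)) \<longlonglongrightarrow> 0"
  proof (rule Lim_null_comparison)
    show "(\<lambda>n. real n powr (- a) * (\<Sum>i=1..?N T n. \<Sum>j=1..?N T n. if i = j then 0 else \<bar>g_kernel H K i j - m i j\<bar>)
        + 21 * T * real n powr (1 - a)) \<longlonglongrightarrow> 0"
      using tendsto_add[OF off diag] by simp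
    show "\<forall>\<^sub>F n in sequentially. norm (real n powr (- a) * (\<Sum>i=1..?N s n. \<Sum>j=1..?N t n. c i j) - real n powr (- a) * bif_cov (?N s n) (?N t n))
      \<le> real n powr (- a) * (\<Sum>i=1..?N T n. \<Sum>j=1..?N T n. if i = j then 0 else \<bar>g_kernel H K i j - m i j\<bar>)
        + 21 * T * real n powr (1 - a)"
      using eventually_gt_at_top[of 0]
    proof eventually_elim
      case (elim n)
      have N: "?N s n \<le> ?N T n" "?N t n \<le> ?N T n"
        using T by (auto intro!: nat_mono floor_mono mult_left_mono)
      have "(\<Sum>i=1..?N s n. \<Sum>j=1..?N t n. m i j) = bif_cov (?N s n) (?N t n)"
        unfolding m_def sum_mixed_diff by (simp add: bif_cov_zero)
      then have "norm (real n powr (- a) * (\<Sum>i=1..?N s n. \<Sum>j=1..?N t n. c i j) - real n powr (- a) * bif_cov (?N s n) (?N t n)) =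
          real n powr (- a) * \<bar>\<Sum>i=1..?N s n. \<Sum>j=1..?N t n. c i j - m i j\<bar>"
        by (simp add: sum_subtractf abs_mult flip: right_diff_distrib)
      also have "\<bar>\<Sum>i=1..?N s n. \<Sum>j=1..?N t n. c i j - m i j\<bar> \<le> (\<Sum>i=1..?N s n. \<Sum>j=1..?N t n. \<bar>c i j - m i j\<bar>)"
        by (rule order_trans[OF sum_abs], rule sum_mono, rule sum_abs)
      also have "\<dots> \<le> (\<Sum>i=1..?N s n. \<Sum>j=1..?N T n. \<bar>c i j - m i j\<bar>)"
        using N by (intro sum_mono sum_mono2) auto
      also have "\<dots> \<le> (\<Sum>i=1..?N T n. \<Sum>j=1..?N T n. \<bar>c i j - m i j\<bar>)"
        using N by (intro sum_mono2 sum_nonneg) auto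
      also have "\<dots> \<le> (\<Sum>i=1..?N T n. (\<Sum>j=1..?N T n. if i = j then 0 else \<bar>g_kernel H K i j - m i j\<bar>) + 21)"
      proof (rule sum_mono)
        fix i assume i: "i \<in> {1..?N T n}"
        have "\<bar>c i j - m i j\<bar> = (if i = j then 0 else \<bar>g_kernel H K i j - m i j\<bar>) + (if i = j then \<bar>1 - m i i\<bar> else 0)" for j
          by (simp add: c_def)
        then have "(\<Sum>j=1..?N T n. \<bar>c i j - m i j\<bar>) = (\<Sum>j=1..?N T n. if i = j then 0 else \<bar>g_kernel H K i j - m i j\<bar>) + \<bar>1 - m i i\<bar>"
          using i by (simp add: sum.distrib)
        moreover have "\<bar>m i i\<bar> \<le> 20" unfolding m_def using i by (intro mixed_diff_bif_cov_near) auto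
        ultimately show "(\<Sum>j=1..?N T n. \<bar>c i j - m i j\<bar>) \<le> (\<Sum>j=1..?N T n. if i = j then 0 else \<bar>g_kernel H K i j - m i j\<bar>) + 21"
          by linarith
      qed
      also have "\<dots> \<le> (\<Sum>i=1..?N T n. \<Sum>j=1..?N T n. if i = j then 0 else \<bar>g_kernel H K i j - m i j\<bar>) + 21 * (real n * T)"
        using T by (simp add: sum.distrib)
      finally have "norm (real n powr (- a) * (\<Sum>i=1..?N s n. \<Sum>j=1..?N t n. c i j) - real n powr (- a) * bif_cov (?N s n) (?N t n)) \<le>
        real n powr (- a) * ((\<Sum>i=1..?N T n. \<Sum>j=1..?N T n. if i = j then 0 else \<bar>g_kernel H K i j - m i j\<bar>) + 21 * (real n * T))"
        by (simp add: mult_left_mono)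
      also have "\<dots> = real n powr (- a) * (\<Sum>i=1..?N T n. \<Sum>j=1..?N T n. if i = j then 0 else \<bar>g_kernel H K i j - m i j\<bar>)
        + 21 * T * (real n powr (- a) * real n)" by (simp add: algebra_simps)
      also have "real n powr (- a) * real n = real n powr (1 - a)"
        using elim by (simp add: powr_diff powr_minus divide_inverse)
      finally show ?case .
    qed
  qed
  from tendsto_add[OF this bif_cov_scaled_tendsto[OF st]] show ?thesis
    by (simp add: c_def)
qed

end

text \<open>At distances of at least 1 squaring only decreases |i - j|^(a-2), so the band estimate
  carries over; far from the diagonal the square gains a further factor n^(a-2), which tends to 0.
  This covers all exponents without asking whether the squares are summable along a row.\<close>

lemma offdiag_square_sum_tendsto_0:
  fixes a T :: real
  assumes a: "1 < a" "a < 2" and T: "T \<ge> 0"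
  shows "(\<lambda>n. real n powr (- a) * (\<Sum>i=1..nat \<lfloor>real n * T\<rfloor>. \<Sum>j=1..nat \<lfloor>real n * T\<rfloor>.
    if i = j then 0 else \<bar>(\<bar>real i - real j\<bar> powr (a - 2))\<^sup>2\<bar>)) \<longlonglongrightarrow> 0"
proof (rule offdiag_sum_tendsto_0[OF a _ T, of 1])
  fix i j :: nat assume "i \<noteq> j"
  then have "1 \<le> \<bar>int i - int j\<bar>" by linarith
  then have "1 \<le> \<bar>real i - real j\<bar>" by linarith
  then have "\<bar>real i - real j\<bar> powr (a - 2) \<le> 1"
    using a powr_mono2'[of "a - 2" 1 "\<bar>real i - real j\<bar>"] by simp
  then have "\<bar>real i - real j\<bar> powr (a - 2) * \<bar>real i - real j\<bar> powr (a - 2) \<le> 1 * \<bar>real i - real j\<bar> powr (a - 2)"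
    by (intro mult_right_mono) auto
  then show "\<bar>(\<bar>real i - real j\<bar> powr (a - 2))\<^sup>2\<bar> \<le> 1 * \<bar>real i - real j\<bar> powr (a - 2)"
    by (simp add: power2_eq_square)
next
  fix \<delta> \<epsilon> :: real assume \<delta>: "\<delta> > 0" and \<epsilon>: "\<epsilon> > 0"
  have "(\<lambda>n. (\<delta> powr (a - 2))\<^sup>2 * real n powr (a - 2)) \<longlonglongrightarrow> (\<delta> powr (a - 2))\<^sup>2 * 0"
    using a by (intro tendsto_mult_left powr_tendsto_0) simp
  then have "\<forall>\<^sub>F n in sequentially. (\<delta> powr (a - 2))\<^sup>2 * real n powr (a - 2) < \<epsilon>"
    using \<epsilon> by (intro order_tendstoD(2)[of _ 0]) auto
  with eventually_gt_at_top[of 0]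
  show "\<forall>\<^sub>F n in sequentially. \<forall>i j :: nat. 1 \<le> i \<longrightarrow> 1 \<le> j \<longrightarrow> real i \<le> real n * T \<longrightarrow> real j \<le> real n * T \<longrightarrow>
    \<delta> * real n < \<bar>real i - real j\<bar> \<longrightarrow> \<bar>(\<bar>real i - real j\<bar> powr (a - 2))\<^sup>2\<bar> \<le> \<epsilon> * real n powr (a - 2)"
  proof eventually_elim
    case (elim n)
    show ?case
    proof (intro allI impI)
      fix i j :: nat assume ij: "\<delta> * real n < \<bar>real i - real j\<bar>"
      have "\<bar>real i - real j\<bar> powr (a - 2) \<le> (\<delta> * real n) powr (a - 2)"
        using ij \<delta> elim a by (intro powr_mono2') auto
      then have "(\<bar>real i - real j\<bar> powr (a - 2))\<^sup>2 \<le> ((\<delta> * real n) powr (a - 2))\<^sup>2"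
        by (intro power_mono) auto
      also have "\<dots> = ((\<delta> powr (a - 2))\<^sup>2 * real n powr (a - 2)) * real n powr (a - 2)"
        using \<delta> by (simp add: powr_mult power2_eq_square)
      also have "\<dots> \<le> \<epsilon> * real n powr (a - 2)"
        using elim by (intro mult_right_mono) auto
      finally show "\<bar>(\<bar>real i - real j\<bar> powr (a - 2))\<^sup>2\<bar> \<le> \<epsilon> * real n powr (a - 2)" by simp
    qed
  qed
qed simp

section \<open>The limit theorem\<close>

lemma integral_product_of_sums:
  fixes U :: "'i \<Rightarrow> 'a \<Rightarrow> real" and V :: "'j \<Rightarrow> 'a \<Rightarrow> real"
  assumes U: "\<And>i. i \<in> I \<Longrightarrow> U i \<in> borel_measurable M" "\<And>i. i \<in> I \<Longrightarrow> integrable M (\<lambda>\<omega>. (U i \<omega>)\<^sup>2)"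
    and V: "\<And>j. j \<in> J \<Longrightarrow> V j \<in> borel_measurable M" "\<And>j. j \<in> J \<Longrightarrow> integrable M (\<lambda>\<omega>. (V j \<omega>)\<^sup>2)"
  shows "integrable M (\<lambda>\<omega>. (\<Sum>i\<in>I. b i * U i \<omega>) * (\<Sum>j\<in>J. d j * V j \<omega>))" (is ?int)
    and "(\<integral>\<omega>. (\<Sum>i\<in>I. b i * U i \<omega>) * (\<Sum>j\<in>J. d j * V j \<omega>) \<partial>M) =
      (\<Sum>i\<in>I. \<Sum>j\<in>J. b i * d j * (\<integral>\<omega>. U i \<omega> * V j \<omega> \<partial>M))" (is ?eq)
proof -
  have int: "integrable M (\<lambda>\<omega>. U i \<omega> * V j \<omega>)" if "i \<in> I" "j \<in> J" for i j
    using that U V by (intro integrable_mult_of_squares) auto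
  have e: "(\<Sum>i\<in>I. b i * U i \<omega>) * (\<Sum>j\<in>J. d j * V j \<omega>) = (\<Sum>i\<in>I. \<Sum>j\<in>J. (b i * d j) * (U i \<omega> * V j \<omega>))" for \<omega>
    unfolding sum_product by (simp add: ac_simps)
  show ?int unfolding e using int by (intro Bochner_Integration.integrable_sum integrable_mult_right)
  show ?eq unfolding e using int
    by (simp add: Bochner_Integration.integral_sum Bochner_Integration.integrable_sum integrable_mult_right cong: sum.cong)
qed

lemma (in prob_space) expectation_abs_le_sqrt:
  fixes U :: "'a \<Rightarrow> real"
  assumes [measurable]: "U \<in> borel_measurable M" and int: "integrable M (\<lambda>\<omega>. (U \<omega>)\<^sup>2)"
  shows "expectation (\<lambda>\<omega>. \<bar>U \<omega>\<bar>) \<le> sqrt (expectation (\<lambda>\<omega>. (U \<omega>)\<^sup>2))"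
proof -
  have "integrable M U" by (rule square_integrable_imp_integrable[OF _ int]) simp
  then have "integrable M (\<lambda>\<omega>. \<bar>U \<omega>\<bar>)" by simp
  from variance_eq[OF this] int variance_positive[of "\<lambda>\<omega>. \<bar>U \<omega>\<bar>"]
  have "(expectation (\<lambda>\<omega>. \<bar>U \<omega>\<bar>))\<^sup>2 \<le> expectation (\<lambda>\<omega>. (U \<omega>)\<^sup>2)" by simp
  then show ?thesis by (rule real_le_rsqrt)
qed

lemma cmod_iexp_add_minus_le: "cmod (iexp (x + y) - iexp x) \<le> \<bar>y\<bar>"
proof -
  have "iexp (x + y) - iexp x = iexp x * (iexp y - 1)" by (simp add: distrib_left exp_add right_diff_distrib)
  then have "cmod (iexp (x + y) - iexp x) = cmod (iexp y - 1)" by (simp add: norm_mult)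
  also have "\<dots> \<le> \<bar>y\<bar>" using iexp_approx1[of y 0] by simp
  finally show ?thesis .
qed

text \<open>The characteristic function of a centered Gaussian combination depends only on its
  variance, a quadratic form in the covariances, so \<open>cov\<close> gives its convergence. Adding
  \<open>W\<close> changes it by at most the expected absolute value of the combination of the
  \<open>W n t\<close>, which is controlled by second moments.\<close>

lemma fdd_converges_gaussian_perturbation:
  fixes G W :: "nat \<Rightarrow> real \<Rightarrow> 'a \<Rightarrow> real" and B :: "real \<Rightarrow> 'b \<Rightarrow> real" and c :: real
  assumes M: "prob_space M" and N: "prob_space N"
    and G: "\<And>n J b. finite J \<Longrightarrow> J \<subseteq> T \<Longrightarrow> gaussian_rv M (\<lambda>\<omega>. \<Sum>t\<in>J. b t * G n t \<omega>)"
    and G0: "\<And>n t. t \<in> T \<Longrightarrow> (\<integral>\<omega>. G n t \<omega> \<partial>M) = 0"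
    and W [measurable]: "\<And>n t. t \<in> T \<Longrightarrow> W n t \<in> borel_measurable M"
    and W2: "\<And>n t. t \<in> T \<Longrightarrow> integrable M (\<lambda>\<omega>. (W n t \<omega>)\<^sup>2)"
    and W0: "\<And>t. t \<in> T \<Longrightarrow> (\<lambda>n. \<integral>\<omega>. (W n t \<omega>)\<^sup>2 \<partial>M) \<longlonglongrightarrow> 0"
    and B: "gaussian_process N T B" and B0: "\<And>t. t \<in> T \<Longrightarrow> (\<integral>\<omega>. B t \<omega> \<partial>N) = 0"
    and cov: "\<And>s t. s \<in> T \<Longrightarrow> t \<in> T \<Longrightarrow> (\<lambda>n. \<integral>\<omega>. G n s \<omega> * G n t \<omega> \<partial>M) \<longlonglongrightarrow> (\<integral>\<omega>. B s \<omega> * B t \<omega> \<partial>N)"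
  shows "fdd_converges T M (\<lambda>n t \<omega>. c * G n t \<omega> + W n t \<omega>) N (\<lambda>t \<omega>. c * B t \<omega>)"
  unfolding fdd_converges_def
proof (intro allI impI, elim conjE)
  fix J assume J: "finite J" "J \<subseteq> T"
  interpret M: prob_space M by fact
  interpret N: prob_space N by fact
  have B_lin: "gaussian_rv N (\<lambda>\<omega>. \<Sum>t\<in>I. b t * B t \<omega>)" if "finite I" "I \<subseteq> T" for I b
    using B that unfolding gaussian_process_def by auto
  have G1: "gaussian_rv M (G n t)" if "t \<in> T" for n t
    using G[of "{t}" "\<lambda>_. 1" n] that by simp
  have B1: "gaussian_rv N (B t)" if "t \<in> T" for t
    using B_lin[of "{t}" "\<lambda>_. 1"] that by simp
  have Gm [measurable]: "G n t \<in> borel_measurable M" if "t \<in> T" for n t using G1[OF that] by (simp add: gaussian_rv_def)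
  have Bm [measurable]: "B t \<in> borel_measurable N" if "t \<in> T" for t using B1[OF that] by (simp add: gaussian_rv_def)
  have G2: "integrable M (\<lambda>\<omega>. (G n t \<omega>)\<^sup>2)" if "t \<in> T" for n t
    by (rule gaussian_rv_square_integrable[OF M G1[OF that] G0[OF that]])
  have B2: "integrable N (\<lambda>\<omega>. (B t \<omega>)\<^sup>2)" if "t \<in> T" for t
    by (rule gaussian_rv_square_integrable[OF N B1[OF that] B0[OF that]])
  have GI: "integrable M (G n t)" if "t \<in> T" for n t
    by (rule M.square_integrable_imp_integrable[OF Gm[OF that] G2[OF that]])
  have BI: "integrable N (B t)" if "t \<in> T" for t
    by (rule N.square_integrable_imp_integrable[OF Bm[OF that] B2[OF that]])
  have WI: "integrable M (W n t)" if "t \<in> T" for n t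
    by (rule M.square_integrable_imp_integrable[OF W[OF that] W2[OF that]])
  have X2: "integrable M (\<lambda>\<omega>. (c * G n t \<omega> + W n t \<omega>)\<^sup>2) \<and>
      (\<integral>\<omega>. (c * G n t \<omega> + W n t \<omega>)\<^sup>2 \<partial>M) \<le> 2 * c\<^sup>2 * (\<integral>\<omega>. G n t \<omega> * G n t \<omega> \<partial>M) + 2 * (\<integral>\<omega>. (W n t \<omega>)\<^sup>2 \<partial>M)"
    if t: "t \<in> T" for n t
  proof -
    note [measurable] = Gm[OF t] W[OF t]
    have le: "(c * x + y)\<^sup>2 \<le> 2 * c\<^sup>2 * x\<^sup>2 + 2 * y\<^sup>2" for x y :: real
    proof -
      have "0 \<le> (c * x - y)\<^sup>2" by simp
      then show ?thesis by (simp add: power2_eq_square algebra_simps)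
    qed
    have b: "integrable M (\<lambda>\<omega>. 2 * c\<^sup>2 * (G n t \<omega>)\<^sup>2 + 2 * (W n t \<omega>)\<^sup>2)"
      using G2[OF t] W2[OF t] by auto
    have i: "integrable M (\<lambda>\<omega>. (c * G n t \<omega> + W n t \<omega>)\<^sup>2)"
      by (rule Bochner_Integration.integrable_bound[OF b]) (use le in \<open>auto intro: order_trans[OF _ abs_ge_self]\<close>)
    have "(\<integral>\<omega>. (c * G n t \<omega> + W n t \<omega>)\<^sup>2 \<partial>M) \<le> (\<integral>\<omega>. 2 * c\<^sup>2 * (G n t \<omega>)\<^sup>2 + 2 * (W n t \<omega>)\<^sup>2 \<partial>M)"
      by (rule integral_mono[OF i b le])
    also have "\<dots> = 2 * c\<^sup>2 * (\<integral>\<omega>. (G n t \<omega>)\<^sup>2 \<partial>M) + 2 * (\<integral>\<omega>. (W n t \<omega>)\<^sup>2 \<partial>M)"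
      using G2[OF t] W2[OF t] by simp
    finally show ?thesis using i by (simp add: power2_eq_square[of "G n t _"])
  qed
  show "weak_conv_on (product_topology (\<lambda>_. euclideanreal) J)
      (\<lambda>n. fin_dim_distr M (\<lambda>t \<omega>. c * G n t \<omega> + W n t \<omega>) J) (fin_dim_distr N (\<lambda>t \<omega>. c * B t \<omega>) J)"
  proof (rule fin_dim_convergence_criterion[OF M N J(1)])
    show "(\<lambda>\<omega>. c * G n t \<omega> + W n t \<omega>) \<in> borel_measurable M" if "t \<in> J" for n t
      using Gm[of t n] W[of t n] that J by auto
    show "(\<lambda>\<omega>. c * B t \<omega>) \<in> borel_measurable N" if "t \<in> J" for t
      using Bm[of t] that J by auto
    show "integrable M (\<lambda>\<omega>. (c * G n t \<omega> + W n t \<omega>)\<^sup>2)" if "t \<in> J" for n t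
      using X2 that J by auto
    show "integrable N (\<lambda>\<omega>. (c * B t \<omega>)\<^sup>2)" if "t \<in> J" for t
      using B2[of t] that J by (auto simp: power_mult_distrib)
    show "\<exists>V. \<forall>n. (\<integral>\<omega>. (c * G n t \<omega> + W n t \<omega>)\<^sup>2 \<partial>M) \<le> V" if "t \<in> J" for t
    proof -
      have t: "t \<in> T" using that J by auto
      have "(\<lambda>n. 2 * c\<^sup>2 * (\<integral>\<omega>. G n t \<omega> * G n t \<omega> \<partial>M) + 2 * (\<integral>\<omega>. (W n t \<omega>)\<^sup>2 \<partial>M)) \<longlonglongrightarrow>
          2 * c\<^sup>2 * (\<integral>\<omega>. B t \<omega> * B t \<omega> \<partial>N) + 2 * 0"
        by (intro tendsto_intros cov W0 t)
      \<comment> \<open>The criterion asks for a bound valid for every \<open>n\<close>, not just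
        eventually; a convergent real sequence has one.\<close>
      from convergent_imp_Bseq[OF convergentI[OF this]] obtain V where
        V: "\<And>n. norm (2 * c\<^sup>2 * (\<integral>\<omega>. G n t \<omega> * G n t \<omega> \<partial>M) + 2 * (\<integral>\<omega>. (W n t \<omega>)\<^sup>2 \<partial>M)) \<le> V"
        by (auto simp: Bseq_def)
      have "(\<integral>\<omega>. (c * G n t \<omega> + W n t \<omega>)\<^sup>2 \<partial>M) \<le> V" for n
        using X2[OF t, of n] V[of n] by (simp add: abs_le_iff)
      then show ?thesis by blast
    qed
    fix b :: "real \<Rightarrow> real"
    let ?\<Gamma> = "\<lambda>n \<omega>. \<Sum>t\<in>J. c * b t * G n t \<omega>" and ?\<rho> = "\<lambda>n \<omega>. \<Sum>t\<in>J. b t * W n t \<omega>"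
    let ?Y = "\<lambda>\<omega>. \<Sum>t\<in>J. c * b t * B t \<omega>"
    have \<Gamma>g: "gaussian_rv M (?\<Gamma> n)" for n by (rule G[OF J])
    have \<Gamma>m [measurable]: "?\<Gamma> n \<in> borel_measurable M" for n using \<Gamma>g by (simp add: gaussian_rv_def)
    have \<Gamma>0: "(\<integral>\<omega>. ?\<Gamma> n \<omega> \<partial>M) = 0" for n
      using GI G0 J by (subst Bochner_Integration.integral_sum) (auto simp: subset_iff)
    have Yg: "gaussian_rv N ?Y" by (rule B_lin[OF J])
    have Y0: "(\<integral>\<omega>. ?Y \<omega> \<partial>N) = 0"
      using BI B0 J by (subst Bochner_Integration.integral_sum) (auto simp: subset_iff)
    have \<rho>m [measurable]: "?\<rho> n \<in> borel_measurable M" for n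
      using W J by (intro borel_measurable_sum borel_measurable_times) (auto simp: subset_iff)
    have v\<Gamma>: "(\<integral>\<omega>. (?\<Gamma> n \<omega>)\<^sup>2 \<partial>M) = (\<Sum>s\<in>J. \<Sum>t\<in>J. c * b s * (c * b t) * (\<integral>\<omega>. G n s \<omega> * G n t \<omega> \<partial>M))" for n
      unfolding power2_eq_square[of "?\<Gamma> n _"] using J Gm G2
      by (intro integral_product_of_sums(2)) auto
    have vY: "(\<integral>\<omega>. (?Y \<omega>)\<^sup>2 \<partial>N) = (\<Sum>s\<in>J. \<Sum>t\<in>J. c * b s * (c * b t) * (\<integral>\<omega>. B s \<omega> * B t \<omega> \<partial>N))"
      unfolding power2_eq_square[of "?Y _"] using J Bm B2
      by (intro integral_product_of_sums(2)) auto
    have "(\<lambda>n. \<integral>\<omega>. (?\<Gamma> n \<omega>)\<^sup>2 \<partial>M) \<longlonglongrightarrow> (\<integral>\<omega>. (?Y \<omega>)\<^sup>2 \<partial>N)"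
      unfolding v\<Gamma> vY using J by (intro tendsto_sum tendsto_mult_left cov) auto
    then have main: "(\<lambda>n. \<integral>\<omega>. iexp (?\<Gamma> n \<omega>) \<partial>M) \<longlonglongrightarrow> (\<integral>\<omega>. iexp (?Y \<omega>) \<partial>N)"
      unfolding gaussian_rv_char[OF M \<Gamma>g \<Gamma>0] gaussian_rv_char[OF N Yg Y0]
      by (intro tendsto_intros) auto
    have lim: "(\<lambda>n. \<Sum>t\<in>J. \<bar>b t\<bar> * sqrt (\<integral>\<omega>. (W n t \<omega>)\<^sup>2 \<partial>M)) \<longlonglongrightarrow> (\<Sum>t\<in>J. \<bar>b t\<bar> * sqrt 0)"
      using J by (intro tendsto_intros W0) auto
    have bound: "cmod ((\<integral>\<omega>. iexp (?\<Gamma> n \<omega> + ?\<rho> n \<omega>) \<partial>M) - (\<integral>\<omega>. iexp (?\<Gamma> n \<omega>) \<partial>M)) \<le>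
        (\<Sum>t\<in>J. \<bar>b t\<bar> * sqrt (\<integral>\<omega>. (W n t \<omega>)\<^sup>2 \<partial>M))" for n
    proof -
      have i: "integrable M (\<lambda>\<omega>. iexp (?\<Gamma> n \<omega> + ?\<rho> n \<omega>))" "integrable M (\<lambda>\<omega>. iexp (?\<Gamma> n \<omega>))"
        using \<Gamma>m \<rho>m by (auto intro!: M.integrable_iexp borel_measurable_of_real simp del: of_real_add of_real_sum)
      have "cmod ((\<integral>\<omega>. iexp (?\<Gamma> n \<omega> + ?\<rho> n \<omega>) \<partial>M) - (\<integral>\<omega>. iexp (?\<Gamma> n \<omega>) \<partial>M)) =
          cmod (\<integral>\<omega>. iexp (?\<Gamma> n \<omega> + ?\<rho> n \<omega>) - iexp (?\<Gamma> n \<omega>) \<partial>M)"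
        by (subst Bochner_Integration.integral_diff[OF i]) (rule refl)
      also have "\<dots> \<le> (\<integral>\<omega>. cmod (iexp (?\<Gamma> n \<omega> + ?\<rho> n \<omega>) - iexp (?\<Gamma> n \<omega>)) \<partial>M)"
        by (rule integral_norm_bound)
      also have "\<dots> \<le> (\<integral>\<omega>. (\<Sum>t\<in>J. \<bar>b t\<bar> * \<bar>W n t \<omega>\<bar>) \<partial>M)"
      proof (rule integral_mono)
        show "integrable M (\<lambda>\<omega>. cmod (iexp (?\<Gamma> n \<omega> + ?\<rho> n \<omega>) - iexp (?\<Gamma> n \<omega>)))"
          by (rule integrable_norm[OF Bochner_Integration.integrable_diff[OF i]])
        show "integrable M (\<lambda>\<omega>. \<Sum>t\<in>J. \<bar>b t\<bar> * \<bar>W n t \<omega>\<bar>)" using WI J by (auto simp: subset_iff)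
        show "cmod (iexp (?\<Gamma> n \<omega> + ?\<rho> n \<omega>) - iexp (?\<Gamma> n \<omega>)) \<le> (\<Sum>t\<in>J. \<bar>b t\<bar> * \<bar>W n t \<omega>\<bar>)" for \<omega>
          by (rule order_trans[OF cmod_iexp_add_minus_le], rule order_trans[OF sum_abs]) (simp add: abs_mult)
      qed
      also have "\<dots> = (\<Sum>t\<in>J. \<bar>b t\<bar> * (\<integral>\<omega>. \<bar>W n t \<omega>\<bar> \<partial>M))"
        using WI J by (subst Bochner_Integration.integral_sum) (auto simp: subset_iff)
      also have "\<dots> \<le> (\<Sum>t\<in>J. \<bar>b t\<bar> * sqrt (\<integral>\<omega>. (W n t \<omega>)\<^sup>2 \<partial>M))"
        using J W W2 by (intro sum_mono mult_left_mono M.expectation_abs_le_sqrt) auto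
      finally show ?thesis .
    qed
    have "(\<lambda>n. (\<integral>\<omega>. iexp (?\<Gamma> n \<omega> + ?\<rho> n \<omega>) \<partial>M) - (\<integral>\<omega>. iexp (?\<Gamma> n \<omega>) \<partial>M)) \<longlonglongrightarrow> 0"
      by (rule Lim_null_comparison[OF always_eventually]) (use bound lim in auto)
    from tendsto_add[OF this main]
    have "(\<lambda>n. \<integral>\<omega>. iexp (?\<Gamma> n \<omega> + ?\<rho> n \<omega>) \<partial>M) \<longlonglongrightarrow> (\<integral>\<omega>. iexp (?Y \<omega>) \<partial>N)" by simp
    moreover have "?\<Gamma> n \<omega> + ?\<rho> n \<omega> = (\<Sum>t\<in>J. b t * (c * G n t \<omega> + W n t \<omega>))" for n \<omega>
      by (simp add: sum.distrib distrib_left ac_simps)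
    moreover have "?Y \<omega> = (\<Sum>t\<in>J. b t * (c * B t \<omega>))" for \<omega> by (simp add: ac_simps)
    ultimately show "(\<lambda>n. \<integral>\<omega>. iexp (\<Sum>t\<in>J. b t * (c * G n t \<omega> + W n t \<omega>)) \<partial>M) \<longlonglongrightarrow> (\<integral>\<omega>. iexp (\<Sum>t\<in>J. b t * (c * B t \<omega>)) \<partial>N)"
      by (simp only:)
  qed
qed

text \<open>In the expanded square the diagonal contributes O(n^(1-a)) and the other pairs O(n^(-a))
  times the sum of |i - j|^(2(a-2)). An upper bound for the covariances is enough because the whole
  expression is nonnegative.\<close>

lemma second_chaos_sum_tendsto_0:
  fixes H K :: real and M :: "'a measure" and \<xi> :: "nat \<Rightarrow> 'a \<Rightarrow> real"
  assumes HK: "0 < H" "H < 1" "0 < K" "K < 1" "2 * H * K > 1"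
    and M: "prob_space M" and gauss: "gaussian_process M {1..} \<xi>"
    and std: "\<And>j. j \<ge> 1 \<Longrightarrow> distributed M lborel (\<xi> j) std_normal_density"
    and cov: "\<And>i j. i \<ge> 1 \<Longrightarrow> j \<ge> 1 \<Longrightarrow> i \<noteq> j \<Longrightarrow>
           (\<integral>\<omega>. \<xi> i \<omega> * \<xi> j \<omega> \<partial>M) = g_kernel H K (real i) (real j)"
    and h [measurable]: "h \<in> borel_measurable borel"
    and h2: "integrable lborel (\<lambda>x. std_normal_density x * (h x)\<^sup>2)"
    and h0: "(\<integral>x. std_normal_density x * h x \<partial>lborel) = 0"
    and h1: "(\<integral>x. std_normal_density x * (x * h x) \<partial>lborel) = 0"
    and t: "t \<ge> 0"
  shows "(\<lambda>n. \<integral>\<omega>. (real n powr (- (H * K)) * (\<Sum>j=1..nat \<lfloor>real n * t\<rfloor>. h (\<xi> j \<omega>)))\<^sup>2 \<partial>M) \<longlonglongrightarrow> 0"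
proof -
  interpret prob_space M by fact
  define a where "a = 2 * H * K"
  note a = a_bounds[OF HK a_def]
  have \<xi>m [measurable]: "\<xi> j \<in> borel_measurable M" if "j \<ge> 1" for j
    using distributed_measurable[OF std[OF that]] by simp
  have mom: "(\<integral>\<omega>. \<xi> j \<omega> \<partial>M) = 0" "(\<integral>\<omega>. (\<xi> j \<omega>)\<^sup>2 \<partial>M) = 1" if "j \<ge> 1" for j
    using distributed_integral[OF std[OF that], of "\<lambda>x. x"] distributed_integral[OF std[OF that], of "\<lambda>x. x\<^sup>2"]
      integral_std_normal_moment_odd[of 0] integral_std_normal_moment_even[of 1] by simp_all
  define v where "v = (\<integral>x. std_normal_density x * (h x)\<^sup>2 \<partial>lborel)"
  \<comment> \<open>\<open>second_chaos_covariance_bound\<close> wants a positive bound, while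
    \<open>v\<close> is 0 when f is linear.\<close>
  define V where "V = v + 1"
  have v0: "v \<ge> 0" by (simp add: v_def)
  have V: "V > 0" "v \<le> V" using v0 by (simp_all add: V_def)
  have hm [measurable]: "(\<lambda>\<omega>. h (\<xi> j \<omega>)) \<in> borel_measurable M" if "j \<ge> 1" for j
    using measurable_compose[OF \<xi>m[OF that] h] .
  have hI: "integrable M (\<lambda>\<omega>. (h (\<xi> j \<omega>))\<^sup>2)" if "j \<ge> 1" for j
    using distributed_integrable[OF std[OF that], of "\<lambda>x. (h x)\<^sup>2"] h2 by simp
  have hv: "(\<integral>\<omega>. (h (\<xi> j \<omega>))\<^sup>2 \<partial>M) = v" if "j \<ge> 1" for j
    using distributed_integral[OF std[OF that], of "\<lambda>x. (h x)\<^sup>2"] by (simp add: v_def)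
  define d where "d = (\<lambda>i j :: nat. (\<bar>real i - real j\<bar> powr (a - 2))\<^sup>2)"
  have cov_h: "(\<integral>\<omega>. h (\<xi> i \<omega>) * h (\<xi> j \<omega>) \<partial>M) \<le> 144 * V * d i j"
    if ij: "i \<ge> 1" "j \<ge> 1" "i \<noteq> j" for i j
  proof -
    define r where "r = 36 * d i j"
    have r: "r > 0" using ij by (simp add: r_def d_def)
    have "(g_kernel H K (real i) (real j))\<^sup>2 \<le> (6 * \<bar>real i - real j\<bar> powr (a - 2))\<^sup>2"
      using g_kernel_bound[OF HK a_def, of "real i" "real j"] ij
      by (intro abs_le_square_iff[THEN iffD1]) auto
    then have rho: "(g_kernel H K (real i) (real j))\<^sup>2 \<le> r" by (simp add: r_def d_def power_mult_distrib)
    \<comment> \<open>The Gebelein bound is available for r \<le> 1/4 only. For larger r the trivial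
      bound \<open>v\<close> already suffices, as 1 < 4 r; this is the origin of the 4, and 144 is 4
      times the 36 in \<open>r\<close>.\<close>
    have "(\<integral>\<omega>. h (\<xi> i \<omega>) * h (\<xi> j \<omega>) \<partial>M) \<le> 4 * r * V"
    proof (cases "r \<le> 1 / 4")
      case True
      have "gaussian_rv M (\<lambda>\<omega>. p * \<xi> i \<omega> + q * \<xi> j \<omega>)" for p q
      proof -
        have "gaussian_rv M (\<lambda>\<omega>. \<Sum>k\<in>J. b k * \<xi> k \<omega>)" if "finite J" "J \<subseteq> {1..}" for J b
          using gauss that unfolding gaussian_process_def by simp
        from this[of "{i, j}" "\<lambda>k. if k = i then p else q"] show ?thesis using ij by simp
      qed
      from second_chaos_covariance_bound[OF M \<xi>m[OF ij(1)] \<xi>m[OF ij(2)] this mom(1)[OF ij(1)] mom(1)[OF ij(2)]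
          mom(2)[OF ij(1)] mom(2)[OF ij(2)] cov[OF ij] rho r True h h2 V(2)[unfolded v_def] V(1) h0 h1]
      have "(\<integral>\<omega>. h (\<xi> i \<omega>) * h (\<xi> j \<omega>) \<partial>M) \<le> 2 * r * V" by linarith
      moreover have "0 \<le> r * V" using r V by simp
      ultimately show ?thesis by linarith
    next
      case False
      have "(\<integral>\<omega>. h (\<xi> i \<omega>) * h (\<xi> j \<omega>) \<partial>M) \<le> (\<integral>\<omega>. ((h (\<xi> i \<omega>))\<^sup>2 + (h (\<xi> j \<omega>))\<^sup>2) / 2 \<partial>M)"
      proof (rule integral_mono)
        show "integrable M (\<lambda>\<omega>. h (\<xi> i \<omega>) * h (\<xi> j \<omega>))"
          using ij hm hI by (intro integrable_mult_of_squares) auto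
        show "integrable M (\<lambda>\<omega>. ((h (\<xi> i \<omega>))\<^sup>2 + (h (\<xi> j \<omega>))\<^sup>2) / 2)" using ij hI by auto
        show "h (\<xi> i \<omega>) * h (\<xi> j \<omega>) \<le> ((h (\<xi> i \<omega>))\<^sup>2 + (h (\<xi> j \<omega>))\<^sup>2) / 2" for \<omega>
          using sum_squares_bound[of "h (\<xi> i \<omega>)" "h (\<xi> j \<omega>)"] by simp
      qed
      also have "\<dots> = v" using ij hI hv by simp
      also have "\<dots> \<le> 1 * V" using V by simp
      also have "\<dots> \<le> (4 * r) * V" using False V by (intro mult_right_mono) auto
      finally show ?thesis .
    qed
    then show ?thesis by (simp add: r_def ac_simps)
  qed
  let ?N = "\<lambda>n. nat \<lfloor>real n * t\<rfloor>"
  let ?D = "\<lambda>n. \<Sum>i=1..?N n. \<Sum>j=1..?N n. if i = j then 0 else \<bar>d i j\<bar>"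
  show ?thesis
  proof (rule Lim_null_comparison)
    show "\<forall>\<^sub>F n in sequentially. norm (\<integral>\<omega>. (real n powr (- (H * K)) * (\<Sum>j=1..?N n. h (\<xi> j \<omega>)))\<^sup>2 \<partial>M)
      \<le> v * t * real n powr (1 - a) + 144 * V * (real n powr (- a) * ?D n)"
      using eventually_gt_at_top[of 0]
    proof eventually_elim
      case (elim n)
      define p where "p = real n powr (- (H * K))"
      have pp: "p * p = real n powr (- a)" by (simp add: p_def a_def mult.assoc flip: powr_add)
      have "(\<integral>\<omega>. (p * (\<Sum>j=1..?N n. h (\<xi> j \<omega>)))\<^sup>2 \<partial>M) =
          (\<integral>\<omega>. (\<Sum>i=1..?N n. p * h (\<xi> i \<omega>)) * (\<Sum>j=1..?N n. p * h (\<xi> j \<omega>)) \<partial>M)"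
        by (simp add: power2_eq_square sum_distrib_left)
      also have "\<dots> = (\<Sum>i=1..?N n. \<Sum>j=1..?N n. p * p * (\<integral>\<omega>. h (\<xi> i \<omega>) * h (\<xi> j \<omega>) \<partial>M))"
        using hm hI by (intro integral_product_of_sums(2)) auto
      also have "\<dots> \<le> (\<Sum>i=1..?N n. \<Sum>j=1..?N n. p * p * ((if i = j then v else 0) + 144 * V * (if i = j then 0 else \<bar>d i j\<bar>)))"
      proof (intro sum_mono mult_left_mono)
        fix i j assume "i \<in> {1..?N n}" "j \<in> {1..?N n}"
        then show "(\<integral>\<omega>. h (\<xi> i \<omega>) * h (\<xi> j \<omega>) \<partial>M) \<le> (if i = j then v else 0) + 144 * V * (if i = j then 0 else \<bar>d i j\<bar>)"
          using cov_h[of i j] hv[of i] by (auto simp: power2_eq_square d_def)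
      qed simp
      also have "\<dots> = p * p * ((\<Sum>i=1..?N n. \<Sum>j=1..?N n. if i = j then v else 0) + 144 * V * ?D n)"
        by (simp only: sum.distrib sum_distrib_left distrib_left)
      also have "(\<Sum>i=1..?N n. \<Sum>j=1..?N n. if i = j then v else 0) = real (?N n) * v"
        by simp
      also have "p * p * (real (?N n) * v + 144 * V * ?D n) \<le> p * p * (real n * t * v + 144 * V * ?D n)"
        using t v0 by (intro mult_left_mono add_right_mono mult_right_mono) auto
      also have "\<dots> = v * t * (real n powr (- a) * real n) + 144 * V * (real n powr (- a) * ?D n)"
        unfolding pp by (simp add: algebra_simps)
      also have "real n powr (- a) * real n = real n powr (1 - a)"
        using elim by (simp add: powr_diff powr_minus divide_inverse)
      finally show ?case by (simp add: p_def)
    qed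
    have "(\<lambda>n. v * t * real n powr (1 - a) + 144 * V * (real n powr (- a) * ?D n)) \<longlonglongrightarrow> v * t * 0 + 144 * V * 0"
      unfolding d_def using a t by (intro tendsto_intros powr_tendsto_0 offdiag_square_sum_tendsto_0) auto
    then show "(\<lambda>n. v * t * real n powr (1 - a) + 144 * V * (real n powr (- a) * ?D n)) \<longlonglongrightarrow> 0" by simp
  qed
qed

text \<open>Interchanging the sums yields one linear combination of finitely many \<xi>, which is
  Gaussian by joint normality.\<close>

lemma gaussian_rv_partial_sums:
  fixes \<xi> :: "nat \<Rightarrow> 'a \<Rightarrow> real"
  assumes gauss: "gaussian_process M {1..} \<xi>" and J: "finite J"
  shows "gaussian_rv M (\<lambda>\<omega>. \<Sum>t\<in>J. b t * (p * (\<Sum>j=1..L t. \<xi> j \<omega>)))"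
proof -
  \<comment> \<open>A common upper bound for all \<open>L t\<close>; taking the sum also covers an
    empty \<open>J\<close>.\<close>
  define m where "m = (\<Sum>t\<in>J. L t)"
  have L: "L t \<le> m" if "t \<in> J" for t unfolding m_def using J that by (intro member_le_sum) auto
  have "(\<Sum>t\<in>J. b t * (p * (\<Sum>j=1..L t. \<xi> j \<omega>))) = (\<Sum>j=1..m. (\<Sum>t\<in>J. if j \<le> L t then b t * p else 0) * \<xi> j \<omega>)" for \<omega>
  proof -
    have "(\<Sum>j=1..L t. \<xi> j \<omega>) = (\<Sum>j=1..m. if j \<le> L t then \<xi> j \<omega> else 0)" if "t \<in> J" for t
      using L[OF that] by (intro sum.mono_neutral_cong_left) auto
    then have "(\<Sum>t\<in>J. b t * (p * (\<Sum>j=1..L t. \<xi> j \<omega>))) = (\<Sum>t\<in>J. \<Sum>j=1..m. b t * (p * (if j \<le> L t then \<xi> j \<omega> else 0)))"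
      by (simp add: sum_distrib_left)
    also have "\<dots> = (\<Sum>j=1..m. \<Sum>t\<in>J. b t * (p * (if j \<le> L t then \<xi> j \<omega> else 0)))" by (rule sum.swap)
    also have "\<dots> = (\<Sum>j=1..m. (\<Sum>t\<in>J. if j \<le> L t then b t * p else 0) * \<xi> j \<omega>)"
      by (intro sum.cong refl) (auto simp: sum_distrib_right intro!: sum.cong)
    finally show ?thesis .
  qed
  moreover have "gaussian_rv M (\<lambda>\<omega>. \<Sum>j=1..m. (\<Sum>t\<in>J. if j \<le> L t then b t * p else 0) * \<xi> j \<omega>)"
    using gauss unfolding gaussian_process_def by auto
  ultimately show ?thesis by simp
qed

theorem proposition6p4:
  fixes H K :: real
    and M :: "'a measure" and \<xi> :: "nat \<Rightarrow> 'a \<Rightarrow> real"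
    and f :: "real \<Rightarrow> real" and c\<^sub>1 :: real and \<eta> :: "nat \<Rightarrow> 'a \<Rightarrow> real"
    and N :: "'b measure" and B :: "real \<Rightarrow> 'b \<Rightarrow> real"
  assumes "0 < H" "H < 1" "0 < K" "K < 1" "2 * H * K > 1"
    and "prob_space M"
    and "gaussian_process M {1..} \<xi>"
    and "\<And>j. j \<ge> 1 \<Longrightarrow> distributed M lborel (\<xi> j) std_normal_density"
    and "\<And>i j. i \<ge> 1 \<Longrightarrow> j \<ge> 1 \<Longrightarrow> i \<noteq> j \<Longrightarrow>
           (\<integral>\<omega>. \<xi> i \<omega> * \<xi> j \<omega> \<partial>M) = g_kernel H K (real i) (real j)"
    and "f \<in> borel_measurable borel"
    and "emeasure lborel {x. f x \<noteq> 0} > 0"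
    and "(\<integral>\<omega>. f (\<xi> 1 \<omega>) \<partial>M) = 0"
    and "integrable M (\<lambda>\<omega>. (f (\<xi> 1 \<omega>))\<^sup>2)"
    and "c\<^sub>1 = (\<integral>\<omega>. f (\<xi> 1 \<omega>) * \<xi> 1 \<omega> \<partial>M)"
    and "c\<^sub>1 \<noteq> 0"
    and "\<And>j \<omega>. j \<ge> 1 \<Longrightarrow> \<eta> j \<omega> = f (\<xi> j \<omega>)"
    and "prob_space N"
    and "bifractional_brownian_motion H K N B"
  shows "fdd_converges {0..} M
           (\<lambda>n t \<omega>. real n powr (- (H * K)) * (\<Sum>j = 1..nat \<lfloor>real n * t\<rfloor>. \<eta> j \<omega>))
           N (\<lambda>t \<omega>. c\<^sub>1 * B t \<omega>)"
proof -
  note HK = assms(1-5) and M = assms(6) and gauss = assms(7) and std = assms(8) and cov = assms(9)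
    and f [measurable] = assms(10) and f0 = assms(12) and f2 = assms(13) and c1 = assms(14) and \<eta> = assms(16)
    and N = assms(17) and B = assms(18)[unfolded bifractional_brownian_motion_def]
  interpret prob_space M by fact
  define a where "a = 2 * H * K"
  define h where "h = (\<lambda>x. f x - c\<^sub>1 * x)"
  have h [measurable]: "h \<in> borel_measurable borel" unfolding h_def by measurable
  have \<xi>m: "\<xi> j \<in> borel_measurable M" if "j \<ge> 1" for j
    using distributed_measurable[OF std[OF that]] by simp
  note [measurable] = \<xi>m[of 1, simplified]
  have \<xi>2: "integrable M (\<lambda>\<omega>. (\<xi> j \<omega>)\<^sup>2)" if "j \<ge> 1" for j
    using distributed_integrable[OF std[OF that], of "\<lambda>x. x\<^sup>2"] integrable_std_normal_moment[of 2] by simp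
  have \<xi>1: "integrable M (\<xi> j)" if "j \<ge> 1" for j
    by (rule square_integrable_imp_integrable[OF \<xi>m[OF that] \<xi>2[OF that]])
  have mom: "(\<integral>\<omega>. \<xi> j \<omega> \<partial>M) = 0" "(\<integral>\<omega>. (\<xi> j \<omega>)\<^sup>2 \<partial>M) = 1" if "j \<ge> 1" for j
    using distributed_integral[OF std[OF that], of "\<lambda>x. x"] distributed_integral[OF std[OF that], of "\<lambda>x. x\<^sup>2"]
      integral_std_normal_moment_odd[of 0] integral_std_normal_moment_even[of 1] by simp_all
  have f1: "integrable M (\<lambda>\<omega>. f (\<xi> 1 \<omega>))"
    by (rule square_integrable_imp_integrable[OF _ f2]) simp
  have f\<xi>: "integrable M (\<lambda>\<omega>. f (\<xi> 1 \<omega>) * \<xi> 1 \<omega>)"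
    by (rule integrable_mult_of_squares[OF _ _ f2 \<xi>2]) simp_all
  have h2M: "integrable M (\<lambda>\<omega>. (h (\<xi> 1 \<omega>))\<^sup>2)"
  proof -
    have "integrable M (\<lambda>\<omega>. (f (\<xi> 1 \<omega>))\<^sup>2 - 2 * c\<^sub>1 * (f (\<xi> 1 \<omega>) * \<xi> 1 \<omega>) + c\<^sub>1\<^sup>2 * (\<xi> 1 \<omega>)\<^sup>2)"
      using f2 f\<xi> \<xi>2[of 1] by (intro Bochner_Integration.integrable_add Bochner_Integration.integrable_diff integrable_mult_right) auto
    then show ?thesis by (simp add: h_def power2_diff power_mult_distrib algebra_simps)
  qed
  \<comment> \<open>The assumptions on f concern the first variable only. Rewritten as integrals
    against the standard normal density they become available for every index.\<close>
  have h2: "integrable lborel (\<lambda>x. std_normal_density x * (h x)\<^sup>2)"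
    using distributed_integrable[OF std[of 1], of "\<lambda>x. (h x)\<^sup>2"] h2M by simp
  have "(\<integral>\<omega>. h (\<xi> 1 \<omega>) \<partial>M) = 0"
    using f1 f0 \<xi>1[of 1] mom(1)[of 1] by (simp add: h_def)
  then have h0: "(\<integral>x. std_normal_density x * h x \<partial>lborel) = 0"
    using distributed_integral[OF std[of 1], of h] by simp
  \<comment> \<open>The unit variance makes c1 exactly the coefficient whose removal leaves
    \<open>h\<close> orthogonal to x.\<close>
  have "(\<integral>\<omega>. \<xi> 1 \<omega> * h (\<xi> 1 \<omega>) \<partial>M) = (\<integral>\<omega>. f (\<xi> 1 \<omega>) * \<xi> 1 \<omega> - c\<^sub>1 * (\<xi> 1 \<omega>)\<^sup>2 \<partial>M)"
    by (simp add: h_def power2_eq_square algebra_simps)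
  also have "\<dots> = 0" using f\<xi> \<xi>2[of 1] mom(2)[of 1] c1 by simp
  finally have h1: "(\<integral>x. std_normal_density x * (x * h x) \<partial>lborel) = 0"
    using distributed_integral[OF std[of 1], of "\<lambda>x. x * h x"] by simp
  have hm: "(\<lambda>\<omega>. h (\<xi> j \<omega>)) \<in> borel_measurable M" if "j \<ge> 1" for j
    using measurable_compose[OF \<xi>m[OF that] h] .
  have hI: "integrable M (\<lambda>\<omega>. (h (\<xi> j \<omega>))\<^sup>2)" if "j \<ge> 1" for j
    using distributed_integrable[OF std[OF that], of "\<lambda>x. (h x)\<^sup>2"] h2 by simp
  define p where "p = (\<lambda>n. real n powr (- (H * K)))"
  define L where "L = (\<lambda>n t. nat \<lfloor>real n * t\<rfloor>)"
  define G where "G = (\<lambda>n t \<omega>. p n * (\<Sum>j=1..L n t. \<xi> j \<omega>))"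
  define W where "W = (\<lambda>n t \<omega>. p n * (\<Sum>j=1..L n t. h (\<xi> j \<omega>)))"
  have pp: "p n * p n = real n powr (- a)" for n by (simp add: p_def a_def mult.assoc flip: powr_add)
  have "fdd_converges {0..} M (\<lambda>n t \<omega>. c\<^sub>1 * G n t \<omega> + W n t \<omega>) N (\<lambda>t \<omega>. c\<^sub>1 * B t \<omega>)"
  proof (rule fdd_converges_gaussian_perturbation[OF M N])
    show "gaussian_rv M (\<lambda>\<omega>. \<Sum>t\<in>J. b t * G n t \<omega>)" if "finite J" for n J b
      unfolding G_def by (rule gaussian_rv_partial_sums[OF gauss that])
    show "(\<integral>\<omega>. G n t \<omega> \<partial>M) = 0" for n t
      unfolding G_def using \<xi>1 mom(1) by (simp add: Bochner_Integration.integral_sum)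
    show "W n t \<in> borel_measurable M" for n t
      unfolding W_def using hm by (intro borel_measurable_times borel_measurable_sum) auto
    show "integrable M (\<lambda>\<omega>. (W n t \<omega>)\<^sup>2)" for n t
    proof -
      have "integrable M (\<lambda>\<omega>. (\<Sum>i=1..L n t. p n * h (\<xi> i \<omega>)) * (\<Sum>j=1..L n t. p n * h (\<xi> j \<omega>)))"
        using hm hI by (intro integral_product_of_sums(1)) auto
      then show ?thesis by (simp add: W_def power2_eq_square sum_distrib_left)
    qed
    show "(\<lambda>n. \<integral>\<omega>. (W n t \<omega>)\<^sup>2 \<partial>M) \<longlonglongrightarrow> 0" if "t \<in> {0..}" for t
      unfolding W_def p_def L_def
      using that by (intro second_chaos_sum_tendsto_0[OF HK M gauss std cov h h2 h0 h1]) auto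
    show "(\<integral>\<omega>. B t \<omega> \<partial>N) = 0" if "t \<in> {0..}" for t
      using B that by auto
    show "gaussian_process N {0..} B" using B by auto
    fix s t :: real assume st: "s \<in> {0..}" "t \<in> {0..}"
    have "(\<integral>\<omega>. G n s \<omega> * G n t \<omega> \<partial>M) =
        real n powr (- a) * (\<Sum>i=1..L n s. \<Sum>j=1..L n t. if i = j then 1 else g_kernel H K (real i) (real j))" for n
    proof -
      have "(\<integral>\<omega>. G n s \<omega> * G n t \<omega> \<partial>M) =
          (\<integral>\<omega>. (\<Sum>i=1..L n s. p n * \<xi> i \<omega>) * (\<Sum>j=1..L n t. p n * \<xi> j \<omega>) \<partial>M)"
        by (simp add: G_def sum_distrib_left)
      also have "\<dots> = (\<Sum>i=1..L n s. \<Sum>j=1..L n t. p n * p n * (\<integral>\<omega>. \<xi> i \<omega> * \<xi> j \<omega> \<partial>M))"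
        using \<xi>m \<xi>2 by (intro integral_product_of_sums(2)) auto
      also have "\<dots> = (\<Sum>i=1..L n s. \<Sum>j=1..L n t. p n * p n * (if i = j then 1 else g_kernel H K (real i) (real j)))"
      proof (intro sum.cong refl)
        fix i j assume "i \<in> {1..L n s}" "j \<in> {1..L n t}"
        then show "p n * p n * (\<integral>\<omega>. \<xi> i \<omega> * \<xi> j \<omega> \<partial>M) = p n * p n * (if i = j then 1 else g_kernel H K (real i) (real j))"
          using cov[of i j] mom(2)[of i] by (auto simp: power2_eq_square)
      qed
      finally show ?thesis unfolding pp by (simp only: sum_distrib_left)
    qed
    moreover have "(\<integral>\<omega>. B s \<omega> * B t \<omega> \<partial>N) = bifractional_cov H K s t" using B st by auto
    ultimately show "(\<lambda>n. \<integral>\<omega>. G n s \<omega> * G n t \<omega> \<partial>M) \<longlonglongrightarrow> (\<integral>\<omega>. B s \<omega> * B t \<omega> \<partial>N)"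
      using kernel_sum_tendsto[OF HK a_def, of s t] st by (simp add: L_def)
  qed
  moreover have "c\<^sub>1 * G n t \<omega> + W n t \<omega> = real n powr (- (H * K)) * (\<Sum>j = 1..nat \<lfloor>real n * t\<rfloor>. \<eta> j \<omega>)" for n t \<omega>
  proof -
    have "(\<Sum>j=1..L n t. \<eta> j \<omega>) = (\<Sum>j=1..L n t. c\<^sub>1 * \<xi> j \<omega> + h (\<xi> j \<omega>))"
      using \<eta> by (intro sum.cong) (auto simp: h_def)
    then show ?thesis
      by (simp add: G_def W_def p_def L_def sum.distrib sum_distrib_left distrib_left mult.left_commute)
  qed
  ultimately show ?thesis by simp
qed

end
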